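(* Let $g:[0,\infty)\to[0,\infty)$ with $0<\rho=\int_0^\infty g(t)\,\mathrm{d}t<1$, and consider the Hawkes process cluster with excitation kernel $g$, with arrival epochs $0=A_0<A_1<\dots<A_{N-1}$ and total size $N$ (including the initial time-$0$ event). Let $G(t)=\int_0^t g(u)\,\mathrm{d}u$ and let $\Lambda_i=\sum_{j=0}^{i-1}G(A_i-A_j)$, $1\le i\le N-1$, be the compensator points. Then for every $k\in\{1,2,\dots\}$, given that $N=k+1$, the conditional joint density of $(\Lambda_1,\dots,\Lambda_k)$ is $$f(\Lambda_1,\Lambda_2,\dots,\Lambda_k\mid N=k+1)=\left(\frac{1}{\rho}\right)^k\frac{(k+1)!}{(k+1)^k}$$ for all $0<\Lambda_1<\dots<\Lambda_k<k\rho$ with $\Lambda_i<i\rho$ for all $i\in\{1,\dots,k\}$. Hence, conditionally on $N$, the vector $\Lambda=(\Lambda_1,\dots,\Lambda_{N-1})$ is uniformly distributed on the polytope $\mathcal{P}_{N-1}$, where $$\mathcal{P}_k=\{x\in\mathbb{R}_+^k \mid x_i<i\rho\ \ \forall\,1\le i\le k,\ \ x_i<x_{i+1}\ \ \forall\,1\le i\le k-1\}.$$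
   Context: Hawkes process cluster with excitation kernel $g$: a point process $(N_t)_{t\ge0}$ with natural filtration $(\mathcal{F}_t)$, started with one event at time $A_0=0$ (which is counted by $N_t$), with epochs $A_0<A_1<\cdots$, such that as $\delta\downarrow 0$, $\mathrm{P}(N_{t+\delta}-N_t=1\mid\mathcal{F}_t)=\lambda_t\delta+o(\delta)$, $\mathrm{P}(N_{t+\delta}-N_t=0\mid\mathcal{F}_t)=1-\lambda_t\delta+o(\delta)$, $\mathrm{P}(N_{t+\delta}-N_t>1\mid\mathcal{F}_t)=o(\delta)$, where the conditional intensity is $\lambda_t=\sum_{i=0}^{N_t-1}g(t-A_i)$ (there is no exogenous baseline intensity). Equivalently (Hawkes and Oakes), starting from the time-$0$ event, each event at time $s$ independently generates direct offspring according to an inhomogeneous Poisson process with rate $g(t-s)$, $t>s$, and the cluster consists of the initial event and all its descendants. Since $\rho<1$, the cluster size $N=\lim_{t\to\infty}N_t$ is almost surely finite. The compensator is $\Lambda(t)=\int_0^t\lambda_s\,\mathrm{d}s$, and $\Lambda_i=\Lambda(A_i)$. $\mathbb{R}_+=[0,\infty)$. *)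

theory Defs
  imports "HOL-Probability.Probability"
begin

text \<open>
  Random point sets on the real line. The \<sigma>-algebra is the one generated by the counts on Borel sets.
  Since \<open>card\<close> of an infinite set is 0, finiteness is carried along explicitly.
\<close>

definition config_space :: "real set measure" where
  "config_space =
     sigma UNIV {{S. finite (S \<inter> B) \<and> card (S \<inter> B) = n} | B n. B \<in> sets borel}"

text \<open>
  Inhomogeneous Poisson process with rate \<open>r\<close>. For a nonnegative rate, \<open>set_integrable lborel B r\<close>
  says that the mean number of points in \<open>B\<close> is finite. The Poisson probabilities are written out
  because \<open>poisson_pmf\<close> requires a strictly positive mean.
\<close>

definition poisson_process :: "'a measure \<Rightarrow> (real \<Rightarrow> real) \<Rightarrow> ('a \<Rightarrow> real set) \<Rightarrow> bool" where
  "poisson_process M r \<Phi> \<longleftrightarrow>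
     \<Phi> \<in> measurable M config_space \<and>
     (\<forall>B\<in>sets borel. set_integrable lborel B r \<longrightarrow>
        (\<forall>n. measure M {\<omega> \<in> space M. finite (\<Phi> \<omega> \<inter> B) \<and> card (\<Phi> \<omega> \<inter> B) = n} =
             (LINT t:B|lborel. r t) ^ n / fact n * exp (- (LINT t:B|lborel. r t)))) \<and>
     (\<forall>(m::nat) B. (\<forall>i<m. B i \<in> sets borel) \<and> disjoint_family_on B {..<m} \<longrightarrow>
        prob_space.indep_vars M (\<lambda>_. count_space UNIV) (\<lambda>i \<omega>. card (\<Phi> \<omega> \<inter> B i)) {..<m})"

text \<open>
  Potential individuals of the cluster carry Ulam-Harris labels: \<open>[]\<close> is the initial event and
  \<open>u @ [i]\<close> is the \<open>i\<close>-th direct offspring (in order of birth, from 0) of \<open>u\<close>. The set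
  \<open>\<Phi> u \<omega>\<close> holds the birth times of the direct offspring of \<open>u\<close> relative to the time \<open>s\<close> of \<open>u\<close>,
  so in absolute time they form a Poisson process with rate \<open>g (t - s)\<close>, \<open>t > s\<close>.
\<close>

definition hawkes_offspring ::
    "'a measure \<Rightarrow> (real \<Rightarrow> real) \<Rightarrow> (nat list \<Rightarrow> 'a \<Rightarrow> real set) \<Rightarrow> bool" where
  "hawkes_offspring M g \<Phi> \<longleftrightarrow>
     (\<forall>u. poisson_process M (\<lambda>t. if 0 < t then g t else 0) (\<Phi> u)) \<and>
     prob_space.indep_vars M (\<lambda>_. config_space) \<Phi> UNIV"

text \<open>
  The labelled events, with their times, for one realisation \<open>F\<close> of the offspring sets: the initial
  event at time 0 and all its descendants.
\<close>

inductive_set cluster :: "(nat list \<Rightarrow> real set) \<Rightarrow> (nat list \<times> real) set"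
  for F :: "nat list \<Rightarrow> real set" where
  root: "([], 0) \<in> cluster F"
| offspring: "(u, s) \<in> cluster F \<Longrightarrow> i < card (F u) \<Longrightarrow>
    (u @ [i], s + sorted_list_of_set (F u) ! i) \<in> cluster F"

definition event_times :: "(nat list \<Rightarrow> real set) \<Rightarrow> real set" where
  "event_times F = snd ` cluster F"

text \<open>
  Total size \<open>N\<close> and epochs \<open>A\<^sub>0 < \<dots> < A\<^sub>N\<^sub>-\<^sub>1\<close>. Coinciding event times and an
  infinite cluster are null events; in the latter case the value of \<open>cluster_size\<close> is 0, which a
  finite cluster never takes.
\<close>

definition cluster_size :: "(nat list \<Rightarrow> real set) \<Rightarrow> nat" where
  "cluster_size F = card (event_times F)"

definition epoch :: "(nat list \<Rightarrow> real set) \<Rightarrow> nat \<Rightarrow> real" where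
  "epoch F i = sorted_list_of_set (event_times F) ! i"

definition kernel_integral :: "(real \<Rightarrow> real) \<Rightarrow> real \<Rightarrow> real" where
  "kernel_integral g t = (LINT u:{0..t}|lborel. g u)"

definition compensator_point :: "(real \<Rightarrow> real) \<Rightarrow> (nat list \<Rightarrow> real set) \<Rightarrow> nat \<Rightarrow> real" where
  "compensator_point g F i = (\<Sum>j<i. kernel_integral g (epoch F i - epoch F j))"

text \<open>
  Vectors in \<open>\<real>\<^sup>k\<close> are extensional functions on \<open>{1..k}\<close>; the reference measure is the
  \<open>k\<close>-fold product of \<open>lborel\<close>.
\<close>

abbreviation lebesgue_prod :: "nat \<Rightarrow> (nat \<Rightarrow> real) measure" where
  "lebesgue_prod k \<equiv> Pi\<^sub>M {1..k} (\<lambda>_. lborel)"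

definition hawkes_polytope :: "real \<Rightarrow> nat \<Rightarrow> (nat \<Rightarrow> real) set" where
  "hawkes_polytope \<rho> k =
     {x \<in> {1..k} \<rightarrow>\<^sub>E {0..}. (\<forall>i\<in>{1..k}. x i < real i * \<rho>) \<and> (\<forall>i\<in>{1..<k}. x i < x (i + 1))}"

end

theory Submission
  imports Defs
begin

text \<open>
  A cluster of \<open>k + 1\<close> events with distinct times \<open>0 = t\<^sub>0 < \<dots> < t\<^sub>k\<close> is determined by the times
  and the function \<open>p\<close> sending each event to its parent, an earlier event. For fixed \<open>p\<close>, the
  birth times relative to the parents have density \<open>exp (- (k + 1) \<rho>) \<Prod> g (t\<^sub>i - t\<^bsub>p i\<^esub>)\<close>, and
  passing from relative to absolute times preserves Lebesgue measure. Summing over all \<open>p\<close> turns the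
  product into the product of the intensities \<open>\<Sum>j<i. g (t\<^sub>i - t\<^sub>j)\<close>, which is exactly the Jacobian
  of the map from epochs to compensator points. So on the event \<open>N = k + 1\<close> these points have
  constant density \<open>exp (- (k + 1) \<rho>)\<close> on the polytope, and the volume of the polytope gives the
  normalisation.
\<close>

section \<open>Ranks in finite sets and measurability of random point sets\<close>

text \<open>Three obstacles shape the argument. The Poisson hypothesis speaks only of counts in
  Borel sets, while the joint law of sorted offspring times is needed. Counts do give the
  probability that each sorted point lies in its own box when the boxes of siblings are ordered left
  to right; each box then holds one point, so no factorials appear, and such boxes identify the law
  on the ordered cone. The kernel is merely integrable: it may vanish on intervals, so the
  compensator can be flat and no smooth bijection is at hand. The Jacobian is replaced, one
  coordinate at a time, by the fact that an atomless finite measure is carried by its own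
  distribution function to Lebesgue measure on an interval. Ties between event times have to be
  excluded almost surely, because epochs are read off a set. The factor exp (- rho) occurs once per
  event: it is the void factor of one whole offspring process, whatever the number of children. The
  volume of the polytope is rho^k (k+1)^(k-1) / k!, where (k+1)^(k-1) is the number of labelled
  trees on k + 1 vertices; with it N gets the Borel distribution.\<close>

lemma sorted_list_of_set_nth_rank:
  fixes S :: "'a::linorder set"
  assumes "finite S" "x \<in> S"
  shows "sorted_list_of_set S ! card {s\<in>S. s < x} = x"
proof -
  let ?xs = "sorted_list_of_set S"
  obtain r where r: "r < length ?xs" "?xs ! r = x"
    using assms by (metis in_set_conv_nth set_sorted_list_of_set)
  have sl: "sorted_wrt (<) ?xs" by simp
  have "{s\<in>S. s < x} = (!) ?xs ` {..<r}"
  proof (intro equalityI subsetI)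
    fix s assume s: "s \<in> {s\<in>S. s < x}"
    then obtain q where q: "q < length ?xs" "?xs ! q = s"
      using assms by (metis (lifting) in_set_conv_nth mem_Collect_eq set_sorted_list_of_set)
    have "q < r"
    proof (rule ccontr)
      assume "\<not> q < r"
      then have "?xs ! r \<le> ?xs ! q" using q r by (intro sorted_nth_mono) auto
      then show False using q r s by auto
    qed
    then show "s \<in> (!) ?xs ` {..<r}" using q by auto
  next
    fix s assume "s \<in> (!) ?xs ` {..<r}"
    then obtain q where q: "q < r" "s = ?xs ! q" by auto
    then have "s < x" using sorted_wrt_nth_less[OF sl q(1) r(1)] r by simp
    moreover have "s \<in> S" using q r assms by (metis nth_mem order.strict_trans set_sorted_list_of_set)
    ultimately show "s \<in> {s\<in>S. s < x}" by simp
  qed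
  moreover have "inj_on ((!) ?xs) {..<r}"
    using r by (auto simp: inj_on_def nth_eq_iff_index_eq)
  ultimately have "card {s\<in>S. s < x} = r" by (simp add: card_image)
  then show ?thesis using r by simp
qed

lemma card_less_rank:
  fixes S :: "'a::linorder set"
  assumes "finite S" "i < card S"
  shows "card {s\<in>S. s < sorted_list_of_set S ! i} = i"
proof -
  let ?x = "sorted_list_of_set S ! i"
  have x: "?x \<in> S" using assms by (metis length_sorted_list_of_set nth_mem set_sorted_list_of_set)
  have "{s\<in>S. s < ?x} \<subset> S" using x by auto
  then have "card {s\<in>S. s < ?x} < card S" using assms(1) psubset_card_mono by blast
  then show ?thesis
    using sorted_list_of_set_nth_rank[OF assms(1) x] assms
    by (metis distinct_sorted_list_of_set length_sorted_list_of_set nth_eq_iff_index_eq)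
qed

lemma sorted_list_of_set_image_rank:
  fixes y :: "'b::linorder \<Rightarrow> 'a::linorder"
  assumes "finite A" "strict_mono_on A y" "j \<in> A"
  shows "sorted_list_of_set (y ` A) ! card {i\<in>A. i < j} = y j"
proof -
  have less: "y i < y j \<longleftrightarrow> i < j" if "i \<in> A" for i
    using assms that by (metis linorder_less_linear order_less_imp_not_less strict_mono_onD)
  have inj: "inj_on y A" using assms(2) strict_mono_on_imp_inj_on by blast
  have "{s \<in> y ` A. s < y j} = y ` {i\<in>A. i < j}" using less by auto
  moreover have "card (y ` {i\<in>A. i < j}) = card {i\<in>A. i < j}"
    by (rule card_image) (rule inj_on_subset[OF inj], auto)
  ultimately show ?thesis
    using sorted_list_of_set_nth_rank[of "y ` A" "y j"] assms by simp
qed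

section \<open>Measurability of counts and of sorted points\<close>

lemma space_config_space [simp]: "space config_space = UNIV"
  by (simp add: config_space_def)

lemma count_in_config_space:
  assumes "B \<in> sets borel"
  shows "{S. finite (S \<inter> B) \<and> card (S \<inter> B) = n} \<in> sets config_space"
  unfolding config_space_def using assms by (subst sets_measure_of) (auto intro!: sigma_sets.Basic)

lemma finite_in_config_space:
  assumes "B \<in> sets borel"
  shows "{S. finite (S \<inter> B)} \<in> sets config_space"
proof -
  have "{S. finite (S \<inter> B)} = (\<Union>n. {S. finite (S \<inter> B) \<and> card (S \<inter> B) = n})" by auto
  then show ?thesis using assms by (auto intro: count_in_config_space)
qed

lemma measurable_card_config_space:
  assumes "B \<in> sets borel"
  shows "(\<lambda>S. card (S \<inter> B)) \<in> config_space \<rightarrow>\<^sub>M count_space UNIV"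
proof (rule measurable_count_space_eq2_countable[THEN iffD2], safe)
  fix n :: nat
  \<comment> \<open>\<open>card\<close> sends infinite sets to 0, so only the preimage of 0 contains
    sets with infinite trace on \<open>B\<close>.\<close>
  have "(\<lambda>S. card (S \<inter> B)) -` {n} \<inter> space config_space =
    (if n = 0 then {S. finite (S \<inter> B) \<and> card (S \<inter> B) = 0} \<union> (space config_space - {S. finite (S \<inter> B)})
     else {S. finite (S \<inter> B) \<and> card (S \<inter> B) = n})"
    by (auto intro: card_ge_0_finite)
  also have "\<dots> \<in> sets config_space"
    using count_in_config_space[OF assms] finite_in_config_space[OF assms] by (simp del: space_config_space)
  finally show "(\<lambda>S. card (S \<inter> B)) -` {n} \<inter> space config_space \<in> sets config_space" .
qed auto

text \<open>Out of range, \<open>!\<close> is unspecified but depends only on the excess of the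
  index. Hence the total function \<open>\<lambda>S. sorted_list_of_set S ! i\<close> is measurable
  also where \<open>i\<close> exceeds the cardinality or \<open>S\<close> is infinite.\<close>

lemma nth_beyond_length: "length xs \<le> i \<Longrightarrow> xs ! i = [] ! (i - length xs)"
proof (induction xs arbitrary: i)
  case (Cons x xs)
  then show ?case by (cases i) auto
qed simp

text \<open>Reduces order statistics to counts on half-lines, and counts generate the
  \<sigma>-algebra of \<open>config_space\<close>.\<close>

lemma sorted_list_of_set_nth_le_iff:
  fixes S :: "real set"
  assumes "i < card S"
  shows "sorted_list_of_set S ! i \<le> t \<longleftrightarrow> i < card (S \<inter> {..t})"
proof -
  have fin: "finite S" using assms card_gt_0_iff by fastforce
  let ?x = "sorted_list_of_set S ! i"
  have x: "?x \<in> S" using assms fin by (metis length_sorted_list_of_set nth_mem set_sorted_list_of_set)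
  have r: "card {s\<in>S. s < ?x} = i" using card_less_rank[OF fin assms] .
  show ?thesis
  proof
    assume "?x \<le> t"
    then have "insert ?x {s\<in>S. s < ?x} \<subseteq> S \<inter> {..t}" using x by auto
    then have "card (insert ?x {s\<in>S. s < ?x}) \<le> card (S \<inter> {..t})" using fin by (intro card_mono) auto
    then show "i < card (S \<inter> {..t})" using r fin by simp
  next
    assume *: "i < card (S \<inter> {..t})"
    show "?x \<le> t"
    proof (rule ccontr)
      assume "\<not> ?x \<le> t"
      then have "S \<inter> {..t} \<subseteq> {s\<in>S. s < ?x}" by auto
      then have "card (S \<inter> {..t}) \<le> i" using r fin by (metis (no_types, lifting) card_mono finite_subset mem_Collect_eq subsetI)
      then show False using * by simp
    qed
  qed
qed

lemma measurable_nth_config_space [measurable]: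
  "(\<lambda>S. sorted_list_of_set S ! i) \<in> borel_measurable config_space"
proof (rule borel_measurable_iff_le[THEN iffD2], rule allI)
  fix t :: real
  have c [measurable]: "(\<lambda>S. card (S \<inter> {..t})) \<in> config_space \<rightarrow>\<^sub>M count_space UNIV"
    by (rule measurable_card_config_space) simp
  have d [measurable]: "card \<in> config_space \<rightarrow>\<^sub>M count_space UNIV"
    using measurable_card_config_space[of UNIV] by simp
  have "sorted_list_of_set S ! i \<le> t \<longleftrightarrow>
      (if i < card S then i < card (S \<inter> {..t}) else ([] ! (i - card S) :: real) \<le> t)" for S
    using sorted_list_of_set_nth_le_iff[of i S t] nth_beyond_length[of "sorted_list_of_set S" i] by simp
  then have "{S \<in> space config_space. sorted_list_of_set S ! i \<le> t} =
    {S \<in> space config_space. if i < card S then i < card (S \<inter> {..t}) else ([] ! (i - card S) :: real) \<le> t}"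
    by auto
  also have "\<dots> \<in> sets config_space"
    by measurable
  finally show "{S \<in> space config_space. sorted_list_of_set S ! i \<le> t} \<in> sets config_space" .
qed

text \<open>Turns a cardinality bound, for finite and infinite \<open>A\<close> alike, into
  existence of a list; for points with countably many labels such existence is a countable union of
  events.\<close>

lemma ex_distinct_list_iff:
  "(\<exists>xs. length xs = n \<and> distinct xs \<and> set xs \<subseteq> A) \<longleftrightarrow> (infinite A \<or> n \<le> card A)"
proof
  assume "\<exists>xs. length xs = n \<and> distinct xs \<and> set xs \<subseteq> A"
  then show "infinite A \<or> n \<le> card A" by (metis card_mono distinct_card)
next
  assume "infinite A \<or> n \<le> card A"
  then obtain B where "B \<subseteq> A" "finite B" "card B = n"
    by (metis infinite_arbitrarily_large obtain_subset_with_card_n)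
  then show "\<exists>xs. length xs = n \<and> distinct xs \<and> set xs \<subseteq> A"
    by (metis distinct_card finite_distinct_list)
qed

text \<open>Different labels may give the same point, so labels cannot be counted directly. At least
  \<open>m\<close> points lie in \<open>B\<close> iff some list of \<open>m\<close> labels
  satisfying \<open>D\<close> has pairwise different values in \<open>B\<close>, and there are
  countably many lists.\<close>

lemma measurable_countable_points:
  fixes T :: "'b::countable \<Rightarrow> 'a \<Rightarrow> real"
  assumes [measurable]: "\<And>u. Measurable.pred M (D u)" "\<And>u. T u \<in> borel_measurable M"
  shows "(\<lambda>\<omega>. {T u \<omega> | u. D u \<omega>}) \<in> M \<rightarrow>\<^sub>M config_space"
  unfolding config_space_def
proof (rule measurable_measure_of)
  fix A assume "A \<in> {{S::real set. finite (S \<inter> B) \<and> card (S \<inter> B) = n} | B n. B \<in> sets borel}"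
  then obtain B n where A: "A = {S. finite (S \<inter> B) \<and> card (S \<inter> B) = n}" and [measurable]: "B \<in> sets borel"
    by auto
  define P where "P m \<omega> \<longleftrightarrow> (\<exists>us::'b list. length us = m \<and> (\<forall>i<m. D (us ! i) \<omega> \<and> T (us ! i) \<omega> \<in> B) \<and>
     (\<forall>i<m. \<forall>j<m. i \<noteq> j \<longrightarrow> T (us ! i) \<omega> \<noteq> T (us ! j) \<omega>))" for m \<omega>
  have [measurable]: "Measurable.pred M (P m)" for m
    unfolding P_def by measurable
  have P: "P m \<omega> \<longleftrightarrow> (\<exists>xs. length xs = m \<and> distinct xs \<and> set xs \<subseteq> {T u \<omega> | u. D u \<omega>} \<inter> B)" for m \<omega>
  proof
    assume "P m \<omega>"
    then obtain us where us: "length us = m" "\<forall>i<m. D (us ! i) \<omega> \<and> T (us ! i) \<omega> \<in> B"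
      "\<forall>i<m. \<forall>j<m. i \<noteq> j \<longrightarrow> T (us ! i) \<omega> \<noteq> T (us ! j) \<omega>" unfolding P_def by blast
    then show "\<exists>xs. length xs = m \<and> distinct xs \<and> set xs \<subseteq> {T u \<omega> | u. D u \<omega>} \<inter> B"
      by (intro exI[of _ "map (\<lambda>u. T u \<omega>) us"]) (auto simp: distinct_conv_nth in_set_conv_nth, blast)
  next
    assume "\<exists>xs. length xs = m \<and> distinct xs \<and> set xs \<subseteq> {T u \<omega> | u. D u \<omega>} \<inter> B"
    then obtain xs where xs: "length xs = m" "distinct xs" "set xs \<subseteq> {T u \<omega> | u. D u \<omega>} \<inter> B" by blast
    then have "\<forall>i<m. \<exists>u. xs ! i = T u \<omega> \<and> D u \<omega> \<and> T u \<omega> \<in> B"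
      using nth_mem by fastforce
    then obtain v where v: "\<And>i. i < m \<Longrightarrow> xs ! i = T (v i) \<omega> \<and> D (v i) \<omega> \<and> T (v i) \<omega> \<in> B" by metis
    show "P m \<omega>" unfolding P_def
      using v xs by (intro exI[of _ "map v [0..<m]"]) (auto, metis nth_eq_iff_index_eq)
  qed
  \<comment> \<open>Failure of \<open>P (Suc n)\<close> also rules out an infinite intersection with
    \<open>B\<close>.\<close>
  have "{T u \<omega> | u. D u \<omega>} \<in> A \<longleftrightarrow> P n \<omega> \<and> \<not> P (Suc n) \<omega>" for \<omega>
    unfolding A P ex_distinct_list_iff by auto
  then have "(\<lambda>\<omega>. {T u \<omega> | u. D u \<omega>}) -` A \<inter> space M = {\<omega> \<in> space M. P n \<omega> \<and> \<not> P (Suc n) \<omega>}"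
    by auto
  also have "\<dots> \<in> sets M" by measurable
  finally show "(\<lambda>\<omega>. {T u \<omega> | u. D u \<omega>}) -` A \<inter> space M \<in> sets M" .
qed auto

section \<open>Clusters encoded by parent functions\<close>

text \<open>Individuals are numbered by birth, so the elder siblings of \<open>i\<close> are the
  smaller indices with the same parent, and their number is the last letter of the Ulam-Harris
  label. Index 0 is left out: it is the root, where a parent function has no meaningful
  value.\<close>

definition sib_rank :: "(nat \<Rightarrow> nat) \<Rightarrow> nat \<Rightarrow> nat" where
  "sib_rank p i = card {j\<in>{1..<i}. p j = p i}"

text \<open>The guard makes the recursion terminate for every \<open>p\<close>; for a parent
  function it fails only at the root among the indices up to \<open>k\<close>. The same holds for
  \<open>tree_time\<close>, where \<open>x i\<close> stands for the birth time of \<open>i\<close>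
  relative to its parent.\<close>

function tree_label :: "(nat \<Rightarrow> nat) \<Rightarrow> nat \<Rightarrow> nat list" where
  "tree_label p i = (if 0 < i \<and> p i < i then tree_label p (p i) @ [sib_rank p i] else [])"
  by auto
termination by (relation "Wellfounded.measure snd") auto

function tree_time :: "(nat \<Rightarrow> nat) \<Rightarrow> (nat \<Rightarrow> real) \<Rightarrow> nat \<Rightarrow> real" where
  "tree_time p x i = (if 0 < i \<and> p i < i then tree_time p x (p i) + x i else 0)"
  by auto
termination by (relation "Wellfounded.measure (\<lambda>(p, x, i). i)") auto

declare tree_label.simps [simp del] tree_time.simps [simp del]

lemma tree_label_0 [simp]: "tree_label p 0 = []" and tree_time_0 [simp]: "tree_time p x 0 = 0"
  by (simp_all add: tree_label.simps[of p 0] tree_time.simps[of p x 0])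

lemma tree_label_rec: "0 < i \<Longrightarrow> p i < i \<Longrightarrow> tree_label p i = tree_label p (p i) @ [sib_rank p i]"
  and tree_time_rec: "0 < i \<Longrightarrow> p i < i \<Longrightarrow> tree_time p x i = tree_time p x (p i) + x i"
  by (simp_all add: tree_label.simps[of p i] tree_time.simps[of p x i])

abbreviation parent_functions :: "nat \<Rightarrow> (nat \<Rightarrow> nat) set" where
  "parent_functions k \<equiv> Pi\<^sub>E {1..k} (\<lambda>i. {..<i})"

lemma parent_function_less: "p \<in> parent_functions k \<Longrightarrow> i \<in> {1..k} \<Longrightarrow> p i < i"
  by (auto simp: PiE_iff)

definition children :: "nat \<Rightarrow> (nat \<Rightarrow> nat) \<Rightarrow> nat \<Rightarrow> nat set" where
  "children k p i = {j\<in>{1..k}. p j = i}"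

lemma finite_children [simp]: "finite (children k p i)"
  by (simp add: children_def)

lemma sib_rank_children:
  assumes "j \<in> children k p i"
  shows "sib_rank p j = card {a \<in> children k p i. a < j}"
  unfolding sib_rank_def by (rule arg_cong[of _ _ card]) (use assms in \<open>auto simp: children_def\<close>)

lemma sib_rank_less:
  assumes "j \<in> children k p i"
  shows "sib_rank p j < card (children k p i)"
  unfolding sib_rank_children[OF assms] by (rule psubset_card_mono) (use assms in auto)

lemma sib_rank_less_iff:
  assumes "i \<in> children k p m" "j \<in> children k p m"
  shows "sib_rank p i < sib_rank p j \<longleftrightarrow> i < j"
proof -
  have *: "sib_rank p a < sib_rank p b" if "a < b" "a \<in> children k p m" "b \<in> children k p m" for a b
    unfolding sib_rank_children[OF that(2)] sib_rank_children[OF that(3)]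
    by (rule psubset_card_mono) (use that in auto)
  show ?thesis using *[of i j] *[of j i] assms by (cases i j rule: linorder_cases) auto
qed

lemma ex_sib_rank:
  assumes "m < card (children k p i)"
  shows "\<exists>j\<in>children k p i. sib_rank p j = m"
proof -
  let ?j = "sorted_list_of_set (children k p i) ! m"
  have j: "?j \<in> children k p i" using assms
    by (metis finite_children length_sorted_list_of_set nth_mem set_sorted_list_of_set)
  then show ?thesis using card_less_rank[OF finite_children assms] sib_rank_children[OF j] by auto
qed

text \<open>Equal labels have equal prefixes and equal last letters; by induction the parents agree,
  and then equal sibling ranks force equal indices. Distinct labels are what makes the offspring
  sets of the \<open>k + 1\<close> events independent.\<close>

lemma inj_tree_label:
  assumes p': "p \<in> parent_functions k"
  shows "inj_on (tree_label p) {0..k}"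
proof -
  note p = parent_function_less[OF p']
  have "i = j" if "i \<le> k" "j \<le> k" "tree_label p i = tree_label p j" for i j
    using that
  proof (induction i arbitrary: j rule: less_induct)
    case (less i)
    show ?case
    proof (cases "i = 0 \<or> j = 0")
      case True
      have "tree_label p a \<noteq> []" if "0 < a" "a \<le> k" for a
        using that p[of a] by (simp add: tree_label_rec)
      then show ?thesis using True less.prems by (metis bot_nat_0.not_eq_extremum tree_label_0)
    next
      case False
      then have pi: "p i < i" "p j < j" using p[of i] p[of j] less.prems by auto
      then have eq: "tree_label p (p i) = tree_label p (p j)" "sib_rank p i = sib_rank p j"
        using less.prems False by (auto simp: tree_label_rec)
      then have "p i = p j" using less.IH[of "p i" "p j"] pi less.prems by auto
      then have "i \<in> children k p (p i)" "j \<in> children k p (p i)"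
        using False less.prems by (auto simp: children_def)
      then show ?thesis using sib_rank_less_iff eq(2) by (metis linorder_neq_iff)
    qed
  qed
  then show ?thesis by (auto simp: inj_on_def)
qed

definition offspring_gap :: "(nat \<Rightarrow> nat) \<Rightarrow> (nat list \<Rightarrow> real set) \<Rightarrow> nat \<Rightarrow> real" where
  "offspring_gap p F i = sorted_list_of_set (F (tree_label p (p i))) ! sib_rank p i"

text \<open>The degree condition closes the tree: the \<open>k + 1\<close> labelled individuals have
  no further children, so nobody else is born. The second clause says that the numbering is the
  order of birth, without ties.\<close>

definition realises :: "nat \<Rightarrow> (nat \<Rightarrow> nat) \<Rightarrow> (nat list \<Rightarrow> real set) \<Rightarrow> bool" where
  "realises k p F \<longleftrightarrow>
     (\<forall>i\<le>k. finite (F (tree_label p i)) \<and> card (F (tree_label p i)) = card (children k p i)) \<and>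
     (\<forall>i<k. tree_time p (offspring_gap p F) i < tree_time p (offspring_gap p F) (Suc i))"

lemma realises_less:
  assumes "realises k p F" "i < j" "j \<le> k"
  shows "tree_time p (offspring_gap p F) i < tree_time p (offspring_gap p F) j"
  using assms(2,3)
proof (induction j)
  case (Suc j)
  have "tree_time p (offspring_gap p F) j < tree_time p (offspring_gap p F) (Suc j)"
    using assms(1) Suc.prems by (simp add: realises_def)
  then show ?case using Suc by (cases "i = j") auto
qed simp

text \<open>Closure under offspring comes from the degree condition: the sibling ranks of the
  children of \<open>i\<close> fill \<open>{..<card (children k p i)}\<close>, so every offspring
  slot belongs to one of the \<open>k + 1\<close> individuals.\<close>

lemma cluster_realises:
  assumes p': "p \<in> parent_functions k" and F: "realises k p F"
  shows "cluster F = (\<lambda>i. (tree_label p i, tree_time p (offspring_gap p F) i)) ` {0..k}" (is "_ = ?R")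
proof (intro equalityI subrelI)
  note p = parent_function_less[OF p']
  fix u s assume "(u, s) \<in> cluster F"
  then show "(u, s) \<in> ?R"
  proof (induction)
    case root
    show ?case by (rule image_eqI[of _ _ 0]) auto
  next
    case (offspring u s m)
    then obtain i where i: "i \<le> k" "u = tree_label p i" "s = tree_time p (offspring_gap p F) i" by auto
    with offspring F have "m < card (children k p i)" by (auto simp: realises_def)
    then obtain j where j: "j \<in> children k p i" "sib_rank p j = m" using ex_sib_rank by blast
    then have *: "p j = i" "0 < j" "p j < j" "j \<le> k" using p by (auto simp: children_def)
    show ?case using * j i
      by (intro image_eqI[of _ _ j]) (auto simp: tree_label_rec tree_time_rec offspring_gap_def[of p F j])
  qed
next
  note p = parent_function_less[OF p']
  have *: "(tree_label p i, tree_time p (offspring_gap p F) i) \<in> cluster F" if "i \<le> k" for i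
    using that
  proof (induction i rule: less_induct)
    case (less i)
    show ?case
    proof (cases "i = 0")
      case True then show ?thesis by (simp add: cluster.root)
    next
      case False
      then have pi: "p i < i" using p[of i] less.prems by simp
      have "i \<in> children k p (p i)" using False less.prems by (auto simp: children_def)
      then have "sib_rank p i < card (F (tree_label p (p i)))"
        using sib_rank_less[of i k p "p i"] F pi less.prems by (simp add: realises_def)
      moreover have "(tree_label p (p i), tree_time p (offspring_gap p F) (p i)) \<in> cluster F"
        using less pi by simp
      ultimately show ?thesis using pi False
        using cluster.offspring[of "tree_label p (p i)" "tree_time p (offspring_gap p F) (p i)" F "sib_rank p i"]
        by (simp add: tree_label_rec tree_time_rec offspring_gap_def[of p F i])
    qed
  qed
  fix u s assume "(u, s) \<in> ?R"
  then show "(u, s) \<in> cluster F" using * by auto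
qed

lemma epochs_realises:
  assumes p': "p \<in> parent_functions k" and F: "realises k p F"
  shows "cluster_size F = Suc k" and "\<And>i. i \<le> k \<Longrightarrow> epoch F i = tree_time p (offspring_gap p F) i"
proof -
  let ?t = "tree_time p (offspring_gap p F)"
  have ev: "event_times F = ?t ` {0..k}"
    unfolding event_times_def cluster_realises[OF assms] by (auto simp: image_image)
  have sm: "strict_mono_on {0..k} ?t"
    using realises_less[OF F] by (auto intro!: strict_mono_onI)
  show "cluster_size F = Suc k"
    unfolding cluster_size_def ev using card_image[OF strict_mono_on_imp_inj_on[OF sm]] by simp
  fix i assume "i \<le> k"
  moreover from this have "{a \<in> {0..k}. a < i} = {..<i}" by auto
  ultimately show "epoch F i = ?t i"
    unfolding epoch_def ev using sorted_list_of_set_image_rank[OF _ sm, of i] by simp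
qed

text \<open>Cluster and epochs depend on \<open>F\<close> alone. As times increase strictly, equal
  times identify the labels of the two numberings, and a label without its last letter is that of
  the parent. This makes the events of different parent functions disjoint.\<close>

lemma realises_unique:
  assumes p: "p \<in> parent_functions k" and q: "q \<in> parent_functions k"
    and F: "realises k p F" "realises k q F"
  shows "p = q"
proof (rule PiE_ext[OF p q])
  note p' = parent_function_less[OF p] and q' = parent_function_less[OF q]
  have t: "tree_time p (offspring_gap p F) i = tree_time q (offspring_gap q F) i" if "i \<le> k" for i
    using epochs_realises(2)[OF p F(1) that] epochs_realises(2)[OF q F(2) that] by simp
  have lab: "tree_label p i = tree_label q i" if "i \<le> k" for i
  proof -
    have "(tree_label p i, tree_time p (offspring_gap p F) i) \<in> cluster F"
      unfolding cluster_realises[OF p F(1)] using that by auto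
    then obtain j where j: "j \<le> k" "tree_label p i = tree_label q j"
      "tree_time p (offspring_gap p F) i = tree_time q (offspring_gap q F) j"
      unfolding cluster_realises[OF q F(2)] by auto
    then have "i = j" using realises_less[OF F(2)] t that by (metis linorder_neq_iff)
    then show ?thesis using j by simp
  qed
  fix i assume i: "i \<in> {1..k}"
  have "tree_label p (p i) = tree_label p (q i)"
    using lab[of i] lab[of "q i"] i p'[OF i] q'[OF i] by (simp add: tree_label_rec)
  then show "p i = q i"
    using inj_tree_label[OF p] i p'[OF i] q'[OF i] by (auto simp: inj_on_def)
qed

section \<open>Explicit description of the cluster by paths of labels\<close>

text \<open>Unlike the inductive set, \<open>path_time F u\<close> and \<open>alive F u\<close>
  visibly read \<open>F\<close> only at the proper prefixes of \<open>u\<close>; measurability and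
  independence rest on this.\<close>

definition path_time :: "(nat list \<Rightarrow> real set) \<Rightarrow> nat list \<Rightarrow> real" where
  "path_time F u = (\<Sum>m<length u. sorted_list_of_set (F (take m u)) ! (u ! m))"

definition alive :: "(nat list \<Rightarrow> real set) \<Rightarrow> nat list \<Rightarrow> bool" where
  "alive F u \<longleftrightarrow> (\<forall>m<length u. u ! m < card (F (take m u)))"

lemma path_time_Nil [simp]: "path_time F [] = 0"
  and alive_Nil [simp]: "alive F []"
  by (simp_all add: path_time_def alive_def)

lemma path_time_snoc [simp]:
  "path_time F (u @ [i]) = path_time F u + sorted_list_of_set (F u) ! i"
proof -
  have "(\<Sum>m<length u. sorted_list_of_set (F (take m (u @ [i]))) ! ((u @ [i]) ! m)) = path_time F u"
    unfolding path_time_def by (rule sum.cong) (auto simp: nth_append)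
  then show ?thesis by (simp add: path_time_def)
qed

lemma alive_snoc [simp]: "alive F (u @ [i]) \<longleftrightarrow> alive F u \<and> i < card (F u)"
  by (auto simp: alive_def nth_append less_Suc_eq)

lemma cluster_eq: "cluster F = {(u, path_time F u) | u. alive F u}"
proof (intro equalityI subrelI)
  fix u s assume "(u, s) \<in> cluster F"
  then show "(u, s) \<in> {(u, path_time F u) | u. alive F u}"
    by induction auto
next
  have "(u, path_time F u) \<in> cluster F" if "alive F u" for u
    using that by (induction u rule: rev_induct) (auto intro: cluster.intros)
  then show "(u, s) \<in> cluster F" if "(u, s) \<in> {(u, path_time F u) | u. alive F u}" for u s
    using that by auto
qed

lemma event_times_eq: "event_times F = {path_time F u | u. alive F u}"
  by (force simp: event_times_def cluster_eq)

text \<open>When no two individuals share a time, \<open>cluster_size\<close>, which counts times,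
  also counts individuals.\<close>

definition regular :: "(nat list \<Rightarrow> real set) \<Rightarrow> bool" where
  "regular F \<longleftrightarrow> (\<forall>u. finite (F u) \<and> F u \<subseteq> {0<..}) \<and>
     (\<forall>u v. alive F u \<longrightarrow> alive F v \<longrightarrow> path_time F u = path_time F v \<longrightarrow> u = v)"

lemma regularD:
  "regular F \<Longrightarrow> alive F u \<Longrightarrow> alive F v \<Longrightarrow> path_time F u = path_time F v \<Longrightarrow> u = v"
  by (simp add: regular_def)

lemma nth_offspring_pos:
  assumes "regular F" "i < card (F u)"
  shows "0 < sorted_list_of_set (F u) ! i"
proof -
  have "sorted_list_of_set (F u) ! i \<in> F u"
    using assms by (metis length_sorted_list_of_set nth_mem regular_def set_sorted_list_of_set)
  then show ?thesis using assms(1) by (auto simp: regular_def)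
qed

lemma path_time_nonneg:
  assumes "regular F" "alive F u"
  shows "0 \<le> path_time F u"
  using assms(2)
proof (induction u rule: rev_induct)
  case (snoc i u)
  then show ?case using nth_offspring_pos[OF assms(1), of i u] by auto
qed simp

text \<open>Each epoch belongs to exactly one label. Dropping the last letter of a non-root label
  gives the parent, which is earlier because offspring gaps are positive; these parents form
  \<open>p\<close>. What remains is that the letters found in \<open>F\<close> agree with
  \<open>sib_rank p\<close>.\<close>

lemma ex_realises:
  assumes F: "regular F" and N: "cluster_size F = Suc k"
  shows "\<exists>p\<in>parent_functions k. realises k p F"
proof -
  let ?S = "event_times F"
  define e where "e = epoch F"
  have fin: "finite ?S" using N unfolding cluster_size_def by (metis card.infinite nat.distinct(1))
  have len: "length (sorted_list_of_set ?S) = Suc k" using N by (simp add: cluster_size_def)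
  have e_less: "e i < e j" if "i < j" "j \<le> k" for i j
    unfolding e_def epoch_def by (rule sorted_wrt_nth_less[where P="(<)"]) (use that len in auto)
  have e_less_iff: "e i < e j \<longleftrightarrow> i < j" if "i \<le> k" "j \<le> k" for i j
    using e_less[of i j] e_less[of j i] that by (cases i j rule: linorder_cases) auto
  have S: "?S = e ` {0..k}"
  proof -
    have "?S = set (sorted_list_of_set ?S)" using fin by simp
    also have "\<dots> = (!) (sorted_list_of_set ?S) ` {0..k}"
      unfolding set_conv_nth len by (auto simp: image_iff less_Suc_eq_le)
    finally show ?thesis by (simp add: e_def epoch_def[abs_def])
  qed
  have "\<exists>u. alive F u \<and> path_time F u = e i" if "i \<le> k" for i
    using that S by (force simp: event_times_eq)
  then obtain u where u: "\<And>i. i \<le> k \<Longrightarrow> alive F (u i) \<and> path_time F (u i) = e i" by metis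
  have ex_index: "\<exists>i\<le>k. v = u i \<and> path_time F v = e i" if "alive F v" for v
  proof -
    have "path_time F v \<in> ?S" using that by (auto simp: event_times_eq)
    then obtain i where "i \<le> k" "path_time F v = e i" using S by auto
    moreover from this have "v = u i" using u[of i] regularD[OF F that, of "u i"] by simp
    ultimately show ?thesis by blast
  qed
  have u_inj: "i = j" if "i \<le> k" "j \<le> k" "u i = u j" for i j
  proof -
    have "e i = e j" using u[of i] u[of j] that by simp
    then show ?thesis
      using e_less_iff[of i j] e_less_iff[of j i] that by (cases i j rule: linorder_cases) auto
  qed
  \<comment> \<open>The root contributes time 0, and all path times are nonnegative.\<close>
  have "e 0 = 0"
  proof -
    obtain j where j: "j \<le> k" "e j = 0" using ex_index[of "[]"] by auto
    have "e 0 \<le> e j" using e_less[of 0 j] j by (cases "j = 0") auto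
    moreover have "0 \<le> e 0" using u[of 0] path_time_nonneg[OF F] by fastforce
    ultimately show ?thesis using j by simp
  qed
  then have u0: "u 0 = []" using u[of 0] regularD[OF F, of "u 0" "[]"] by simp
  have "\<exists>j m. j < i \<and> m < card (F (u j)) \<and> u i = u j @ [m] \<and> e i = e j + sorted_list_of_set (F (u j)) ! m"
    if i: "i \<in> {1..k}" for i
  proof -
    have "u i \<noteq> []" using u_inj[of i 0] u0 i by auto
    then obtain v m where v: "u i = v @ [m]" by (metis rev_exhaust)
    then have al: "alive F v" "m < card (F v)" using u[of i] i by auto
    then obtain j where j: "j \<le> k" "v = u j" "path_time F v = e j" using ex_index by blast
    have "e i = e j + sorted_list_of_set (F (u j)) ! m" using u[of i] i v j by auto
    moreover from this have "j < i" using e_less_iff[of j i] j i nth_offspring_pos[OF F al(2)] by simp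
    ultimately show ?thesis using v j al by blast
  qed
  then obtain p0 m where pm: "\<And>i. i \<in> {1..k} \<Longrightarrow> p0 i < i \<and> m i < card (F (u (p0 i))) \<and>
      u i = u (p0 i) @ [m i] \<and> e i = e (p0 i) + sorted_list_of_set (F (u (p0 i))) ! m i"
    by metis
  define p where "p = restrict p0 {1..k}"
  have p: "p \<in> parent_functions k" using pm by (auto simp: p_def)
  have pm: "p i < i" "m i < card (F (u (p i)))" "u i = u (p i) @ [m i]"
    "e i = e (p i) + sorted_list_of_set (F (u (p i))) ! m i" if "i \<in> {1..k}" for i
    using pm[OF that] that by (simp_all add: p_def)
  have m_less: "m a < m b" if "a \<in> children k p i" "b \<in> children k p i" "a < b" for a b i
  proof (rule ccontr)
    assume "\<not> m a < m b"
    moreover have ab: "a \<in> {1..k}" "b \<in> {1..k}" "p a = i" "p b = i" using that by (auto simp: children_def)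
    ultimately have "sorted_list_of_set (F (u i)) ! m b \<le> sorted_list_of_set (F (u i)) ! m a"
      using pm(2)[of a] by (intro sorted_nth_mono) auto
    then show False using pm(4)[of a] pm(4)[of b] ab e_less[of a b] that(3) by simp
  qed
  \<comment> \<open>An offspring slot \<open>n\<close> of a living individual is itself alive, hence
    one of the events; its index is the required child.\<close>
  have m_img: "\<exists>j\<in>children k p i. m j = n" if "i \<le> k" "n < card (F (u i))" for i n
  proof -
    have "alive F (u i @ [n])" using that u[of i] by simp
    then obtain j where j: "j \<le> k" "u i @ [n] = u j" using ex_index by blast
    then have "j \<noteq> 0" using u0 by (metis snoc_eq_iff_butlast)
    then have j1: "j \<in> {1..k}" using j by simp
    then have "u i = u (p j)" "m j = n" using pm(3)[OF j1] j by auto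
    then show ?thesis using u_inj[of i "p j"] pm(1)[OF j1] j1 that
      by (intro bexI[of _ j]) (auto simp: children_def)
  qed
  have m_bound: "m j < card (F (u i))" if "j \<in> children k p i" for i j
    using pm(2)[of j] that by (auto simp: children_def)
  have m_inj: "inj_on m (children k p i)" for i
    using m_less[of _ i] by (metis linorder_inj_onI' order_less_irrefl)
  have card_children: "card (F (u i)) = card (children k p i)" if "i \<le> k" for i
  proof -
    have "m ` children k p i = {..<card (F (u i))}"
      using m_bound m_img[OF that] by force
    then show ?thesis using card_image[OF m_inj[of i]] by simp
  qed
  \<comment> \<open>Along siblings the letters increase and fill an initial segment, so the letter
    of \<open>j\<close> counts the siblings before \<open>j\<close>.\<close>
  have rank: "sib_rank p j = m j" if jk: "j \<in> {1..k}" for j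
  proof -
    have j: "j \<in> children k p (p j)" "p j \<le> k" using that pm(1)[OF that] by (auto simp: children_def)
    have "m ` {a \<in> children k p (p j). a < j} = {..<m j}"
    proof (intro equalityI subsetI)
      fix n assume n: "n \<in> {..<m j}"
      then obtain a where a: "a \<in> children k p (p j)" "m a = n"
        using m_img[OF j(2), of n] pm(2)[OF jk] by auto
      then have "a < j" using m_less[OF j(1) a(1)] n by (cases a j rule: linorder_cases) auto
      then show "n \<in> m ` {a \<in> children k p (p j). a < j}" using a by auto
    qed (use m_less j in auto)
    then have "card {a \<in> children k p (p j). a < j} = m j"
      using card_image[OF inj_on_subset[OF m_inj[of "p j"]], of "{a \<in> children k p (p j). a < j}"] by simp
    then show ?thesis using sib_rank_children[OF j(1)] by simp
  qed
  have lab: "tree_label p i = u i" if "i \<le> k" for i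
    using that
  proof (induction i rule: less_induct)
    case (less i)
    then show ?case
      using pm(1,3)[of i] rank[of i] u0 tree_label_rec[of i p] by (cases "i = 0") auto
  qed
  have time: "tree_time p (offspring_gap p F) i = e i" if "i \<le> k" for i
    using that
  proof (induction i rule: less_induct)
    case (less i)
    then show ?case
      using pm(1,4)[of i] rank[of i] \<open>e 0 = 0\<close> tree_time_rec[of i p "offspring_gap p F"] lab[of "p i"]
      by (cases "i = 0") (auto simp: offspring_gap_def[of p F i])
  qed
  have "realises k p F"
    unfolding realises_def using lab time card_children e_less F by (auto simp: regular_def)
  then show ?thesis using p by blast
qed

section \<open>Measurability of cluster size and epochs\<close>

lemma path_time_cong:
  assumes "\<And>m. m < length u \<Longrightarrow> F (take m u) = F' (take m u)"
  shows "path_time F u = path_time F' u"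
  unfolding path_time_def using assms by simp

lemma measurable_card [measurable]: "card \<in> config_space \<rightarrow>\<^sub>M count_space UNIV"
  using measurable_card_config_space[of UNIV] by simp

lemma measurable_path_time:
  assumes "\<And>m. m < length u \<Longrightarrow> (\<lambda>\<omega>. \<Phi> (take m u) \<omega>) \<in> M \<rightarrow>\<^sub>M config_space"
  shows "(\<lambda>\<omega>. path_time (\<lambda>v. \<Phi> v \<omega>) u) \<in> borel_measurable M"
  unfolding path_time_def
  by (intro borel_measurable_sum measurable_compose[OF assms measurable_nth_config_space]) simp

lemma measurable_event_times:
  assumes [measurable]: "\<And>u. \<Phi> u \<in> M \<rightarrow>\<^sub>M config_space"
  shows "(\<lambda>\<omega>. event_times (\<lambda>u. \<Phi> u \<omega>)) \<in> M \<rightarrow>\<^sub>M config_space"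
  unfolding event_times_eq
proof (rule measurable_countable_points)
  show "Measurable.pred M (\<lambda>\<omega>. alive (\<lambda>u. \<Phi> u \<omega>) u)" for u
    unfolding alive_def by measurable
  show "(\<lambda>\<omega>. path_time (\<lambda>u. \<Phi> u \<omega>) u) \<in> borel_measurable M" for u
    by (rule measurable_path_time) simp
qed

lemma measurable_cluster_size:
  assumes "\<And>u. \<Phi> u \<in> M \<rightarrow>\<^sub>M config_space"
  shows "(\<lambda>\<omega>. cluster_size (\<lambda>u. \<Phi> u \<omega>)) \<in> M \<rightarrow>\<^sub>M count_space UNIV"
  unfolding cluster_size_def by (rule measurable_compose[OF measurable_event_times[OF assms] measurable_card])

lemma measurable_epoch:
  assumes "\<And>u. \<Phi> u \<in> M \<rightarrow>\<^sub>M config_space"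
  shows "(\<lambda>\<omega>. epoch (\<lambda>u. \<Phi> u \<omega>) i) \<in> borel_measurable M"
  unfolding epoch_def by (rule measurable_compose[OF measurable_event_times[OF assms] measurable_nth_config_space])

section \<open>Poisson offspring and almost sure regularity\<close>

text \<open>\<open>f\<close> is the offspring rate, that is, the kernel extended by zero to
  nonpositive times. With a function integrable on the whole line, the kernel integral becomes
  \<open>mass {..t}\<close>.\<close>

locale hawkes_cluster = prob_space M for M :: "'a measure" +
  fixes f :: "real \<Rightarrow> real" and \<Phi> :: "nat list \<Rightarrow> 'a \<Rightarrow> real set"
  assumes f_nonneg: "\<And>t. 0 \<le> f t"
    and f_zero: "\<And>t. t \<le> 0 \<Longrightarrow> f t = 0"
    and f_int [intro]: "integrable lborel f"
    and poisson: "\<And>u. poisson_process M f (\<Phi> u)"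
    and indep_offspring: "indep_vars (\<lambda>_. config_space) \<Phi> UNIV"
begin

definition rho :: real where "rho = (\<integral>t. f t \<partial>lborel)"

definition mass :: "real set \<Rightarrow> real" where "mass B = (LINT t:B|lborel. f t)"

lemma f_measurable [measurable]: "f \<in> borel_measurable borel"
  using f_int by auto

lemma set_integrable_f: "B \<in> sets borel \<Longrightarrow> set_integrable lborel B f"
  unfolding set_integrable_def using integrable_mult_indicator[OF _ f_int] by simp

lemma measurable_\<Phi> [measurable]: "\<Phi> u \<in> M \<rightarrow>\<^sub>M config_space"
  using poisson[of u] by (simp add: poisson_process_def)

lemma prob_count:
  assumes "B \<in> sets borel"
  shows "prob {\<omega> \<in> space M. finite (\<Phi> u \<omega> \<inter> B) \<and> card (\<Phi> u \<omega> \<inter> B) = n} = mass B ^ n / fact n * exp (- mass B)"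
  using poisson[of u] assms set_integrable_f[OF assms] by (simp add: poisson_process_def mass_def)

lemma count_event:
  assumes "B \<in> sets borel"
  shows "{\<omega> \<in> space M. finite (\<Phi> u \<omega> \<inter> B) \<and> card (\<Phi> u \<omega> \<inter> B) = n} \<in> events"
proof -
  have "{\<omega> \<in> space M. finite (\<Phi> u \<omega> \<inter> B) \<and> card (\<Phi> u \<omega> \<inter> B) = n} =
    \<Phi> u -` {S. finite (S \<inter> B) \<and> card (S \<inter> B) = n} \<inter> space M" by auto
  then show ?thesis using measurable_sets[OF measurable_\<Phi> count_in_config_space[OF assms]] by simp
qed

lemma mass_null:
  assumes "B \<in> sets borel" "\<And>t. t \<in> B \<Longrightarrow> f t = 0"
  shows "mass B = 0"
proof -
  have "(\<lambda>t. indicator B t *\<^sub>R f t) = (\<lambda>_. 0)" using assms(2) by (auto simp: indicator_def)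
  then show ?thesis unfolding mass_def set_lebesgue_integral_def by simp
qed

lemma mass_singleton: "mass {y} = 0"
proof -
  have "AE t in lborel. indicator {y} t *\<^sub>R f t = 0"
    using AE_lborel_singleton[of y] by eventually_elim auto
  then show ?thesis
    unfolding mass_def set_lebesgue_integral_def by (intro integral_eq_zero_AE)
qed

lemma AE_no_points:
  assumes B: "B \<in> sets borel" and "mass B = 0"
  shows "AE \<omega> in M. \<Phi> u \<omega> \<inter> B = {}"
proof -
  let ?E = "{\<omega> \<in> space M. finite (\<Phi> u \<omega> \<inter> B) \<and> card (\<Phi> u \<omega> \<inter> B) = 0}"
  have "?E \<in> events" by (rule count_event) fact
  moreover have "prob ?E = 1" using prob_count[OF B, of u 0] assms by simp
  ultimately have "AE \<omega> in M. \<omega> \<in> ?E" by (simp add: prob_eq_1)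
  then show ?thesis by (rule AE_mp) (auto intro!: AE_I2)
qed

text \<open>The mean \<open>mass UNIV\<close> is finite, so the Poisson probabilities of all finite
  counts sum to 1 by the exponential series, leaving probability 0 for an infinite set.\<close>

lemma AE_finite:  "AE \<omega> in M. finite (\<Phi> u \<omega>)"
proof -
  let ?E = "\<lambda>n. {\<omega> \<in> space M. finite (\<Phi> u \<omega> \<inter> UNIV) \<and> card (\<Phi> u \<omega> \<inter> UNIV) = n}"
  have meas: "?E n \<in> events" for n
    by (rule count_event) simp
  have "(\<lambda>n. prob (?E n)) sums prob (\<Union>n. ?E n)"
    by (rule finite_measure_UNION) (use meas in \<open>auto simp: disjoint_family_on_def\<close>)
  moreover have UNIV_borel: "UNIV \<in> sets (borel :: real measure)" by simp
  have "(\<lambda>n. prob (?E n)) sums 1"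
  proof -
    have "(\<lambda>n. inverse (fact n) *\<^sub>R mass UNIV ^ n * exp (- mass UNIV)) sums (exp (mass UNIV) * exp (- mass UNIV))"
      by (rule sums_mult2) (rule exp_converges)
    then show ?thesis unfolding prob_count[OF UNIV_borel]
      by (simp add: exp_minus field_simps)
  qed
  ultimately have "prob (\<Union>n. ?E n) = 1" by (rule sums_unique2)
  then have "AE \<omega> in M. \<omega> \<in> (\<Union>n. ?E n)" using meas by (subst (asm) prob_eq_1) auto
  then show ?thesis by (rule AE_mp) auto
qed

section \<open>Almost sure distinctness of event times\<close>

text \<open>\<open>indep_var\<close> relates two variables of one type. A real variable to be
  compared with a point set is therefore carried as a singleton and recovered as its sorted element
  number 0.\<close>

lemma measurable_singleton_config_space:
  assumes "h \<in> borel_measurable N"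
  shows "(\<lambda>x. {h x}) \<in> N \<rightarrow>\<^sub>M config_space"
  using measurable_countable_points[where D="\<lambda>_::unit. \<lambda>_. True" and T="\<lambda>_. h" and M=N] assms by simp

text \<open>By independence and Fubini the second variable may be frozen at a number
  \<open>y\<close>, and a Poisson set with atomless mean measure avoids a fixed point almost
  surely.\<close>

lemma AE_nth_neq:
  fixes Y :: "'a \<Rightarrow> real set"
  assumes "indep_var config_space (\<Phi> w) config_space Y"
  shows "AE \<omega> in M. \<not> (i < card (\<Phi> w \<omega>) \<and> sorted_list_of_set (\<Phi> w \<omega>) ! i = sorted_list_of_set (Y \<omega>) ! 0)"
proof -
  have [measurable]: "Y \<in> M \<rightarrow>\<^sub>M config_space" using assms by (rule indep_var_rv2)
  let ?P = "distr M config_space (\<Phi> w)" and ?Q = "distr M config_space Y"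
  interpret P: prob_space ?P by (rule prob_space_distr) simp
  interpret Q: prob_space ?Q by (rule prob_space_distr) simp
  interpret PQ: pair_sigma_finite ?P ?Q ..
  define B where "B = {z \<in> space (config_space \<Otimes>\<^sub>M config_space).
      i < card (fst z) \<and> sorted_list_of_set (fst z) ! i = sorted_list_of_set (snd z) ! 0}"
  have B [measurable]: "B \<in> sets (config_space \<Otimes>\<^sub>M config_space)" unfolding B_def by measurable
  have eq: "?P \<Otimes>\<^sub>M ?Q = distr M (config_space \<Otimes>\<^sub>M config_space) (\<lambda>\<omega>. (\<Phi> w \<omega>, Y \<omega>))"
    using assms by (simp add: indep_var_distribution_eq)
  have "emeasure (?P \<Otimes>\<^sub>M ?Q) B = (\<integral>\<^sup>+Z. emeasure ?P ((\<lambda>x. (x, Z)) -` B) \<partial>?Q)"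
    by (rule PQ.emeasure_pair_measure_alt2) simp
  also have "\<dots> = (\<integral>\<^sup>+y. 0 \<partial>?Q)"
  proof (rule nn_integral_cong)
    fix Z :: "real set"
    define y where "y = sorted_list_of_set Z ! 0"
    have m: "(\<lambda>x. (x, Z)) -` B \<in> sets config_space"
      using measurable_sets[of "\<lambda>x. (x, Z)" config_space "config_space \<Otimes>\<^sub>M config_space" B] by simp
    have "AE \<omega> in M. \<Phi> w \<omega> \<notin> (\<lambda>x. (x, Z)) -` B"
    proof (rule AE_mp[OF AE_no_points[of "{y}" w]])
      show "AE \<omega> in M. \<Phi> w \<omega> \<inter> {y} = {} \<longrightarrow> \<Phi> w \<omega> \<notin> (\<lambda>x. (x, Z)) -` B"
      proof (intro AE_I2 impI notI)
        fix \<omega> assume *: "\<Phi> w \<omega> \<inter> {y} = {}" "\<Phi> w \<omega> \<in> (\<lambda>x. (x, Z)) -` B"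
        then have i: "i < card (\<Phi> w \<omega>)" and y: "sorted_list_of_set (\<Phi> w \<omega>) ! i = y" by (auto simp: B_def y_def)
        have "finite (\<Phi> w \<omega>)" using i card_gt_0_iff by fastforce
        then have "y \<in> \<Phi> w \<omega>"
          using i y by (metis length_sorted_list_of_set nth_mem set_sorted_list_of_set)
        then show False using *(1) by auto
      qed
    qed (simp_all add: mass_singleton)
    then have "emeasure M (\<Phi> w -` ((\<lambda>x. (x, Z)) -` B) \<inter> space M) = 0"
      using m by (subst (asm) AE_iff_measurable[OF _ refl]) (auto intro: arg_cong[where f="emeasure M"] simp: vimage_def Collect_conj_eq Int_commute)
    then show "emeasure ?P ((\<lambda>x. (x, Z)) -` B) = 0"
      using m by (simp add: emeasure_distr)
  qed
  finally have "emeasure M ((\<lambda>\<omega>. (\<Phi> w \<omega>, Y \<omega>)) -` B \<inter> space M) = 0"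
    unfolding eq by (simp add: emeasure_distr)
  then have "AE \<omega> in M. \<omega> \<notin> (\<lambda>\<omega>. (\<Phi> w \<omega>, Y \<omega>)) -` B \<inter> space M"
    by (intro AE_not_in) (auto simp: null_sets_def)
  then show ?thesis by (rule AE_mp) (auto simp: B_def space_pair_measure)
qed

text \<open>Unless \<open>v\<close> is a sibling of \<open>w @ [i]\<close>, the offspring set of
  \<open>w\<close> enters the two times only through the last step of \<open>w @ [i]\<close>.
  Equality would then make a point of \<open>\<Phi> w\<close> hit a value independent of
  \<open>\<Phi> w\<close>. The length bound keeps \<open>w\<close> from being a proper prefix of
  such a \<open>v\<close>.\<close>

lemma AE_path_time_neq:
  assumes "v \<noteq> []" "v \<noteq> w @ [i]" "length v \<le> Suc (length w)" 
  shows "AE \<omega> in M. \<not> (alive (\<lambda>u. \<Phi> u \<omega>) (w @ [i]) \<and> alive (\<lambda>u. \<Phi> u \<omega>) v \<and>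
           path_time (\<lambda>u. \<Phi> u \<omega>) (w @ [i]) = path_time (\<lambda>u. \<Phi> u \<omega>) v)"
proof (cases "butlast v = w")
  case True
  then obtain j where v: "v = w @ [j]" using assms(1) by (metis append_butlast_last_id)
  then have "i \<noteq> j" using assms(2) by auto
  \<comment> \<open>Siblings never coincide: different positions of a list without repetitions hold
    different values.\<close>
  then show ?thesis unfolding v by (auto simp: nth_eq_iff_index_eq)
next
  case False
  \<comment> \<open>\<open>K\<close> collects the labels at which the path times of \<open>v\<close>
    and \<open>w\<close> read the offspring sets.\<close>
  define K where "K = (\<lambda>m. take m v) ` {..<length v} \<union> (\<lambda>m. take m w) ` {..<length w}"
  have "w \<notin> K"
  proof
    assume "w \<in> K"
    moreover have "w \<noteq> take m w" if "m < length w" for m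
      using that by (metis length_take less_irrefl min.absorb4)
    ultimately obtain m where "m < length v" "w = take m v" unfolding K_def by auto
    moreover from this have "m = length v - 1" using assms(3) by simp
    ultimately show False using False by (simp add: butlast_conv_take)
  qed
  define h where "h F = {path_time F v - path_time F w}" for F
  have hK: "h (\<lambda>u. \<Phi> u \<omega>) = h (restrict (\<lambda>u. \<Phi> u \<omega>) K)" for \<omega>
    unfolding h_def by (intro arg_cong[where f="\<lambda>x. {x}"] arg_cong2[where f="(-)"] path_time_cong) (auto simp: K_def)
  have "indep_var (PiM {w} (\<lambda>_. config_space)) (\<lambda>\<omega>. restrict (\<lambda>u. \<Phi> u \<omega>) {w})
      (PiM K (\<lambda>_. config_space)) (\<lambda>\<omega>. restrict (\<lambda>u. \<Phi> u \<omega>) K)"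
    using \<open>w \<notin> K\<close> by (intro indep_var_restrict[OF indep_offspring]) auto
  moreover have "(\<lambda>F. F w) \<in> PiM {w} (\<lambda>_. config_space) \<rightarrow>\<^sub>M config_space"
    by (rule measurable_component_singleton) simp
  moreover have "h \<in> PiM K (\<lambda>_. config_space) \<rightarrow>\<^sub>M config_space"
    unfolding h_def
    by (intro measurable_singleton_config_space borel_measurable_diff measurable_path_time[where \<Phi>="\<lambda>u F. F u"] measurable_component_singleton)
       (auto simp: K_def)
  ultimately have "indep_var config_space ((\<lambda>F. F w) \<circ> (\<lambda>\<omega>. restrict (\<lambda>u. \<Phi> u \<omega>) {w}))
      config_space (h \<circ> (\<lambda>\<omega>. restrict (\<lambda>u. \<Phi> u \<omega>) K))"
    by (rule indep_var_compose)
  then have "indep_var config_space (\<Phi> w) config_space (\<lambda>\<omega>. h (\<lambda>u. \<Phi> u \<omega>))"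
    unfolding hK comp_def by simp
  from AE_nth_neq[OF this, of i] show ?thesis
    by (rule AE_mp) (auto simp: h_def)
qed

text \<open>There are countably many pairs of labels, and in each pair the one that is not shorter
  can serve as \<open>w @ [i]\<close>; an empty \<open>v\<close> is harmless since only the root has
  time 0.\<close>

lemma AE_regular: "AE \<omega> in M. regular (\<lambda>u. \<Phi> u \<omega>)"
proof -
  have pos: "AE \<omega> in M. \<forall>u. finite (\<Phi> u \<omega>) \<and> \<Phi> u \<omega> \<inter> {..0} = {}"
    unfolding AE_all_countable
    using AE_finite AE_no_points[of "{..0}"] mass_null[of "{..0}"] f_zero by (auto intro: AE_conjI)
  have neq: "AE \<omega> in M. \<forall>w i v. v \<noteq> [] \<and> v \<noteq> w @ [i] \<and> length v \<le> Suc (length w) \<longrightarrow>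
      \<not> (alive (\<lambda>u. \<Phi> u \<omega>) (w @ [i]) \<and> alive (\<lambda>u. \<Phi> u \<omega>) v \<and>
           path_time (\<lambda>u. \<Phi> u \<omega>) (w @ [i]) = path_time (\<lambda>u. \<Phi> u \<omega>) v)"
    unfolding AE_all_countable using AE_path_time_neq by (auto simp del: path_time_snoc alive_snoc)
  from pos neq show ?thesis
  proof eventually_elim
    case (elim \<omega>)
    let ?F = "\<lambda>u. \<Phi> u \<omega>"
    have F: "finite (?F u)" "?F u \<subseteq> {0<..}" for u using elim(1) by (force, fastforce simp: not_le[symmetric])
    have nth_pos: "0 < sorted_list_of_set (?F u) ! i" if "i < card (?F u)" for u i
    proof -
      have "sorted_list_of_set (?F u) ! i \<in> ?F u"
        using that F(1) by (metis length_sorted_list_of_set nth_mem set_sorted_list_of_set)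
      then show ?thesis using F(2) by auto
    qed
    have nonneg: "0 \<le> path_time ?F u" if "alive ?F u" for u
      using that
    proof (induction u rule: rev_induct)
      case (snoc i u)
      then show ?case using nth_pos[of i u] by auto
    qed simp
    have pos: "0 < path_time ?F u" if "alive ?F u" "u \<noteq> []" for u
      using that nth_pos nonneg by (cases u rule: rev_cases) (auto intro: add_nonneg_pos)
    have *: "u = v" if "alive ?F u" "alive ?F v" "path_time ?F u = path_time ?F v" "length v \<le> length u" for u v
    proof (cases u rule: rev_cases)
      case Nil then show ?thesis using that by simp
    next
      case (snoc w i)
      have "v \<noteq> []" using pos[of u] that snoc by auto
      then show ?thesis using elim(2)[rule_format, of v w i] that snoc by (auto simp del: path_time_snoc alive_snoc)
    qed
    show ?case
      unfolding regular_def using F * by (metis nle_le)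
  qed
qed

end

section \<open>Measures on ordered cones\<close>

text \<open>With one point per box, boxes ordered left to right force the order of the points, so
  the rank of a point in \<open>S\<close> is the rank of its box. This turns a statement about
  sorted points into counts on disjoint sets, which is what a Poisson process prescribes.\<close>

lemma ordered_boxes_iff:
  fixes S :: "real set" and I :: "nat set"
  assumes "finite I" "finite S"
    and J: "\<And>i j x y. i \<in> I \<Longrightarrow> j \<in> I \<Longrightarrow> i < j \<Longrightarrow> x \<in> J i \<Longrightarrow> y \<in> J j \<Longrightarrow> x < y"
  shows "(card S = card I \<and> (\<forall>j\<in>I. sorted_list_of_set S ! card {a\<in>I. a < j} \<in> J j)) \<longleftrightarrow>
    ((\<forall>j\<in>I. card (S \<inter> J j) = 1) \<and> S \<subseteq> \<Union> (J ` I))" (is "?L \<longleftrightarrow> ?R")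
proof
  assume L: ?L
  define y where "y j = sorted_list_of_set S ! card {a\<in>I. a < j}" for j
  have yJ: "y j \<in> J j" if "j \<in> I" for j using L that by (simp add: y_def)
  have "strict_mono_on I y" using J yJ by (auto intro!: strict_mono_onI)
  then have inj: "inj_on y I" by (rule strict_mono_on_imp_inj_on)
  have "y ` I \<subseteq> S"
  proof safe
    fix j assume "j \<in> I"
    then have "card {a\<in>I. a < j} < card I" using assms(1) by (intro psubset_card_mono) auto
    then show "y j \<in> S" unfolding y_def
      using L assms(2) by (metis length_sorted_list_of_set nth_mem set_sorted_list_of_set)
  qed
  then have S: "S = y ` I" using L card_image[OF inj] assms(2) by (metis card_subset_eq)
  have "S \<inter> J j = {y j}" if "j \<in> I" for j
  proof -
    have "i = j" if "i \<in> I" "y i \<in> J j" for i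
      using J[of i j "y i" "y i"] J[of j i "y i" "y i"] yJ[OF that(1)] that \<open>j \<in> I\<close>
      by (cases i j rule: linorder_cases) auto
    then show ?thesis using S yJ that by auto
  qed
  then show ?R using S yJ by auto
next
  assume R: ?R
  then have "\<forall>j\<in>I. \<exists>y. S \<inter> J j = {y}" by (metis card_1_singletonE)
  then obtain y where y: "\<And>j. j \<in> I \<Longrightarrow> S \<inter> J j = {y j}" by metis
  have sm: "strict_mono_on I y" using J y by (intro strict_mono_onI) blast
  have S: "S = y ` I" using R y by blast
  show ?L
    using sorted_list_of_set_image_rank[OF assms(1) sm] y card_image[OF strict_mono_on_imp_inj_on[OF sm]]
    unfolding S by auto
qed

definition order_cone :: "'i set \<Rightarrow> ('i \<times> 'i) set \<Rightarrow> ('i \<Rightarrow> real) set" where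
  "order_cone I R = {x \<in> PiE I (\<lambda>_. UNIV). \<forall>(i, j)\<in>R. x i < x j}"

lemma order_cone_sets:
  assumes "finite I" "R \<subseteq> I \<times> I"
  shows "order_cone I R \<in> sets (Pi\<^sub>M I (\<lambda>_. lborel))"
proof -
  have fin: "finite R" using assms finite_subset by blast
  have "order_cone I R = {x \<in> space (Pi\<^sub>M I (\<lambda>_. lborel)). \<forall>z\<in>R. x (fst z) < x (snd z)}"
    by (auto simp: order_cone_def space_PiM split_beta)
  also have "\<dots> \<in> sets (Pi\<^sub>M I (\<lambda>_. lborel))"
  proof (rule sets.sets_Collect_finite_All[OF _ fin])
    fix z assume "z \<in> R"
    then have "fst z \<in> I" "snd z \<in> I" using assms(2) by auto
    show "{x \<in> space (Pi\<^sub>M I (\<lambda>_. lborel :: real measure)). x (fst z) < x (snd z)} \<in> sets (Pi\<^sub>M I (\<lambda>_. lborel))"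
    proof -
      have *: "(\<lambda>x. x i) \<in> borel_measurable (Pi\<^sub>M I (\<lambda>_. lborel :: real measure))" if "i \<in> I" for i
        using measurable_component_singleton[OF that, of "\<lambda>_. lborel :: real measure"] by simp
      note [measurable] = *[OF \<open>fst z \<in> I\<close>] *[OF \<open>snd z \<in> I\<close>]
      show ?thesis by measurable
    qed
  qed
  finally show ?thesis .
qed

text \<open>The cone is exhausted by disjoint unions of products of dyadic cells that are already ordered.\<close>

lemma measure_eqI_ordered_boxes:
  fixes P Q :: "('i \<Rightarrow> real) measure"
  assumes I: "finite I" "R \<subseteq> I \<times> I"
    and P: "sets P = sets (Pi\<^sub>M I (\<lambda>_. lborel))" and Q: "sets Q = sets (Pi\<^sub>M I (\<lambda>_. lborel))"
    and fin: "emeasure P (space P) \<noteq> \<infinity>"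
    and conc: "AE x in P. x \<in> order_cone I R" "AE x in Q. x \<in> order_cone I R"
    and eq: "\<And>J. (\<And>i. i \<in> I \<Longrightarrow> J i \<in> sets borel) \<Longrightarrow>
        (\<And>i j x y. (i, j) \<in> R \<Longrightarrow> x \<in> J i \<Longrightarrow> y \<in> J j \<Longrightarrow> x < y) \<Longrightarrow>
        emeasure P (Pi\<^sub>E I J) = emeasure Q (Pi\<^sub>E I J)"
  shows "P = Q"
proof (rule measure_eqI_PiM_finite[OF I(1) P Q])
  fix A :: "'i \<Rightarrow> real set" assume "\<And>i. i \<in> I \<Longrightarrow> A i \<in> sets lborel"
  then have A: "\<And>i. i \<in> I \<Longrightarrow> A i \<in> sets borel" by simp
  \<comment> \<open>At level \<open>n\<close> the order is required already of the dyadic cell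
    indices; two points in one cell are not yet separated.\<close>
  define cone where "cone n = {x \<in> PiE I (\<lambda>_. UNIV). \<forall>(i, j)\<in>R. \<lfloor>2 ^ n * x i :: real\<rfloor> < \<lfloor>2 ^ n * x j\<rfloor>}" for n :: nat
  define ind where "ind = {m \<in> PiE I (\<lambda>_. UNIV :: int set). \<forall>(i, j)\<in>R. m i < m j}"
  define box where "box n m = PiE I (\<lambda>i. A i \<inter> {x. \<lfloor>2 ^ n * x\<rfloor> = m i})" for n :: nat and m :: "'i \<Rightarrow> int"
  have ind: "countable ind" unfolding ind_def by (intro countable_subset[OF _ countable_PiE[OF I(1)]]) auto
  have cells: "{x::real. \<lfloor>2 ^ n * x\<rfloor> = c} \<in> sets borel" for n :: nat and c :: int by measurable
  have sets_box: "box n m \<in> sets (Pi\<^sub>M I (\<lambda>_. lborel))" for n m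
    unfolding box_def using I A cells by (intro sets_PiM_I_finite) auto
  have dec: "PiE I A \<inter> cone n = (\<Union>m\<in>ind. box n m)" for n
  proof (intro equalityI subsetI)
    fix x assume x: "x \<in> PiE I A \<inter> cone n"
    let ?m = "\<lambda>i\<in>I. \<lfloor>2 ^ n * x i\<rfloor>"
    have "restrict (\<lambda>i. \<lfloor>2 ^ n * x i\<rfloor>) I i < restrict (\<lambda>i. \<lfloor>2 ^ n * x i\<rfloor>) I j" if "(i, j) \<in> R" for i j
      using x that I(2) by (auto simp: cone_def)
    then have "?m \<in> ind" unfolding ind_def by (intro CollectI conjI ballI) (auto simp del: restrict_apply restrict_apply')
    moreover have "x \<in> box n ?m" using x by (auto simp: box_def PiE_iff)
    ultimately show "x \<in> (\<Union>m\<in>ind. box n m)" by blast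
  next
    fix x assume "x \<in> (\<Union>m\<in>ind. box n m)"
    then obtain m where m: "m \<in> ind" and x: "x \<in> box n m" by blast
    have "\<lfloor>2 ^ n * x i\<rfloor> < \<lfloor>2 ^ n * x j\<rfloor>" if "(i, j) \<in> R" for i j
    proof -
      have "i \<in> I" "j \<in> I" using that I(2) by auto
      then have "\<lfloor>2 ^ n * x i\<rfloor> = m i" "\<lfloor>2 ^ n * x j\<rfloor> = m j" using x by (auto simp: box_def PiE_iff)
      then show ?thesis using m that by (auto simp: ind_def)
    qed
    then show "x \<in> PiE I A \<inter> cone n"
      using x by (auto simp: box_def cone_def PiE_iff)
  qed
  have disj: "disjoint_family_on (box n) ind" for n
    unfolding disjoint_family_on_def
  proof (intro ballI impI)
    fix m m' assume m: "m \<in> ind" "m' \<in> ind" "m \<noteq> m'"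
    then obtain i where i: "i \<in> I" "m i \<noteq> m' i" by (metis (mono_tags, lifting) PiE_ext ind_def mem_Collect_eq)
    show "box n m \<inter> box n m' = {}"
    proof (rule ccontr)
      assume "box n m \<inter> box n m' \<noteq> {}"
      then obtain x where "x \<in> box n m" "x \<in> box n m'" by auto
      then show False using i by (auto simp: box_def PiE_iff)
    qed
  qed
  have eq_box: "emeasure P (box n m) = emeasure Q (box n m)" if m: "m \<in> ind" for n m
    unfolding box_def
  proof (rule eq)
    fix i j x y assume "(i, j) \<in> R" "x \<in> A i \<inter> {x. \<lfloor>2 ^ n * x\<rfloor> = m i}" "y \<in> A j \<inter> {x. \<lfloor>2 ^ n * x\<rfloor> = m j}"
    then have "\<lfloor>2 ^ n * x\<rfloor> < \<lfloor>2 ^ n * y\<rfloor>" using m by (auto simp: ind_def)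
    then have "2 ^ n * x < 2 ^ n * y" by (metis floor_mono linorder_not_less)
    then show "x < y" by simp
  qed (use A cells in auto)
  have eq_cone: "emeasure P (PiE I A \<inter> cone n) = emeasure Q (PiE I A \<inter> cone n)" for n
  proof -
    have "emeasure N (PiE I A \<inter> cone n) = (\<integral>\<^sup>+m. emeasure N (box n m) \<partial>count_space ind)"
      if "sets N = sets (Pi\<^sub>M I (\<lambda>_. lborel))" for N
      unfolding dec using sets_box that by (intro emeasure_UN_countable ind disj) auto
    moreover have "(\<integral>\<^sup>+m. emeasure P (box n m) \<partial>count_space ind) = (\<integral>\<^sup>+m. emeasure Q (box n m) \<partial>count_space ind)"
      using eq_box by (intro nn_integral_cong) auto
    ultimately show ?thesis using P Q by simp
  qed
  have sets_cone: "PiE I A \<inter> cone n \<in> sets (Pi\<^sub>M I (\<lambda>_. lborel))" for n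
    unfolding dec using sets_box ind by (intro sets.countable_UN'') auto
  \<comment> \<open>Halving the cells keeps separated points separated, since the boundary between
    their cells remains a boundary.\<close>
  have inc: "incseq (\<lambda>n. PiE I A \<inter> cone n)"
  proof (intro incseq_SucI Int_mono order_refl subsetI)
    fix n x assume x: "x \<in> cone n"
    have "\<lfloor>2 ^ Suc n * a\<rfloor> < \<lfloor>2 ^ Suc n * b\<rfloor>" if "\<lfloor>2 ^ n * a\<rfloor> < \<lfloor>2 ^ n * b\<rfloor>" for a b :: real
    proof -
      have "2 ^ n * a < \<lfloor>2 ^ n * b\<rfloor>" using that by (simp add: floor_less_iff)
      then have "2 ^ Suc n * a < 2 * \<lfloor>2 ^ n * b\<rfloor>" by simp
      moreover have "2 * \<lfloor>2 ^ n * b\<rfloor> \<le> \<lfloor>2 ^ Suc n * b\<rfloor>"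
        using of_int_floor_le[of "2 ^ n * b"] by (simp add: le_floor_iff)
      ultimately show ?thesis by (simp add: floor_less_iff)
    qed
    then show "x \<in> cone (Suc n)" using x unfolding cone_def by fast
  qed
  have un: "(\<Union>n. PiE I A \<inter> cone n) = PiE I A \<inter> order_cone I R"
  proof (intro equalityI subsetI)
    fix x assume "x \<in> (\<Union>n. PiE I A \<inter> cone n)"
    then obtain n where x: "x \<in> PiE I A" "x \<in> cone n" by auto
    have "a < b" if "\<lfloor>2 ^ n * a\<rfloor> < \<lfloor>2 ^ n * b\<rfloor>" for a b :: real
    proof -
      have "2 ^ n * a < 2 ^ n * b" using that by (metis floor_mono linorder_not_less)
      then show ?thesis by simp
    qed
    then show "x \<in> PiE I A \<inter> order_cone I R" using x by (force simp: cone_def order_cone_def)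
  next
    fix x assume x: "x \<in> PiE I A \<inter> order_cone I R"
    have "\<forall>\<^sub>F n in sequentially. \<lfloor>2 ^ n * a\<rfloor> < \<lfloor>2 ^ n * b\<rfloor>" if ab: "a < b" for a b :: real
    proof -
      have "\<forall>\<^sub>F n in sequentially. 1 / (b - a) \<le> 2 ^ n"
      proof -
        \<comment> \<open>Once the mesh \<open>1 / 2 ^ n\<close> is at most \<open>b - a\<close>,
          the two points lie in different cells.\<close>
        obtain n0 where "1 / (b - a) < 2 ^ n0" using real_arch_pow[of 2 "1 / (b - a)"] by auto
        then have "1 / (b - a) \<le> 2 ^ n" if "n \<ge> n0" for n
          using power_increasing[OF that, of "2::real"] by linarith
        then show ?thesis by (auto simp: eventually_sequentially)
      qed
      then show ?thesis
      proof eventually_elim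
        case (elim n)
        then have "1 \<le> 2 ^ n * (b - a)" using ab by (simp add: field_simps)
        then have "2 ^ n * a + 1 \<le> 2 ^ n * b" by (simp add: algebra_simps)
        then show ?case by linarith
      qed
    qed
    then have "\<forall>\<^sub>F n in sequentially. \<forall>z\<in>R. \<lfloor>2 ^ n * x (fst z)\<rfloor> < \<lfloor>2 ^ n * x (snd z)\<rfloor>"
      using x finite_subset[OF I(2)] I(1) by (intro eventually_ball_finite) (auto simp: order_cone_def)
    then obtain n where "\<forall>z\<in>R. \<lfloor>2 ^ n * x (fst z)\<rfloor> < \<lfloor>2 ^ n * x (snd z)\<rfloor>"
      using eventually_happens'[OF sequentially_bot] by blast
    then have "x \<in> cone n" using x by (auto simp: cone_def order_cone_def)
    then show "x \<in> (\<Union>n. PiE I A \<inter> cone n)" using x by auto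
  qed
  have lim: "emeasure N (PiE I A) = (SUP n. emeasure N (PiE I A \<inter> cone n))"
    if N: "sets N = sets (Pi\<^sub>M I (\<lambda>_. lborel))" and c: "AE x in N. x \<in> order_cone I R" for N
  proof -
    have "(SUP n. emeasure N (PiE I A \<inter> cone n)) = emeasure N (\<Union>n. PiE I A \<inter> cone n)"
      using sets_cone N by (intro SUP_emeasure_incseq inc) auto
    also have "\<dots> = emeasure N (PiE I A)"
      unfolding un using c order_cone_sets[OF I] A I N
      by (intro emeasure_eq_AE) (auto intro!: sets_PiM_I_finite)
    finally show ?thesis by simp
  qed
  show "emeasure P (PiE I A) = emeasure Q (PiE I A)"
    unfolding lim[OF P conc(1)] lim[OF Q conc(2)] eq_cone by simp
next
  show "range (\<lambda>_::nat. PiE I (\<lambda>_. UNIV)) \<subseteq> prod_algebra I (\<lambda>_. lborel :: real measure)"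
    using I by (auto intro!: prod_algebraI_finite)
qed (use fin sets_eq_imp_space_eq[OF P] in \<open>auto simp: space_PiM\<close>)

section \<open>Joint law of the offspring gaps\<close>

text \<open>The part of \<open>realises\<close> that concerns numbers of children only. The order of
  absolute times is deferred: it mixes different parents and would spoil the factorisation over
  independent offspring sets.\<close>

definition right_degrees :: "nat \<Rightarrow> (nat \<Rightarrow> nat) \<Rightarrow> (nat list \<Rightarrow> real set) \<Rightarrow> bool" where
  "right_degrees k p F \<longleftrightarrow>
     (\<forall>i\<le>k. finite (F (tree_label p i)) \<and> card (F (tree_label p i)) = card (children k p i))"

text \<open>Sorting the offspring sets constrains gaps only within one family, so these pairs are
  all the order relations that the gaps inherit.\<close>

definition siblings :: "nat \<Rightarrow> (nat \<Rightarrow> nat) \<Rightarrow> (nat \<times> nat) set" where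
  "siblings k p = {(i, j). i \<in> {1..k} \<and> j \<in> {1..k} \<and> i < j \<and> p i = p j}"

lemma siblings_subset: "siblings k p \<subseteq> {1..k} \<times> {1..k}"
  by (auto simp: siblings_def)

lemma sorted_points_in_config_space:
  assumes "finite I" "\<And>j. j \<in> I \<Longrightarrow> J j \<in> sets borel"
  shows "{S. finite S \<and> card S = c \<and> (\<forall>j\<in>I. sorted_list_of_set S ! r j \<in> J j)} \<in> sets config_space"
proof -
  have "{S. finite S \<and> card S = c \<and> (\<forall>j\<in>I. sorted_list_of_set S ! r j \<in> J j)} =
    {S. finite (S \<inter> UNIV) \<and> card (S \<inter> UNIV) = c} \<inter>
    {S \<in> space config_space. \<forall>j\<in>I. sorted_list_of_set S ! r j \<in> J j}" by auto
  also have "\<dots> \<in> sets config_space"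
  proof (intro sets.Int count_in_config_space sets.sets_Collect_finite_All assms(1))
    fix j assume "j \<in> I"
    then show "{S \<in> space config_space. sorted_list_of_set S ! r j \<in> J j} \<in> sets config_space"
      using measurable_sets[OF measurable_nth_config_space, of "J j" "r j"] assms(2)
      by (simp add: vimage_def)
  qed simp
  finally show ?thesis .
qed

context hawkes_cluster
begin

section \<open>The Poisson law on ordered boxes\<close>

lemma nn_integral_f:
  assumes "B \<in> sets borel"
  shows "(\<integral>\<^sup>+t. ennreal (f t) * indicator B t \<partial>lborel) = ennreal (mass B)"
proof -
  have "(\<integral>\<^sup>+t. ennreal (f t) * indicator B t \<partial>lborel) = (\<integral>\<^sup>+t. ennreal (indicator B t *\<^sub>R f t) \<partial>lborel)"
    by (intro nn_integral_cong) (auto simp: indicator_def)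
  also have "\<dots> = ennreal (\<integral>t. indicator B t *\<^sub>R f t \<partial>lborel)"
    using set_integrable_f[OF assms] f_nonneg unfolding set_integrable_def
    by (intro nn_integral_eq_integral) auto
  finally show ?thesis by (simp add: mass_def set_lebesgue_integral_def)
qed

lemma mass_nonneg: "0 \<le> mass B"
  unfolding mass_def set_lebesgue_integral_def using f_nonneg by (intro Bochner_Integration.integral_nonneg) auto

text \<open>The mean measure of one offspring process.\<close>

definition mu :: "real measure" where "mu = density lborel (\<lambda>t. ennreal (f t))"

lemma sets_mu [simp, measurable_cong]: "sets mu = sets borel" and space_mu [simp]: "space mu = UNIV"
  by (simp_all add: mu_def)

lemma emeasure_mu: "B \<in> sets borel \<Longrightarrow> emeasure mu B = ennreal (mass B)"
  unfolding mu_def by (simp add: emeasure_density nn_integral_f)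

lemma mass_eq: "B \<in> sets borel \<Longrightarrow> mass B = measure mu B"
  using emeasure_mu mass_nonneg by (simp add: measure_def)

lemma finite_measure_mu: "finite_measure mu"
  by (rule finite_measureI) (simp add: emeasure_mu)

lemma mass_UNIV: "mass UNIV = rho"
  by (simp add: mass_def rho_def set_lebesgue_integral_def)

lemma mass_sum:
  fixes B :: "nat \<Rightarrow> real set"
  assumes "finite I" "\<And>i. i \<in> I \<Longrightarrow> B i \<in> sets borel" "disjoint_family_on B I"
  shows "mass (\<Union>i\<in>I. B i) = (\<Sum>i\<in>I. mass (B i))"
proof -
  interpret mu: finite_measure mu by (rule finite_measure_mu)
  have "measure mu (\<Union>i\<in>I. B i) = (\<Sum>i\<in>I. measure mu (B i))"
    using assms by (intro mu.finite_measure_finite_Union) auto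
  then show ?thesis using assms by (simp add: mass_eq sets.finite_UN)
qed

lemma prob_card:
  assumes "B \<in> sets borel"
  shows "prob ((\<lambda>\<omega>. card (\<Phi> u \<omega> \<inter> B)) -` {n} \<inter> space M) = mass B ^ n / fact n * exp (- mass B)"
proof -
  have m: "(\<lambda>\<omega>. card (\<Phi> u \<omega> \<inter> B)) \<in> M \<rightarrow>\<^sub>M count_space UNIV"
    using measurable_compose[OF measurable_\<Phi> measurable_card_config_space[OF assms]] .
  have "prob ((\<lambda>\<omega>. card (\<Phi> u \<omega> \<inter> B)) -` {n} \<inter> space M) =
      prob {\<omega> \<in> space M. finite (\<Phi> u \<omega> \<inter> B) \<and> card (\<Phi> u \<omega> \<inter> B) = n}"
    using AE_finite[of u] by (intro finite_measure_eq_AE count_event[OF assms] measurable_sets[OF m]) auto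
  then show ?thesis using prob_count[OF assms] by simp
qed

text \<open>Each box must hold one point and the rest of the line none. A Poisson count of one has
  weight \<open>mass (J j)\<close> times its void factor, without factorial, and the void factors
  over a partition of the line multiply to \<open>exp (- rho)\<close>.\<close>

lemma prob_ordered_boxes:
  fixes I :: "nat set" and J :: "nat \<Rightarrow> real set"
  assumes I: "I \<subseteq> {1..k}" and B: "\<And>j. j \<in> I \<Longrightarrow> J j \<in> sets borel"
    and J: "\<And>i j x y. i \<in> I \<Longrightarrow> j \<in> I \<Longrightarrow> i < j \<Longrightarrow> x \<in> J i \<Longrightarrow> y \<in> J j \<Longrightarrow> x < y"
  shows "prob {\<omega> \<in> space M. finite (\<Phi> u \<omega>) \<and> card (\<Phi> u \<omega>) = card I \<and>
      (\<forall>j\<in>I. sorted_list_of_set (\<Phi> u \<omega>) ! card {a\<in>I. a < j} \<in> J j)} = exp (- rho) * (\<Prod>j\<in>I. mass (J j))"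
    (is "prob ?E = _")
proof -
  have fin: "finite I" by (rule finite_subset[OF I]) simp
  have "0 \<notin> I" using I by auto
  \<comment> \<open>Index 0 lies outside \<open>I\<close>, hence is free for the complement of all
    boxes; the remaining indices get the empty set. The result is a partition of the line indexed by
    an initial segment, as \<open>poisson_process\<close> demands.\<close>
  define B where "B j = (if j \<in> I then J j else if j = 0 then - \<Union> (J ` I) else {})" for j
  define n :: "nat \<Rightarrow> nat" where "n j = (if j \<in> I then 1 else 0)" for j
  have B_sets: "B j \<in> sets borel" for j
    unfolding B_def using assms(2) fin by (auto intro!: sets.finite_UN simp: Compl_eq_Diff_UNIV)
  have disj: "disjoint_family_on B {..<Suc k}"
    unfolding disjoint_family_on_def
  proof (intro ballI impI)
    fix i j :: nat assume "i \<noteq> j"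
    have "J i \<inter> J j = {}" if "i \<in> I" "j \<in> I"
      using J[of i j] J[of j i] that \<open>i \<noteq> j\<close> by (metis disjoint_iff linorder_neqE_nat order_less_irrefl)
    then show "B i \<inter> B j = {}" using \<open>i \<noteq> j\<close> by (auto simp: B_def)
  qed
  have un: "(\<Union>j\<in>{..<Suc k}. B j) = UNIV"
  proof -
    have "t \<in> (\<Union>j\<in>{..<Suc k}. B j)" for t
    proof (cases "t \<in> \<Union> (J ` I)")
      case True
      then obtain j where "j \<in> I" "t \<in> J j" by blast
      then show ?thesis using I by (intro UN_I[of j]) (auto simp: B_def)
    next
      case False
      then show ?thesis using \<open>0 \<notin> I\<close> by (intro UN_I[of 0]) (auto simp: B_def)
    qed
    then show ?thesis by blast
  qed
  have mass_un: "(\<Sum>j<Suc k. mass (B j)) = rho"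
    using mass_sum[OF _ B_sets disj] un mass_UNIV by simp
  let ?F = "\<lambda>j. (\<lambda>\<omega>. card (\<Phi> u \<omega> \<inter> B j)) -` {n j} \<inter> space M"
  have ev: "?F j \<in> events" for j
    using measurable_sets[OF measurable_compose[OF measurable_\<Phi> measurable_card_config_space[OF B_sets]]] by simp
  have "indep_vars (\<lambda>_. count_space UNIV) (\<lambda>i \<omega>. card (\<Phi> u \<omega> \<inter> B i)) {..<Suc k}"
    using poisson[of u] B_sets disj unfolding poisson_process_def by blast
  then have "prob (\<Inter>j\<in>{..<Suc k}. ?F j) = (\<Prod>j<Suc k. prob (?F j))"
    by (rule indep_varsD) auto
  also have "\<dots> = (\<Prod>j<Suc k. mass (B j) ^ n j * exp (- mass (B j)))"
    unfolding prob_card[OF B_sets] by (rule prod.cong) (auto simp: n_def)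
  also have "\<dots> = (\<Prod>j<Suc k. mass (B j) ^ n j) * exp (- rho)"
    by (simp add: prod.distrib exp_sum[symmetric] sum_negf mass_un del: prod.lessThan_Suc sum.lessThan_Suc)
  also have "(\<Prod>j<Suc k. mass (B j) ^ n j) = (\<Prod>j\<in>I. mass (J j))"
    using I by (intro prod.mono_neutral_cong_right) (auto simp: n_def B_def)
  finally have *: "prob (\<Inter>j\<in>{..<Suc k}. ?F j) = exp (- rho) * (\<Prod>j\<in>I. mass (J j))" by simp
  have iff: "(\<forall>j<Suc k. card (S \<inter> B j) = n j) \<longleftrightarrow> (card S = card I \<and>
      (\<forall>j\<in>I. sorted_list_of_set S ! card {a\<in>I. a < j} \<in> J j))" if "finite S" for S
  proof -
    have "(\<forall>j<Suc k. card (S \<inter> B j) = n j) \<longleftrightarrow> (\<forall>j\<in>I. card (S \<inter> J j) = 1) \<and> S \<subseteq> \<Union> (J ` I)"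
    proof
      assume L: "\<forall>j<Suc k. card (S \<inter> B j) = n j"
      have "card (S \<inter> J j) = 1" if "j \<in> I" for j
        using L[rule_format, of j] that I by (auto simp: B_def n_def)
      moreover have "card (S \<inter> - \<Union> (J ` I)) = 0"
        using L[rule_format, of 0] \<open>0 \<notin> I\<close> by (simp add: B_def n_def)
      then have "S \<inter> - \<Union> (J ` I) = {}" using that by simp
      ultimately show "(\<forall>j\<in>I. card (S \<inter> J j) = 1) \<and> S \<subseteq> \<Union> (J ` I)" by blast
    next
      assume R: "(\<forall>j\<in>I. card (S \<inter> J j) = 1) \<and> S \<subseteq> \<Union> (J ` I)"
      then have "S \<inter> - \<Union> (J ` I) = {}" by blast
      then show "\<forall>j<Suc k. card (S \<inter> B j) = n j" using R by (auto simp: B_def n_def)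
    qed
    then show ?thesis using ordered_boxes_iff[OF fin that J] by simp
  qed
  have "?E = \<Phi> u -` {S. finite S \<and> card S = card I \<and>
      (\<forall>j\<in>I. sorted_list_of_set S ! card {a\<in>I. a < j} \<in> J j)} \<inter> space M" by auto
  then have "?E \<in> events"
    using measurable_sets[OF measurable_\<Phi> sorted_points_in_config_space[OF fin assms(2)]] by simp
  moreover have "(\<Inter>j\<in>{..<Suc k}. ?F j) \<in> events" using ev by (intro sets.finite_INT) auto
  moreover have "AE \<omega> in M. (\<omega> \<in> ?E) = (\<omega> \<in> (\<Inter>j\<in>{..<Suc k}. ?F j))"
    using AE_finite[of u]
  proof (rule AE_mp, intro AE_I2 impI)
    fix \<omega> assume "\<omega> \<in> space M" "finite (\<Phi> u \<omega>)"
    then show "(\<omega> \<in> ?E) = (\<omega> \<in> (\<Inter>j\<in>{..<Suc k}. ?F j))" using iff[of "\<Phi> u \<omega>"] by auto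
  qed
  ultimately have "prob ?E = prob (\<Inter>j\<in>{..<Suc k}. ?F j)" by (intro finite_measure_eq_AE)
  with * show ?thesis by simp
qed

text \<open>The conditions split over \<open>k + 1\<close> distinct labels with independent
  offspring sets. Each event, childless or not, contributes one \<open>exp (- rho)\<close>.\<close>

lemma prob_gaps:
  assumes p: "p \<in> parent_functions k" and B: "\<And>j. j \<in> {1..k} \<Longrightarrow> J j \<in> sets borel"
    and J: "\<And>i j x y. (i, j) \<in> siblings k p \<Longrightarrow> x \<in> J i \<Longrightarrow> y \<in> J j \<Longrightarrow> x < y"
  shows "prob {\<omega> \<in> space M. right_degrees k p (\<lambda>u. \<Phi> u \<omega>) \<and>
      (\<forall>j\<in>{1..k}. offspring_gap p (\<lambda>u. \<Phi> u \<omega>) j \<in> J j)} = exp (- real (Suc k) * rho) * (\<Prod>j\<in>{1..k}. mass (J j))"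
    (is "prob ?E = _")
proof -
  define S where "S i = {X. finite X \<and> card X = card (children k p i) \<and>
      (\<forall>j\<in>children k p i. sorted_list_of_set X ! card {a \<in> children k p i. a < j} \<in> J j)}" for i
  have S_sets: "S i \<in> sets config_space" for i
    unfolding S_def using B by (intro sorted_points_in_config_space) (auto simp: children_def)
  \<comment> \<open>Independence is indexed by labels, so the conditions indexed by \<open>i\<close>
    are transported along the inverse of \<open>tree_label p\<close>.\<close>
  define T where "T u = S (the_inv_into {0..k} (tree_label p) u)" for u
  note inj = inj_tree_label[OF p]
  have T: "T (tree_label p i) = S i" if "i \<le> k" for i
    unfolding T_def using that by (subst the_inv_into_f_f[OF inj]) auto
  have gap: "offspring_gap p F j = sorted_list_of_set (F (tree_label p i)) ! card {a \<in> children k p i. a < j}"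
    if "j \<in> children k p i" for F i j
    using that sib_rank_children[OF that] by (auto simp: offspring_gap_def children_def)
  have "?E = (\<Inter>i\<in>{0..k}. \<Phi> (tree_label p i) -` S i \<inter> space M)"
  proof (intro equalityI subsetI)
    fix \<omega> assume \<omega>: "\<omega> \<in> ?E"
    have "\<Phi> (tree_label p i) \<omega> \<in> S i" if "i \<le> k" for i
    proof -
      have "sorted_list_of_set (\<Phi> (tree_label p i) \<omega>) ! card {a \<in> children k p i. a < j} \<in> J j"
        if "j \<in> children k p i" for j
      proof -
        have "offspring_gap p (\<lambda>u. \<Phi> u \<omega>) j \<in> J j" using \<omega> that by (auto simp: children_def)
        then show ?thesis unfolding gap[OF that] .
      qed
      then show ?thesis using \<omega> that by (auto simp: S_def right_degrees_def)
    qed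
    then show "\<omega> \<in> (\<Inter>i\<in>{0..k}. \<Phi> (tree_label p i) -` S i \<inter> space M)" using \<omega> by auto
  next
    fix \<omega> assume \<omega>: "\<omega> \<in> (\<Inter>i\<in>{0..k}. \<Phi> (tree_label p i) -` S i \<inter> space M)"
    then have *: "\<Phi> (tree_label p i) \<omega> \<in> S i" if "i \<le> k" for i using that by auto
    have "offspring_gap p (\<lambda>u. \<Phi> u \<omega>) j \<in> J j" if j: "j \<in> {1..k}" for j
    proof -
      have c: "j \<in> children k p (p j)" "p j \<le> k"
        using j parent_function_less[OF p j] by (auto simp: children_def)
      show ?thesis using *[OF c(2)] c(1) gap[OF c(1)] by (simp add: S_def)
    qed
    moreover have "right_degrees k p (\<lambda>u. \<Phi> u \<omega>)"
      using * by (auto simp: right_degrees_def S_def)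
    ultimately show "\<omega> \<in> ?E" using \<omega> by auto
  qed
  also have "\<dots> = (\<Inter>u\<in>tree_label p ` {0..k}. \<Phi> u -` T u \<inter> space M)"
    using T by auto
  also have "prob \<dots> = (\<Prod>u\<in>tree_label p ` {0..k}. prob (\<Phi> u -` T u \<inter> space M))"
    using S_sets by (intro indep_varsD[OF indep_offspring]) (auto simp: T_def)
  also have "\<dots> = (\<Prod>i\<in>{0..k}. prob (\<Phi> (tree_label p i) -` S i \<inter> space M))"
    using T by (subst prod.reindex[OF inj]) auto
  also have "\<dots> = (\<Prod>i\<in>{0..k}. exp (- rho) * (\<Prod>j\<in>children k p i. mass (J j)))"
  proof (rule prod.cong[OF refl])
    fix i
    have e: "\<Phi> (tree_label p i) -` S i \<inter> space M = {\<omega> \<in> space M. finite (\<Phi> (tree_label p i) \<omega>) \<and>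
       card (\<Phi> (tree_label p i) \<omega>) = card (children k p i) \<and>
      (\<forall>j\<in>children k p i. sorted_list_of_set (\<Phi> (tree_label p i) \<omega>) ! card {a\<in>children k p i. a < j} \<in> J j)}"
      by (auto simp: S_def)
    show "prob (\<Phi> (tree_label p i) -` S i \<inter> space M) = exp (- rho) * (\<Prod>j\<in>children k p i. mass (J j))"
      unfolding e
    proof (rule prob_ordered_boxes)
      fix a b x y assume "a \<in> children k p i" "b \<in> children k p i" "a < b" and xy: "x \<in> J a" "y \<in> J b"
      then have "(a, b) \<in> siblings k p" by (auto simp: children_def siblings_def)
      then show "x < y" using xy by (rule J)
    qed (use B in \<open>auto simp: children_def\<close>)
  qed
  also have "\<dots> = exp (- rho) ^ Suc k * (\<Prod>i\<in>{0..k}. \<Prod>j\<in>children k p i. mass (J j))"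
    by (simp add: prod.distrib)
  \<comment> \<open>Every non-root index is a child of exactly one parent.\<close>
  also have "(\<Prod>i\<in>{0..k}. \<Prod>j\<in>children k p i. mass (J j)) = (\<Prod>j\<in>{1..k}. mass (J j))"
    unfolding children_def
  proof (rule prod.group)
    show "p ` {1..k} \<subseteq> {0..k}" using parent_function_less[OF p] by fastforce
  qed auto
  also have "exp (- rho) ^ Suc k = exp (- real (Suc k) * rho)"
    by (simp only: exp_of_nat_mult[symmetric] mult_minus_left mult_minus_right)
  finally show ?thesis .
qed

lemma measurable_gap: "(\<lambda>\<omega>. offspring_gap p (\<lambda>u. \<Phi> u \<omega>) i) \<in> borel_measurable M"
  unfolding offspring_gap_def by (rule measurable_compose[OF measurable_\<Phi> measurable_nth_config_space])

lemma measurable_gaps: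
  "(\<lambda>\<omega>. \<lambda>i\<in>{1..k}. offspring_gap p (\<lambda>u. \<Phi> u \<omega>) i) \<in> M \<rightarrow>\<^sub>M lebesgue_prod k"
  using measurable_gap by (intro measurable_restrict) simp

lemma right_degrees_event: "{\<omega> \<in> space M. right_degrees k p (\<lambda>u. \<Phi> u \<omega>)} \<in> events"
proof -
  have "{\<omega> \<in> space M. right_degrees k p (\<lambda>u. \<Phi> u \<omega>)} =
    {\<omega> \<in> space M. \<forall>i\<in>{..k}. finite (\<Phi> (tree_label p i) \<omega> \<inter> UNIV) \<and>
       card (\<Phi> (tree_label p i) \<omega> \<inter> UNIV) = card (children k p i)}"
    by (auto simp: right_degrees_def)
  also have "\<dots> \<in> events" by (intro sets.sets_Collect_finite_All count_event) auto
  finally show ?thesis .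
qed

text \<open>Both sides, as measures in \<open>A\<close>, live on the cone of sibling orders and
  agree on ordered boxes by \<open>prob_gaps\<close>; this determines them.\<close>

lemma gap_law:
  assumes p: "p \<in> parent_functions k" and A: "A \<in> sets (lebesgue_prod k)"
  shows "emeasure M {\<omega> \<in> space M. right_degrees k p (\<lambda>u. \<Phi> u \<omega>) \<and>
        (\<lambda>i\<in>{1..k}. offspring_gap p (\<lambda>u. \<Phi> u \<omega>) i) \<in> A} =
    (\<integral>\<^sup>+x. ennreal (exp (- real (Suc k) * rho) * (\<Prod>i\<in>{1..k}. f (x i))) *
        indicator (order_cone {1..k} (siblings k p)) x * indicator A x \<partial>lebesgue_prod k)"
proof -
  let ?I = "{1..k}" and ?X = "\<lambda>\<omega>. \<lambda>i\<in>{1..k}. offspring_gap p (\<lambda>u. \<Phi> u \<omega>) i"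
  let ?D = "{\<omega> \<in> space M. right_degrees k p (\<lambda>u. \<Phi> u \<omega>)}"
  let ?C = "order_cone ?I (siblings k p)" and ?c = "exp (- real (Suc k) * rho)"
  let ?w = "\<lambda>x. ennreal (?c * (\<Prod>i\<in>?I. f (x i))) * indicator ?C x"
  define P where "P = distr (density M (indicator ?D)) (lebesgue_prod k) ?X"
  define Q where "Q = density (lebesgue_prod k) ?w"
  note [measurable] = measurable_gaps[of p k] right_degrees_event[of k p]
  interpret L: product_sigma_finite "\<lambda>_. lborel :: real measure" by standard
  have w [measurable]: "?w \<in> borel_measurable (lebesgue_prod k)"
  proof (intro borel_measurable_times_ennreal borel_measurable_indicator order_cone_sets siblings_subset)
    have "(\<lambda>x. f (x i)) \<in> borel_measurable (lebesgue_prod k)" if "i \<in> ?I" for i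
      using measurable_compose[OF measurable_component_singleton[OF that, of "\<lambda>_. lborel :: real measure"], of f borel] by simp
    then show "(\<lambda>x. ennreal (?c * (\<Prod>i\<in>?I. f (x i)))) \<in> borel_measurable (lebesgue_prod k)"
      by measurable
  qed simp
  have P: "emeasure P A = emeasure M {\<omega> \<in> space M. right_degrees k p (\<lambda>u. \<Phi> u \<omega>) \<and> ?X \<omega> \<in> A}"
    if [measurable]: "A \<in> sets (lebesgue_prod k)" for A
  proof -
    have "emeasure P A = (\<integral>\<^sup>+\<omega>. indicator ?D \<omega> * indicator (?X -` A \<inter> space M) \<omega> \<partial>M)"
      unfolding P_def using measurable_gaps[of p k] measurable_sets[OF measurable_gaps that, of p] right_degrees_event[of k p]
      by (subst emeasure_distr[OF _ that]) (auto simp: emeasure_density simp del: One_nat_def)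
    also have "\<dots> = (\<integral>\<^sup>+\<omega>. indicator (?D \<inter> (?X -` A \<inter> space M)) \<omega> \<partial>M)"
      by (simp add: indicator_inter_arith)
    also have "\<dots> = emeasure M (?D \<inter> (?X -` A \<inter> space M))"
      by (intro nn_integral_indicator sets.Int right_degrees_event measurable_sets[OF measurable_gaps that])
    also have "?D \<inter> (?X -` A \<inter> space M) = {\<omega> \<in> space M. right_degrees k p (\<lambda>u. \<Phi> u \<omega>) \<and> ?X \<omega> \<in> A}" by auto
    finally show ?thesis .
  qed
  have "P = Q"
  proof (rule measure_eqI_ordered_boxes[of ?I "siblings k p"])
    show "emeasure P (space P) \<noteq> \<infinity>"
      using P[OF sets.top] by (simp add: P_def)
    have "?X \<omega> \<in> ?C" if "right_degrees k p (\<lambda>u. \<Phi> u \<omega>)" for \<omega>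
    proof -
      have "offspring_gap p (\<lambda>u. \<Phi> u \<omega>) i < offspring_gap p (\<lambda>u. \<Phi> u \<omega>) j" if "(i, j) \<in> siblings k p" for i j
      proof -
        have ij: "i \<in> children k p (p j)" "j \<in> children k p (p j)" "i < j" "p i = p j" "p j \<le> k"
          using that parent_function_less[OF p, of j] by (auto simp: siblings_def children_def)
        have "sib_rank p j < card (\<Phi> (tree_label p (p j)) \<omega>)"
          using sib_rank_less[OF ij(2)] \<open>right_degrees k p _\<close> ij(5) by (simp add: right_degrees_def)
        then show ?thesis unfolding offspring_gap_def ij(4) using sib_rank_less_iff[OF ij(1,2)] ij(3)
          by (intro sorted_wrt_nth_less[where P="(<)"]) auto
      qed
      then show ?thesis by (auto simp: order_cone_def siblings_def)
    qed
    then have e: "{\<omega> \<in> space M. right_degrees k p (\<lambda>u. \<Phi> u \<omega>) \<and> ?X \<omega> \<in> space (lebesgue_prod k) - ?C} = {}"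
      by blast
    have C: "?C \<in> sets (lebesgue_prod k)" by (intro order_cone_sets siblings_subset) simp
    then have "emeasure P (space (lebesgue_prod k) - ?C) = 0"
      using P[of "space (lebesgue_prod k) - ?C"] unfolding e by simp
    then show "AE x in P. x \<in> ?C"
      using C by (intro AE_I[of _ _ "space (lebesgue_prod k) - ?C"]) (auto simp: P_def)
    show "AE x in Q. x \<in> ?C"
      unfolding Q_def by (subst AE_density[OF w]) (auto simp: indicator_def)
    fix J :: "nat \<Rightarrow> real set"
    assume B: "\<And>i. i \<in> ?I \<Longrightarrow> J i \<in> sets borel"
      and J: "\<And>i j x y. (i, j) \<in> siblings k p \<Longrightarrow> x \<in> J i \<Longrightarrow> y \<in> J j \<Longrightarrow> x < y"
    have box: "PiE ?I J \<in> sets (lebesgue_prod k)" using B by (intro sets_PiM_I_finite) auto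
    have "emeasure P (PiE ?I J) = emeasure M {\<omega> \<in> space M. right_degrees k p (\<lambda>u. \<Phi> u \<omega>) \<and>
      (\<forall>j\<in>{1..k}. offspring_gap p (\<lambda>u. \<Phi> u \<omega>) j \<in> J j)}"
      unfolding P[OF box] by (intro arg_cong[where f="emeasure M"]) (auto simp: PiE_iff)
    also have "\<dots> = ennreal (?c * (\<Prod>j\<in>?I. mass (J j)))"
      unfolding emeasure_eq_measure using prob_gaps[OF p B J] by simp
    also have "\<dots> = ennreal ?c * (\<Prod>j\<in>?I. \<integral>\<^sup>+t. ennreal (f t) * indicator (J j) t \<partial>lborel)"
      using B by (simp add: nn_integral_f ennreal_mult' prod_ennreal mass_nonneg prod_nonneg)
    also have "\<dots> = ennreal ?c * (\<integral>\<^sup>+x. (\<Prod>j\<in>?I. ennreal (f (x j)) * indicator (J j) (x j)) \<partial>lebesgue_prod k)"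
      using B by (subst L.product_nn_integral_prod) auto
    also have "\<dots> = (\<integral>\<^sup>+x. ennreal ?c * (\<Prod>j\<in>?I. ennreal (f (x j)) * indicator (J j) (x j)) \<partial>lebesgue_prod k)"
    proof (intro nn_integral_cmult[symmetric] borel_measurable_prod_ennreal)
      fix j assume j: "j \<in> ?I"
      note [measurable] = B[OF j]
      have "(\<lambda>t. ennreal (f t) * indicator (J j) t) \<in> borel_measurable lborel" by measurable
      from measurable_compose[OF measurable_component_singleton[OF j] this]
      show "(\<lambda>x. ennreal (f (x j)) * indicator (J j) (x j)) \<in> borel_measurable (lebesgue_prod k)" .
    qed
    also have "\<dots> = (\<integral>\<^sup>+x. ?w x * indicator (PiE ?I J) x \<partial>lebesgue_prod k)"
    proof (rule nn_integral_cong)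
      fix x assume x: "x \<in> space (lebesgue_prod k)"
      show "ennreal ?c * (\<Prod>j\<in>?I. ennreal (f (x j)) * indicator (J j) (x j)) = ?w x * indicator (PiE ?I J) x"
      proof (cases "x \<in> PiE ?I J")
        case True
        \<comment> \<open>An ordered box lies inside the cone, so the indicator of the cone is 1 on
          it.\<close>
        then have "x \<in> ?C" using J siblings_subset[of k p] by (fastforce simp: order_cone_def PiE_iff)
        then show ?thesis using True f_nonneg
          by (auto simp: PiE_iff ennreal_mult' prod_ennreal prod_nonneg)
      next
        case False
        then obtain j where "j \<in> ?I" "x j \<notin> J j" using x by (auto simp: space_PiM PiE_iff)
        then have "(\<Prod>j\<in>?I. ennreal (f (x j)) * indicator (J j) (x j)) = 0"
          by (intro prod_zero bexI[of _ j]) auto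
        then show ?thesis using False by simp
      qed
    qed
    also have "\<dots> = emeasure Q (PiE ?I J)"
      unfolding Q_def by (rule emeasure_density[OF w box, symmetric])
    finally show "emeasure P (PiE ?I J) = emeasure Q (PiE ?I J)" .
  qed (simp_all add: P_def Q_def siblings_subset del: One_nat_def)
  moreover have "emeasure Q A = (\<integral>\<^sup>+x. ?w x * indicator A x \<partial>lebesgue_prod k)"
    unfolding Q_def by (rule emeasure_density[OF w A])
  ultimately show ?thesis using P[OF A] by argo
qed

end

section \<open>Changes of variables\<close>

text \<open>The distribution function is continuous, so a superlevel set is a half-line starting
  where the level \<open>y\<close> is attained and has mass \<open>measure M UNIV - y\<close>. Flat
  stretches are allowed, which matters because the kernel may vanish on intervals.\<close>

lemma (in finite_borel_measure) distr_cdf_atomless: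
  assumes atomless: "\<And>x. measure M {x} = 0"
  shows "distr M borel (cdf M) = density lborel (indicator {0<..<measure M UNIV})"
proof (rule measure_eqI_lessThan)
  let ?H = "cdf M" and ?c = "measure M UNIV"
  have space: "space M = UNIV" by (rule borel_UNIV)
  have cont: "isCont ?H x" for x using isCont_cdf atomless by simp
  then have contH: "continuous_on UNIV ?H" by (simp add: continuous_at_imp_continuous_on)
  have [measurable]: "?H \<in> borel_measurable borel" by (rule borel_measurable_continuous_onI[OF contH])
  have [measurable_cong]: "sets M = sets borel" by (rule M_is_borel)
  have mono: "x \<le> y \<Longrightarrow> ?H x \<le> ?H y" for x y by (rule cdf_nondecreasing)
  have bound: "0 \<le> ?H x" "?H x \<le> ?c" for x using cdf_nonneg cdf_bounded by (simp_all add: space)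
  have greater: "measure M {s<..} = ?c - ?H s" for s
  proof -
    have "measure M (UNIV - {..s}) = ?c - measure M {..s}"
      using finite_measure_compl[of "{..s}"] by (simp add: space)
    moreover have "UNIV - {..s} = {s<..}" by auto
    ultimately show ?thesis by (simp add: cdf_def2)
  qed
  have main: "measure M {s. y < ?H s} = ?c - y" if y: "0 \<le> y" "y < ?c" for y
  proof (cases "\<exists>s. ?H s \<le> y")
    \<comment> \<open>No value is at or below \<open>y\<close>; the limit 0 at minus infinity forces
      \<open>y = 0\<close>, and the superlevel set is the whole line.\<close>
    case False
    have "y \<le> 0"
    proof (rule ccontr)
      assume "\<not> y \<le> 0"
      then have "\<forall>\<^sub>F s in at_bot. ?H s < y" using cdf_lim_at_bot by (intro order_tendstoD(2)) auto
      then show False using False by (auto dest!: eventually_happens simp: less_eq_real_def)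
    qed
    moreover have "{s. y < ?H s} = UNIV" using False by (auto simp: not_le)
    ultimately show ?thesis using y by simp
  next
    case True
    let ?S = "{s. ?H s \<le> y}"
    have "\<forall>\<^sub>F s in at_top. y < ?H s" using cdf_lim_at_top y by (intro order_tendstoD(1)) (auto simp: space)
    then obtain b where b: "\<And>s. s \<ge> b \<Longrightarrow> y < ?H s" unfolding eventually_at_top_linorder by blast
    have bdd: "bdd_above ?S"
    proof (rule bdd_aboveI[of _ b], rule ccontr)
      fix s assume "s \<in> ?S" "\<not> s \<le> b"
      then show False using b[of s] by simp
    qed
    have "closed ?S" using contH by (intro closed_Collect_le) auto
    then have Sup: "Sup ?S \<in> ?S" using True bdd by (intro closed_contains_Sup) auto
    have S: "?S = {..Sup ?S}"
      using Sup mono bdd cSup_upper[OF _ bdd] by (auto intro: order_trans)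
    \<comment> \<open>Otherwise continuity would extend the sublevel set beyond its
      supremum.\<close>
    have "y \<le> ?H (Sup ?S)"
    proof (rule ccontr)
      assume "\<not> y \<le> ?H (Sup ?S)"
      then have "\<forall>\<^sub>F s in at (Sup ?S). ?H s < y"
        using cont[of "Sup ?S"] unfolding isCont_def by (intro order_tendstoD(2)) auto
      then have "\<forall>\<^sub>F s in at_right (Sup ?S). ?H s < y \<and> Sup ?S < s"
        by (auto simp: eventually_at_split eventually_at_right_less intro: eventually_conj)
      then obtain s where "?H s < y" "Sup ?S < s" using eventually_happens by fastforce
      then show False using cSup_upper[OF _ bdd, of s] by auto
    qed
    then have "?H (Sup ?S) = y" using Sup by simp
    moreover have "{s. y < ?H s} = {Sup ?S<..}" using S by (metis (no_types, lifting) Collect_cong atMost_iff greaterThan_def linorder_not_less mem_Collect_eq)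
    ultimately show ?thesis using greater by simp
  qed
  have val: "emeasure (distr M borel ?H) {y<..} = ennreal (measure M {s. y < ?H s})" for y
    by (simp add: emeasure_distr emeasure_eq_measure space vimage_def)
  show "emeasure (distr M borel ?H) {y<..} < \<infinity>" for y by (simp add: val)
  show "emeasure (distr M borel ?H) {y<..} = emeasure (density lborel (indicator {0<..<?c})) {y<..}" for y
  proof -
    have "emeasure (density lborel (indicator {0<..<?c})) {y<..} = (\<integral>\<^sup>+x. indicator {0<..<?c} x * indicator {y<..} x \<partial>lborel)"
      by (simp add: emeasure_density)
    also have "\<dots> = emeasure lborel ({0<..<?c} \<inter> {y<..})"
      by (simp add: indicator_inter_arith[symmetric])
    finally have Q: "emeasure (density lborel (indicator {0<..<?c})) {y<..} = emeasure lborel ({0<..<?c} \<inter> {y<..})" .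
    consider "y < 0" | "0 \<le> y" "y < ?c" | "?c \<le> y" by linarith
    then show ?thesis
    proof cases
      case 1
      then have "{s. y < ?H s} = UNIV" "{0<..<?c} \<inter> {y<..} = {0<..<?c}" using bound(1) by (auto intro: less_le_trans)
      then show ?thesis unfolding val Q by simp
    next
      case 2
      then have "{0<..<?c} \<inter> {y<..} = {y<..<?c}" by auto
      then show ?thesis unfolding val Q main[OF 2] using 2 by simp
    next
      case 3
      then have "{s. y < ?H s} = {}" "{0<..<?c} \<inter> {y<..} = {}" using bound(2) by (auto simp: not_less intro: order_trans)
      then show ?thesis unfolding val Q by simp
    qed
  qed
qed auto

text \<open>On a flat stretch to the right of \<open>a\<close>, \<open>a < s\<close> does not give
  \<open>cdf M a < cdf M s\<close>. Such \<open>s\<close> satisfy \<open>cdf M s = cdf M a\<close>,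
  a null event, because the transformed law has no atoms.\<close>

lemma (in finite_borel_measure) nn_integral_cdf_atomless:
  assumes atomless: "\<And>x. measure M {x} = 0" and h [measurable]: "h \<in> borel_measurable borel"
  shows "(\<integral>\<^sup>+s. indicator {a<..} s * h (cdf M s) \<partial>M) =
    (\<integral>\<^sup>+y. indicator {cdf M a<..<measure M UNIV} y * h y \<partial>lborel)"
proof -
  let ?H = "cdf M" and ?c = "measure M UNIV"
  have [measurable_cong]: "sets M = sets borel" by (rule M_is_borel)
  have "isCont ?H x" for x using isCont_cdf atomless by simp
  then have [measurable]: "?H \<in> borel_measurable borel"
    by (intro borel_measurable_continuous_onI) (simp add: continuous_at_imp_continuous_on)
  have law: "(\<integral>\<^sup>+s. k (?H s) \<partial>M) = (\<integral>\<^sup>+y. indicator {0<..<?c} y * k y \<partial>lborel)"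
    if [measurable]: "k \<in> borel_measurable borel" for k :: "real \<Rightarrow> ennreal"
  proof -
    have "(\<integral>\<^sup>+s. k (?H s) \<partial>M) = (\<integral>\<^sup>+y. k y \<partial>distr M borel ?H)" by (simp add: nn_integral_distr)
    then show ?thesis by (simp add: distr_cdf_atomless[OF atomless] nn_integral_density)
  qed
  have "(\<integral>\<^sup>+s. indicator {?H a} (?H s) \<partial>M) = (\<integral>\<^sup>+y. indicator {0<..<?c} y * indicator {?H a} y \<partial>lborel)"
    by (rule law) simp
  also have "\<dots> = (\<integral>\<^sup>+y. 0 \<partial>(lborel :: real measure))"
    using AE_lborel_singleton[of "?H a"] by (intro nn_integral_cong_AE) (auto elim!: eventually_mono simp: indicator_def)
  finally have "(\<integral>\<^sup>+s. indicator {?H a} (?H s) \<partial>M) = 0" by simp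
  then have "AE s in M. indicator {?H a} (?H s) = (0 :: ennreal)"
    by (subst (asm) nn_integral_0_iff_AE) auto
  then have "AE s in M. indicator {a<..} s * h (?H s) = indicator {?H a<..} (?H s) * h (?H s)"
  proof eventually_elim
    case (elim s)
    then have "?H s \<noteq> ?H a" by (auto simp: indicator_def)
    then have "a < s \<longleftrightarrow> ?H a < ?H s" using cdf_nondecreasing[of a s] cdf_nondecreasing[of s a] by force
    then show ?case by (simp add: indicator_def)
  qed
  then have "(\<integral>\<^sup>+s. indicator {a<..} s * h (?H s) \<partial>M) = (\<integral>\<^sup>+s. indicator {?H a<..} (?H s) * h (?H s) \<partial>M)"
    by (rule nn_integral_cong_AE)
  also have "\<dots> = (\<integral>\<^sup>+y. indicator {0<..<?c} y * (indicator {?H a<..} y * h y) \<partial>lborel)"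
    by (rule law[of "\<lambda>y. indicator {?H a<..} y * h y"]) measurable
  also have "\<dots> = (\<integral>\<^sup>+y. indicator {?H a<..<?c} y * h y \<partial>lborel)"
    using cdf_nonneg[of a] by (intro nn_integral_cong) (auto simp: indicator_def)
  finally show ?thesis .
qed

section \<open>From relative to absolute birth times\<close>

lemma tree_time_cong:
  assumes "\<And>j. 1 \<le> j \<Longrightarrow> j \<le> i \<Longrightarrow> x j = y j"
  shows "tree_time p x i = tree_time p y i"
  using assms
proof (induction i rule: less_induct)
  case (less i)
  then show ?case
    by (cases "0 < i \<and> p i < i") (auto simp: tree_time_rec tree_time.simps[of p x i] tree_time.simps[of p y i])
qed

lemma measurable_tree_time:
  assumes "i \<le> k"
  shows "(\<lambda>x. tree_time p x i) \<in> borel_measurable (lebesgue_prod k)"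
  using assms
proof (induction i rule: less_induct)
  case (less i)
  show ?case
  proof (cases "0 < i \<and> p i < i")
    case True
    then have "(\<lambda>x. x i) \<in> borel_measurable (lebesgue_prod k)"
      using measurable_component_singleton[of i "{1..k}" "\<lambda>_. lborel :: real measure"] less.prems by simp
    moreover have "(\<lambda>x. tree_time p x (p i)) \<in> borel_measurable (lebesgue_prod k)"
      using less True by simp
    ultimately show ?thesis using True by (simp add: tree_time_rec)
  next
    case False
    then have "(\<lambda>x. tree_time p x i) = (\<lambda>_. 0)" by (auto simp: tree_time.simps[of p _ i])
    then show ?thesis by simp
  qed
qed

lemma measurable_tree_times:
  "(\<lambda>x. \<lambda>i\<in>{1..k}. tree_time p x i) \<in> lebesgue_prod k \<rightarrow>\<^sub>M lebesgue_prod k"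
  using measurable_tree_time by (intro measurable_restrict) simp

lemma atLeastAtMost_1_Suc: "{1..Suc k} = insert (Suc k) {1..k}"
  by auto

lemma measurable_lebesgue_prod_upd:
  "(\<lambda>(x, y). x(Suc k := y)) \<in> lebesgue_prod k \<Otimes>\<^sub>M lborel \<rightarrow>\<^sub>M lebesgue_prod (Suc k)"
  unfolding atLeastAtMost_1_Suc by (rule measurable_add_dim)

lemma measurable_lebesgue_prod_upd1:
  assumes "x \<in> space (lebesgue_prod k)"
  shows "(\<lambda>y. x(Suc k := y)) \<in> borel \<rightarrow>\<^sub>M lebesgue_prod (Suc k)"
  using measurable_compose[OF measurable_Pair1'[OF assms, of "lborel :: real measure"] measurable_lebesgue_prod_upd] by simp

lemma nn_integral_lebesgue_prod_Suc:
  assumes "h \<in> borel_measurable (lebesgue_prod (Suc k))"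
  shows "(\<integral>\<^sup>+x. h x \<partial>lebesgue_prod (Suc k)) = (\<integral>\<^sup>+x. \<integral>\<^sup>+y. h (x(Suc k := y)) \<partial>lborel \<partial>lebesgue_prod k)"
proof -
  interpret product_sigma_finite "\<lambda>_. lborel :: real measure" by standard
  show ?thesis using assms unfolding atLeastAtMost_1_Suc by (intro product_nn_integral_insert) auto
qed

lemma measurable_nn_integral_upd:
  assumes "h \<in> borel_measurable (lebesgue_prod (Suc k))"
  shows "(\<lambda>x. \<integral>\<^sup>+y. h (x(Suc k := y)) \<partial>lborel) \<in> borel_measurable (lebesgue_prod k)"
  using measurable_compose[OF measurable_lebesgue_prod_upd assms]
  by (intro lborel.borel_measurable_nn_integral) (simp add: split_beta')

lemma nn_integral_lebesgue_prod_0: "(\<integral>\<^sup>+x. h x \<partial>lebesgue_prod 0) = h (\<lambda>_. undefined)"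
  by (simp add: PiM_empty nn_integral_count_space_finite)

text \<open>The map is unit triangular: the new time is the new gap plus the time of an earlier
  individual, which does not involve the new gap. With the earlier coordinates fixed it is a
  translation.\<close>

lemma nn_integral_tree_times:
  assumes "\<And>i. i \<in> {1..k} \<Longrightarrow> p i < i" and "h \<in> borel_measurable (lebesgue_prod k)"
  shows "(\<integral>\<^sup>+x. h (\<lambda>i\<in>{1..k}. tree_time p x i) \<partial>lebesgue_prod k) = (\<integral>\<^sup>+t. h t \<partial>lebesgue_prod k)"
  using assms
proof (induction k arbitrary: h)
  case 0
  show ?case unfolding nn_integral_lebesgue_prod_0 by (simp add: restrict_def)
next
  case (Suc k)
  let ?T = "\<lambda>k x. \<lambda>i\<in>{1..k}. tree_time p x i"
  have pk: "p (Suc k) < Suc k" using Suc.prems(1)[of "Suc k"] by simp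
  \<comment> \<open>The factor \<open>1 * y\<close> gives the inner substitution the affine form of
    \<open>nn_integral_real_affine\<close>.\<close>
  have upd: "?T (Suc k) (x(Suc k := y)) = (?T k x)(Suc k := tree_time p x (p (Suc k)) + 1 * y)" for x y
  proof
    fix i
    have "tree_time p (x(Suc k := y)) j = tree_time p x j" if "j \<le> k" for j
      using that by (intro tree_time_cong) auto
    moreover have "tree_time p (x(Suc k := y)) (Suc k) = tree_time p (x(Suc k := y)) (p (Suc k)) + y"
      using pk by (subst tree_time_rec) auto
    ultimately show "?T (Suc k) (x(Suc k := y)) i = ((?T k x)(Suc k := tree_time p x (p (Suc k)) + 1 * y)) i"
      using pk by (auto simp: le_Suc_eq)
  qed
  have "(\<integral>\<^sup>+x. h (?T (Suc k) x) \<partial>lebesgue_prod (Suc k)) =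
      (\<integral>\<^sup>+x. \<integral>\<^sup>+y. h ((?T k x)(Suc k := tree_time p x (p (Suc k)) + 1 * y)) \<partial>lborel \<partial>lebesgue_prod k)"
    unfolding upd[symmetric]
    by (rule nn_integral_lebesgue_prod_Suc) (rule measurable_compose[OF measurable_tree_times Suc.prems(2)])
  also have "\<dots> = (\<integral>\<^sup>+x. \<integral>\<^sup>+y. h ((?T k x)(Suc k := y)) \<partial>lborel \<partial>lebesgue_prod k)"
  proof (rule nn_integral_cong)
    fix x assume "x \<in> space (lebesgue_prod k)"
    have "?T k x \<in> space (lebesgue_prod k)" by (simp add: space_PiM)
    then have "(\<lambda>y. h ((?T k x)(Suc k := y))) \<in> borel_measurable borel"
      using measurable_compose[OF measurable_lebesgue_prod_upd1 Suc.prems(2)] by blast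
    from nn_integral_real_affine[OF this, of 1]
    show "(\<integral>\<^sup>+y. h ((?T k x)(Suc k := tree_time p x (p (Suc k)) + 1 * y)) \<partial>lborel) = (\<integral>\<^sup>+y. h ((?T k x)(Suc k := y)) \<partial>lborel)"
      by simp
  qed
  also have "\<dots> = (\<integral>\<^sup>+x. \<integral>\<^sup>+y. h (x(Suc k := y)) \<partial>lborel \<partial>lebesgue_prod k)"
    using Suc.prems(1) by (intro Suc.IH[of "\<lambda>x. \<integral>\<^sup>+y. h (x(Suc k := y)) \<partial>lborel"] measurable_nn_integral_upd Suc.prems(2)) auto
  also have "\<dots> = (\<integral>\<^sup>+x. h x \<partial>lebesgue_prod (Suc k))"
    by (rule nn_integral_lebesgue_prod_Suc[OF Suc.prems(2), symmetric])
  finally show ?case .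
qed

section \<open>Intensity and compensator\<close>

text \<open>Vectors are indexed from 1; index 0 supplies the initial event at time 0. Applied to
  compensator points, it supplies the lower bound 0 of the first one.\<close>

definition rooted :: "(nat \<Rightarrow> real) \<Rightarrow> nat \<Rightarrow> real" where
  "rooted t i = (if i = 0 then 0 else t i)"

definition increasing_epochs :: "nat \<Rightarrow> (nat \<Rightarrow> real) \<Rightarrow> bool" where
  "increasing_epochs k t \<longleftrightarrow> (\<forall>i<k. rooted t i < rooted t (Suc i))"

lemma rooted_simps [simp]: "rooted t 0 = 0" "rooted t (Suc i) = t (Suc i)"
  by (simp_all add: rooted_def)

lemma rooted_upd [simp]: "i \<le> k \<Longrightarrow> rooted (t(Suc k := s)) i = rooted t i"
  by (simp add: rooted_def)

lemma increasing_upd: "increasing_epochs (Suc k) (t(Suc k := s)) \<longleftrightarrow> increasing_epochs k t \<and> rooted t k < s"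
  by (auto simp: increasing_epochs_def less_Suc_eq)

lemma measurable_rooted:
  assumes "i \<le> k"
  shows "(\<lambda>t. rooted t i) \<in> borel_measurable (lebesgue_prod k)"
proof (cases "i = 0")
  case False
  then show ?thesis
    using measurable_component_singleton[of i "{1..k}" "\<lambda>_. lborel :: real measure"] assms by (simp add: rooted_def)
qed simp

lemma increasing_sets: "{t \<in> space (lebesgue_prod k). increasing_epochs k t} \<in> sets (lebesgue_prod k)"
proof -
  have "{t \<in> space (lebesgue_prod k). increasing_epochs k t} =
    {t \<in> space (lebesgue_prod k). \<forall>i\<in>{..<k}. rooted t i < rooted t (Suc i)}"
    by (auto simp: increasing_epochs_def)
  also have "\<dots> \<in> sets (lebesgue_prod k)"
  proof (rule sets.sets_Collect_finite_All)
    fix i assume "i \<in> {..<k}"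
    then show "{t \<in> space (lebesgue_prod k). rooted t i < rooted t (Suc i)} \<in> sets (lebesgue_prod k)"
      by (intro borel_measurable_less measurable_rooted) auto
  qed simp
  finally show ?thesis .
qed

lemma measurable_increasing:
  "(\<lambda>t. indicator {t. increasing_epochs k t} t :: ennreal) \<in> borel_measurable (lebesgue_prod k)"
proof -
  have "(\<lambda>t. indicator {t \<in> space (lebesgue_prod k). increasing_epochs k t} t :: ennreal) \<in> borel_measurable (lebesgue_prod k)"
    using increasing_sets by (rule borel_measurable_indicator)
  then show ?thesis by (rule measurable_cong[THEN iffD1, rotated]) (auto simp: indicator_def)
qed

context hawkes_cluster
begin

definition intensity :: "nat \<Rightarrow> (nat \<Rightarrow> real) \<Rightarrow> real" where
  "intensity i t = (\<Sum>j<i. f (rooted t i - rooted t j))"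

text \<open>Since \<open>f\<close> vanishes on nonpositive times, \<open>mass {..s}\<close> is the
  kernel integral over \<open>{0..s}\<close>, in a form that is monotone in \<open>s\<close> on the
  whole line.\<close>

definition compensator :: "nat \<Rightarrow> (nat \<Rightarrow> real) \<Rightarrow> real" where
  "compensator i t = (\<Sum>j<i. mass {..rooted t i - rooted t j})"

text \<open>Through \<open>rooted\<close> the first coordinate is strictly positive, unlike in
  \<open>hawkes_polytope\<close>; within the product space the two differ by a null set.\<close>

definition in_polytope :: "nat \<Rightarrow> (nat \<Rightarrow> real) \<Rightarrow> bool" where
  "in_polytope k y \<longleftrightarrow> increasing_epochs k y \<and> (\<forall>i\<in>{1..k}. y i < real i * rho)"

lemma rho_nonneg: "0 \<le> rho"
  using mass_nonneg[of UNIV] by (simp add: mass_UNIV)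

lemma mass_atMost_0: "mass {..0} = 0"
  by (rule mass_null) (simp_all add: f_zero)

lemma measurable_mass_atMost [measurable]: "(\<lambda>x. mass {..x}) \<in> borel_measurable borel"
proof (rule borel_measurable_mono, rule monoI)
  interpret mu: finite_measure mu by (rule finite_measure_mu)
  show "mass {..x} \<le> mass {..y}" if "x \<le> y" for x y :: real
    using that by (simp add: mass_eq mu.finite_measure_mono)
qed

text \<open>For \<open>n\<close> earlier events at times \<open>b j\<close>, the intensity is the
  density of a finite atomless measure whose distribution function is the compensator. Its total
  mass \<open>real n * rho\<close> is the origin of the constraints
  \<open>x i < real i * \<rho>\<close>.\<close>

lemma nn_integral_intensity:
  fixes b :: "nat \<Rightarrow> real"
  assumes h: "h \<in> borel_measurable borel"
  shows "(\<integral>\<^sup>+s. ennreal (\<Sum>j<n. f (s - b j)) * (indicator {a<..} s * h (\<Sum>j<n. mass {..s - b j})) \<partial>lborel) =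
    (\<integral>\<^sup>+y. indicator {(\<Sum>j<n. mass {..a - b j})<..<real n * rho} y * h y \<partial>lborel)"
proof -
  define m where "m = density lborel (\<lambda>s. ennreal (\<Sum>j<n. f (s - b j)))"
  have sets_m [measurable_cong]: "sets m = sets borel" by (simp add: m_def)
  have em: "emeasure m B = ennreal (\<Sum>j<n. mass ((\<lambda>u. b j + u) -` B))" if [measurable]: "B \<in> sets borel" for B
  proof -
    have v: "(\<lambda>u. b j + u) -` B \<in> sets borel" for j
      using measurable_sets[of "\<lambda>u. b j + u" borel borel B] by simp
    have "emeasure m B = (\<integral>\<^sup>+s. (\<Sum>j<n. ennreal (f (s - b j)) * indicator B s) \<partial>lborel)"
      unfolding m_def using f_nonneg
      by (subst emeasure_density) (auto intro!: nn_integral_cong simp: sum_ennreal sum_distrib_right[symmetric])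
    also have "\<dots> = (\<Sum>j<n. \<integral>\<^sup>+s. ennreal (f (s - b j)) * indicator B s \<partial>lborel)"
      by (rule nn_integral_sum) measurable
    also have "\<dots> = (\<Sum>j<n. ennreal (mass ((\<lambda>u. b j + u) -` B)))"
    proof (rule sum.cong[OF refl])
      fix j
      have "(\<integral>\<^sup>+s. ennreal (f (s - b j)) * indicator B s \<partial>lborel) =
          (\<integral>\<^sup>+u. ennreal (f u) * indicator ((\<lambda>u. b j + u) -` B) u \<partial>lborel)"
        by (subst nn_integral_real_affine[of _ 1 "b j"]) (auto simp: indicator_def)
      also have "\<dots> = ennreal (mass ((\<lambda>u. b j + u) -` B))" by (rule nn_integral_f[OF v])
      finally show "(\<integral>\<^sup>+s. ennreal (f (s - b j)) * indicator B s \<partial>lborel) = ennreal (mass ((\<lambda>u. b j + u) -` B))" .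
    qed
    finally show ?thesis using mass_nonneg by (simp add: sum_ennreal)
  qed
  have meas: "measure m B = (\<Sum>j<n. mass ((\<lambda>u. b j + u) -` B))" if "B \<in> sets borel" for B
    unfolding measure_def em[OF that] using mass_nonneg by (simp add: sum_nonneg)
  interpret m: finite_borel_measure m
  proof (intro finite_borel_measure.intro finite_measureI finite_borel_measure_axioms.intro)
    show "emeasure m (space m) \<noteq> \<infinity>" by (simp add: em sets_eq_imp_space_eq[OF sets_m])
  qed (simp add: sets_m)
  have "(\<lambda>u. c + u) -` {x} = {x - c}" "(\<lambda>u. c + u) -` {..x} = {..x - c}" for c x :: real by auto
  then have atomless: "measure m {x} = 0" and cdf: "cdf m x = (\<Sum>j<n. mass {..x - b j})"
    and total: "measure m UNIV = real n * rho" for x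
    by (simp_all add: meas mass_singleton cdf_def2 mass_UNIV)
  note [measurable] = h
  have "(\<integral>\<^sup>+s. indicator {a<..} s * h (cdf m s) \<partial>m) =
    (\<integral>\<^sup>+s. ennreal (\<Sum>j<n. f (s - b j)) * (indicator {a<..} s * h (\<Sum>j<n. mass {..s - b j})) \<partial>lborel)"
    unfolding cdf unfolding m_def by (rule nn_integral_density) measurable
  then show ?thesis using m.nn_integral_cdf_atomless[OF atomless h, of a] by (simp add: cdf total)
qed

lemma measurable_intensity: "i \<le> k \<Longrightarrow> intensity i \<in> borel_measurable (lebesgue_prod k)"
  unfolding intensity_def[abs_def]
  by (intro borel_measurable_sum measurable_compose[OF _ f_measurable] borel_measurable_diff measurable_rooted) auto

lemma measurable_compensator: "i \<le> k \<Longrightarrow> compensator i \<in> borel_measurable (lebesgue_prod k)"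
  unfolding compensator_def[abs_def]
  by (intro borel_measurable_sum measurable_compose[OF _ measurable_mass_atMost] borel_measurable_diff measurable_rooted) auto

lemma measurable_compensators:
  "(\<lambda>t. \<lambda>i\<in>{1..k}. compensator i t) \<in> lebesgue_prod k \<rightarrow>\<^sub>M lebesgue_prod k"
  using measurable_compensator by (intro measurable_restrict) simp

lemma in_polytope_upd:
  "in_polytope (Suc k) (y(Suc k := s)) \<longleftrightarrow> in_polytope k y \<and> rooted y k < s \<and> s < real (Suc k) * rho"
  unfolding in_polytope_def increasing_upd atLeastAtMost_1_Suc by auto

lemma in_polytope_sets: "{y \<in> space (lebesgue_prod k). in_polytope k y} \<in> sets (lebesgue_prod k)"
proof -
  have "{y \<in> space (lebesgue_prod k). y i < real i * rho} \<in> sets (lebesgue_prod k)" if "i \<in> {1..k}" for i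
    using measurable_component_singleton[OF that, of "\<lambda>_. lborel :: real measure"]
    by (intro borel_measurable_less) simp_all
  then have "{y \<in> space (lebesgue_prod k). increasing_epochs k y} \<inter> {y \<in> space (lebesgue_prod k). \<forall>i\<in>{1..k}. y i < real i * rho}
      \<in> sets (lebesgue_prod k)"
    by (intro sets.Int increasing_sets sets.sets_Collect_finite_All) auto
  also have "{y \<in> space (lebesgue_prod k). increasing_epochs k y} \<inter> {y \<in> space (lebesgue_prod k). \<forall>i\<in>{1..k}. y i < real i * rho} =
      {y \<in> space (lebesgue_prod k). in_polytope k y}" by (auto simp: in_polytope_def)
  finally show ?thesis .
qed

lemma measurable_in_polytope:
  "(\<lambda>y. indicator {y. in_polytope k y} y :: ennreal) \<in> borel_measurable (lebesgue_prod k)"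
  using borel_measurable_indicator[OF in_polytope_sets]
  by (rule measurable_cong[THEN iffD1, rotated]) (auto simp: indicator_def)

text \<open>Given the earlier epochs, the compensator maps the next epoch, with density the intensity,
  to Lebesgue measure on the interval from its current value to the total mass.\<close>

lemma nn_integral_compensators:
  assumes "h \<in> borel_measurable (lebesgue_prod k)"
  shows "(\<integral>\<^sup>+t. (\<Prod>i\<in>{1..k}. ennreal (intensity i t)) * indicator {t. increasing_epochs k t} t *
          h (\<lambda>i\<in>{1..k}. compensator i t) \<partial>lebesgue_prod k) =
    (\<integral>\<^sup>+y. indicator {y. in_polytope k y} y * h y \<partial>lebesgue_prod k)"
  using assms
proof (induction k arbitrary: h)
  case 0
  show ?case
    unfolding nn_integral_lebesgue_prod_0 by (simp add: increasing_epochs_def in_polytope_def restrict_def)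
next
  case (Suc k)
  note h = Suc.prems
  let ?C = "\<lambda>k t. \<lambda>i\<in>{1..k}. compensator i t"
  let ?W = "\<lambda>k t. (\<Prod>i\<in>{1..k}. ennreal (intensity i t)) * indicator {t. increasing_epochs k t} t"
  \<comment> \<open>\<open>F\<close> restricts \<open>h\<close> to the fibre of the polytope over
    the first \<open>k\<close> coordinates; integrating out the last coordinate gives
    \<open>h'\<close>, to which the induction hypothesis is applied.\<close>
  define F where "F x = indicator {y. rooted x k < y \<and> y < real (Suc k) * rho} (x (Suc k)) * h x" for x
  define h' where "h' c = (\<integral>\<^sup>+y. F (c(Suc k := y)) \<partial>lborel)" for c
  have F: "F \<in> borel_measurable (lebesgue_prod (Suc k))"
  proof -
    have [measurable]: "(\<lambda>x. rooted x k) \<in> borel_measurable (lebesgue_prod (Suc k))"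
      "(\<lambda>x. x (Suc k)) \<in> borel_measurable (lebesgue_prod (Suc k))"
      using measurable_rooted[of k "Suc k"] measurable_rooted[of "Suc k" "Suc k"] by simp_all
    have "{x \<in> space (lebesgue_prod (Suc k)). rooted x k < x (Suc k) \<and> x (Suc k) < real (Suc k) * rho} \<in> sets (lebesgue_prod (Suc k))"
      by measurable
    from borel_measurable_times_ennreal[OF borel_measurable_indicator[OF this] h]
    show ?thesis
      by (rule measurable_cong[THEN iffD1, rotated]) (auto simp: F_def indicator_def)
  qed
  have h': "h' \<in> borel_measurable (lebesgue_prod k)"
    unfolding h'_def by (rule measurable_nn_integral_upd[OF F])
  have upd_low: "intensity i (t(Suc k := s)) = intensity i t" "compensator i (t(Suc k := s)) = compensator i t"
    if "i \<le> k" for i t s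
    using that by (simp_all add: intensity_def compensator_def)
  have upd_top: "intensity (Suc k) (t(Suc k := s)) = (\<Sum>j<Suc k. f (s - rooted t j))"
    "compensator (Suc k) (t(Suc k := s)) = (\<Sum>j<Suc k. mass {..s - rooted t j})" for t s
    by (simp_all add: intensity_def compensator_def less_Suc_eq_le del: sum.lessThan_Suc cong: sum.cong_simp)
  have upd_C: "?C (Suc k) (t(Suc k := s)) = (?C k t)(Suc k := (\<Sum>j<Suc k. mass {..s - rooted t j}))" for t s
    by (auto simp: fun_eq_iff upd_low upd_top[unfolded One_nat_def] le_Suc_eq simp del: sum.lessThan_Suc)
  have upd_W: "?W (Suc k) (t(Suc k := s)) =
      ?W k t * (ennreal (\<Sum>j<Suc k. f (s - rooted t j)) * indicator {rooted t k<..} s)" for t s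
  proof -
    have "(\<Prod>i\<in>{1..Suc k}. ennreal (intensity i (t(Suc k := s)))) =
        ennreal (\<Sum>j<Suc k. f (s - rooted t j)) * (\<Prod>i\<in>{1..k}. ennreal (intensity i t))"
      unfolding atLeastAtMost_1_Suc by (simp add: upd_low upd_top del: sum.lessThan_Suc)
    moreover have "indicator {t. increasing_epochs (Suc k) t} (t(Suc k := s)) =
        (indicator {t. increasing_epochs k t} t * indicator {rooted t k<..} s :: ennreal)"
      by (simp add: indicator_def increasing_upd)
    ultimately show ?thesis by (simp add: mult_ac del: sum.lessThan_Suc)
  qed
  have Wm: "(\<lambda>t. ?W k t) \<in> borel_measurable (lebesgue_prod k)" for k
    by (intro borel_measurable_times_ennreal borel_measurable_prod_ennreal measurable_compose[OF _ measurable_ennreal]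
         measurable_intensity measurable_increasing) auto
  have "(\<integral>\<^sup>+t. ?W (Suc k) t * h (?C (Suc k) t) \<partial>lebesgue_prod (Suc k)) =
      (\<integral>\<^sup>+t. \<integral>\<^sup>+s. ?W (Suc k) (t(Suc k := s)) * h (?C (Suc k) (t(Suc k := s))) \<partial>lborel \<partial>lebesgue_prod k)"
    by (intro nn_integral_lebesgue_prod_Suc borel_measurable_times_ennreal Wm measurable_compose[OF measurable_compensators h])
  also have "\<dots> = (\<integral>\<^sup>+t. ?W k t * h' (?C k t) \<partial>lebesgue_prod k)"
  proof (rule nn_integral_cong)
    fix t assume t: "t \<in> space (lebesgue_prod k)"
    define c where "c = ?C k t"
    have c: "c \<in> space (lebesgue_prod k)" by (simp add: c_def space_PiM)
    have hc [measurable]: "(\<lambda>y. h (c(Suc k := y))) \<in> borel_measurable borel"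
      using measurable_compose[OF measurable_lebesgue_prod_upd1[OF c] h] .
    \<comment> \<open>At \<open>s = rooted t k\<close> the newest event, \<open>j = k\<close>, adds
      \<open>mass {..0} = 0\<close>, so the compensator starts from its previous value.\<close>
    have "(\<Sum>j<Suc k. mass {..rooted t k - rooted t j}) = compensator k t"
      by (simp add: compensator_def mass_atMost_0)
    also have "\<dots> = rooted c k"
      by (cases k) (simp_all add: c_def compensator_def)
    finally have start: "(\<Sum>j<Suc k. mass {..rooted t k - rooted t j}) = rooted c k" .
    have "(\<integral>\<^sup>+s. ?W (Suc k) (t(Suc k := s)) * h (?C (Suc k) (t(Suc k := s))) \<partial>lborel) =
      (\<integral>\<^sup>+s. ?W k t * (ennreal (\<Sum>j<Suc k. f (s - rooted t j)) * (indicator {rooted t k<..} s *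
         h (c(Suc k := (\<Sum>j<Suc k. mass {..s - rooted t j}))))) \<partial>lborel)"
      unfolding upd_W upd_C c_def by (simp add: mult_ac del: sum.lessThan_Suc)
    also have "\<dots> = ?W k t * (\<integral>\<^sup>+s. ennreal (\<Sum>j<Suc k. f (s - rooted t j)) * (indicator {rooted t k<..} s *
         h (c(Suc k := (\<Sum>j<Suc k. mass {..s - rooted t j})))) \<partial>lborel)"
      by (rule nn_integral_cmult) measurable
    also have "(\<integral>\<^sup>+s. ennreal (\<Sum>j<Suc k. f (s - rooted t j)) * (indicator {rooted t k<..} s *
         h (c(Suc k := (\<Sum>j<Suc k. mass {..s - rooted t j})))) \<partial>lborel) =
      (\<integral>\<^sup>+y. indicator {rooted c k<..<real (Suc k) * rho} y * h (c(Suc k := y)) \<partial>lborel)"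
      unfolding start[symmetric] by (rule nn_integral_intensity[OF hc])
    also have "\<dots> = h' c"
      unfolding h'_def F_def by (intro nn_integral_cong) (simp add: indicator_def)
    finally show "(\<integral>\<^sup>+s. ?W (Suc k) (t(Suc k := s)) * h (?C (Suc k) (t(Suc k := s))) \<partial>lborel) = ?W k t * h' (?C k t)"
      by (simp only: c_def)
  qed
  also have "\<dots> = (\<integral>\<^sup>+y. indicator {y. in_polytope k y} y * h' y \<partial>lebesgue_prod k)"
    by (rule Suc.IH[OF h'])
  also have "\<dots> = (\<integral>\<^sup>+y. \<integral>\<^sup>+s. indicator {y. in_polytope (Suc k) y} (y(Suc k := s)) * h (y(Suc k := s)) \<partial>lborel \<partial>lebesgue_prod k)"
  proof (rule nn_integral_cong)
    fix y assume y: "y \<in> space (lebesgue_prod k)"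
    have "(\<lambda>s. F (y(Suc k := s))) \<in> borel_measurable lborel"
      using measurable_compose[OF measurable_lebesgue_prod_upd1[OF y] F] by simp
    then show "indicator {y. in_polytope k y} y * h' y =
        (\<integral>\<^sup>+s. indicator {y. in_polytope (Suc k) y} (y(Suc k := s)) * h (y(Suc k := s)) \<partial>lborel)"
      unfolding h'_def by (subst nn_integral_cmult[symmetric])
        (auto intro!: nn_integral_cong simp: F_def in_polytope_upd indicator_def simp del: of_nat_Suc)
  qed
  also have "\<dots> = (\<integral>\<^sup>+y. indicator {y. in_polytope (Suc k) y} y * h y \<partial>lebesgue_prod (Suc k))"
    by (intro nn_integral_lebesgue_prod_Suc[symmetric] borel_measurable_times_ennreal measurable_in_polytope h)
  finally show ?case .
qed

end

section \<open>Volume of the polytope and law of the compensator points\<close>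

text \<open>The volume is integrated from the last coordinate downwards; the inner integrals are the
  Goncarov polynomials for the equidistant nodes \<open>a * r\<close>.\<close>

definition goncarov :: "real \<Rightarrow> nat \<Rightarrow> real \<Rightarrow> real" where
  "goncarov r a u = (if a = 0 then 1 else (u - real a * r) * u ^ (a - 1) / fact a)"

text \<open>Together with the zero of \<open>goncarov r (Suc a)\<close> at
  \<open>real (Suc a) * r\<close>, this is the recursion produced by iterated integration.\<close>

lemma goncarov_deriv: "(goncarov r (Suc a) has_real_derivative goncarov r a u) (at u)"
proof (cases a)
  case 0
  then have "goncarov r (Suc a) = (\<lambda>u. u - r)" "goncarov r a u = 1"
    by (auto simp: goncarov_def)
  then show ?thesis by (auto intro!: derivative_eq_intros)
next
  case (Suc b)
  have "goncarov r (Suc a) = (\<lambda>u. (u - real (Suc a) * r) * u ^ Suc b / fact (Suc a))"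
    using Suc by (auto simp: goncarov_def fun_eq_iff)
  moreover have "((\<lambda>u. (u - real (Suc a) * r) * u ^ Suc b / fact (Suc a)) has_real_derivative
      ((u - real (Suc a) * r) * (real (Suc b) * u ^ b) + u ^ Suc b) / fact (Suc a)) (at u)"
  proof (rule DERIV_cdivide[OF DERIV_mult[THEN DERIV_cong]])
    show "((\<lambda>u. u - real (Suc a) * r) has_real_derivative 1) (at u)"
      by (auto intro!: derivative_eq_intros)
    show "((\<lambda>u. u ^ Suc b) has_real_derivative real (Suc b) * u ^ b) (at u)"
      using DERIV_pow[of "Suc b" u] by simp
  qed simp
  moreover have "((u - real (Suc a) * r) * (real (Suc b) * u ^ b) + u ^ Suc b) / fact (Suc a) = goncarov r a u"
  proof -
    have "((u - real (Suc a) * r) * (real (Suc b) * u ^ b) + u ^ Suc b) = real (Suc a) * ((u - real a * r) * u ^ b)"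
      unfolding Suc by (simp add: algebra_simps)
    then show ?thesis unfolding Suc by (simp add: goncarov_def field_simps del: of_nat_Suc)
  qed
  ultimately show ?thesis by simp
qed

lemma goncarov_continuous: "continuous_on UNIV (goncarov r a)"
  unfolding goncarov_def[abs_def] by (cases "a = 0") (auto intro!: continuous_intros)

text \<open>\<open>U\<close> is chosen so that the upper limit \<open>b\<close> falls on the zero of
  the antiderivative; only the lower limit contributes.\<close>

lemma nn_integral_goncarov:
  assumes r: "0 \<le> r" and z: "z \<le> b" and U: "U = b + real (Suc a) * r" and "0 \<le> b"
  shows "(\<integral>\<^sup>+s. indicator {z<..<b} s * ennreal (goncarov r a (U - s)) \<partial>lborel) = ennreal (goncarov r (Suc a) (U - z))"
proof -
  note cont = goncarov_continuous[of r a]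
  have [measurable]: "(\<lambda>s. goncarov r a (U - s)) \<in> borel_measurable borel"
    by (intro borel_measurable_continuous_onI continuous_on_compose2[OF cont] continuous_intros) auto
  \<comment> \<open>For \<open>s \<le> b\<close> the argument \<open>U - s\<close> is at least
    \<open>(a + 1) * r\<close>, to the right of the zero \<open>a * r\<close>, so
    \<open>ennreal\<close> truncates nothing.\<close>
  have nonneg: "0 \<le> goncarov r a (U - s)" if "s \<le> b" for s
  proof -
    have "0 \<le> U - s - real a * r" using that r U by (simp add: algebra_simps)
    moreover from this have "0 \<le> U - s" using r by (smt (verit) mult_nonneg_nonneg of_nat_0_le_iff)
    ultimately show ?thesis by (simp add: goncarov_def)
  qed
  have "(\<integral>\<^sup>+s. indicator {z<..<b} s * ennreal (goncarov r a (U - s)) \<partial>lborel) =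
      (\<integral>\<^sup>+s. ennreal (goncarov r a (U - s)) * indicator {z..b} s \<partial>lborel)"
    using AE_lborel_singleton[of z] AE_lborel_singleton[of b]
    by (intro nn_integral_cong_AE) (auto elim!: eventually_elim2 simp: indicator_def)
  also have "\<dots> = ennreal (- goncarov r (Suc a) (U - b) - - goncarov r (Suc a) (U - z))"
  proof (rule nn_integral_FTC_Icc)
    show "((\<lambda>s. - goncarov r (Suc a) (U - s)) has_real_derivative goncarov r a (U - s)) (at s)" for s
      by (rule DERIV_chain2[OF goncarov_deriv, THEN DERIV_minus, THEN DERIV_cong])
        (auto intro!: derivative_eq_intros)
  qed (use nonneg z in auto)
  also have "goncarov r (Suc a) (U - b) = 0" by (simp add: goncarov_def U)
  finally show ?thesis by simp
qed

context hawkes_cluster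
begin

text \<open>\<open>a\<close> counts the coordinates above \<open>j\<close> that are already
  integrated out. Trading one coordinate for one unit of \<open>a\<close> leaves
  \<open>j + a + 1\<close> unchanged, so the integrand keeps its form; \<open>a = 0\<close> gives
  the volume.\<close>

lemma nn_integral_in_polytope_goncarov:
  "(\<integral>\<^sup>+y. indicator {y. in_polytope j y} y * ennreal (goncarov rho a (real (j + a + 1) * rho - rooted y j)) \<partial>lebesgue_prod j) =
    ennreal (goncarov rho (a + j) (real (j + a + 1) * rho))"
proof (induction j arbitrary: a)
  case 0
  show ?case
    unfolding nn_integral_lebesgue_prod_0 by (simp add: in_polytope_def increasing_epochs_def)
next
  case (Suc j)
  let ?U = "real (Suc j + a + 1) * rho"
  note cont = goncarov_continuous[of rho a]
  have g: "(\<lambda>y. goncarov rho a (?U - rooted y (Suc j))) \<in> borel_measurable (lebesgue_prod (Suc j))"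
    by (rule measurable_compose[OF borel_measurable_diff[OF borel_measurable_const measurable_rooted[OF order_refl]]
          borel_measurable_continuous_onI[OF cont]])
  have g': "(\<lambda>s. goncarov rho a (?U - s)) \<in> borel_measurable borel"
    by (intro borel_measurable_continuous_onI continuous_on_compose2[OF cont] continuous_intros) auto
  have "(\<integral>\<^sup>+y. indicator {y. in_polytope (Suc j) y} y * ennreal (goncarov rho a (?U - rooted y (Suc j))) \<partial>lebesgue_prod (Suc j)) =
    (\<integral>\<^sup>+y. \<integral>\<^sup>+s. indicator {y. in_polytope (Suc j) y} (y(Suc j := s)) *
       ennreal (goncarov rho a (?U - rooted (y(Suc j := s)) (Suc j))) \<partial>lborel \<partial>lebesgue_prod j)"
    by (intro nn_integral_lebesgue_prod_Suc borel_measurable_times_ennreal measurable_in_polytope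
          measurable_compose[OF g measurable_ennreal])
  also have "\<dots> = (\<integral>\<^sup>+y. indicator {y. in_polytope j y} y * ennreal (goncarov rho (Suc a) (?U - rooted y j)) \<partial>lebesgue_prod j)"
  proof (rule nn_integral_cong)
    fix y
    have "(\<integral>\<^sup>+s. indicator {y. in_polytope (Suc j) y} (y(Suc j := s)) *
        ennreal (goncarov rho a (?U - rooted (y(Suc j := s)) (Suc j))) \<partial>lborel) =
      (\<integral>\<^sup>+s. indicator {y. in_polytope j y} y * (indicator {rooted y j<..<real (Suc j) * rho} s * ennreal (goncarov rho a (?U - s))) \<partial>lborel)"
      by (intro nn_integral_cong) (auto simp: in_polytope_upd indicator_def simp del: of_nat_Suc)
    also have "\<dots> = indicator {y. in_polytope j y} y * (\<integral>\<^sup>+s. indicator {rooted y j<..<real (Suc j) * rho} s * ennreal (goncarov rho a (?U - s)) \<partial>lborel)"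
      using g' by (intro nn_integral_cmult) auto
    also have "\<dots> = indicator {y. in_polytope j y} y * ennreal (goncarov rho (Suc a) (?U - rooted y j))"
    proof (cases "in_polytope j y")
      case True
      have "rooted y j \<le> real (Suc j) * rho"
      proof (cases "j = 0")
        case False
        then have "rooted y j < real j * rho" using True by (auto simp: in_polytope_def rooted_def)
        also have "\<dots> \<le> real (Suc j) * rho" using rho_nonneg by (intro mult_right_mono) auto
        finally show ?thesis by simp
      qed (use rho_nonneg in simp)
      then have "(\<integral>\<^sup>+s. indicator {rooted y j<..<real (Suc j) * rho} s * ennreal (goncarov rho a (?U - s)) \<partial>lborel) =
          ennreal (goncarov rho (Suc a) (?U - rooted y j))"
        using rho_nonneg by (intro nn_integral_goncarov) (auto simp: algebra_simps)
      then show ?thesis by simp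
    qed simp
    finally show "(\<integral>\<^sup>+s. indicator {y. in_polytope (Suc j) y} (y(Suc j := s)) *
        ennreal (goncarov rho a (?U - rooted (y(Suc j := s)) (Suc j))) \<partial>lborel) =
      indicator {y. in_polytope j y} y * ennreal (goncarov rho (Suc a) (?U - rooted y j))" .
  qed
  also have "\<dots> = ennreal (goncarov rho (a + Suc j) ?U)"
    using Suc.IH[of "Suc a"] by (simp add: add_ac)
  finally show ?case .
qed

lemma nn_integral_in_polytope:
  "(\<integral>\<^sup>+y. indicator {y. in_polytope k y} y \<partial>lebesgue_prod k) = ennreal (goncarov rho k (real (Suc k) * rho))"
  using nn_integral_in_polytope_goncarov[of k 0] by (simp add: goncarov_def[of rho 0])

section \<open>Law of the epochs and of the compensator points\<close>

text \<open>Adds the order of absolute times to \<open>gap_law\<close> and changes variables. The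
  cone of sibling orders disappears: siblings share the time of their parent, so increasing times
  already order their gaps.\<close>

lemma realises_emeasure:
  assumes p: "p \<in> parent_functions k" and A: "A \<in> sets (lebesgue_prod k)"
  defines "E \<equiv> {\<omega> \<in> space M. realises k p (\<lambda>u. \<Phi> u \<omega>) \<and>
      (\<lambda>i\<in>{1..k}. tree_time p (offspring_gap p (\<lambda>u. \<Phi> u \<omega>)) i) \<in> A}"
  shows "E \<in> events" and "emeasure M E = (\<integral>\<^sup>+t. ennreal (exp (- real (Suc k) * rho)) *
      (\<Prod>i\<in>{1..k}. ennreal (f (rooted t i - rooted t (p i)))) * (indicator {t. increasing_epochs k t} t * indicator A t) \<partial>lebesgue_prod k)"
proof -
  let ?T = "\<lambda>x. \<lambda>i\<in>{1..k}. tree_time p x i"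
  let ?X = "\<lambda>\<omega>. \<lambda>i\<in>{1..k}. offspring_gap p (\<lambda>u. \<Phi> u \<omega>) i"
  define A' where "A' = ?T -` ({t \<in> space (lebesgue_prod k). increasing_epochs k t} \<inter> A) \<inter> space (lebesgue_prod k)"
  have A': "A' \<in> sets (lebesgue_prod k)"
    unfolding A'_def by (intro measurable_sets[OF measurable_tree_times] sets.Int increasing_sets A)
  have rooted_T: "rooted (?T x) i = tree_time p x i" if "i \<le> k" for x i
    using that by (auto simp: rooted_def)
  have T_X: "?T (restrict x {1..k}) = ?T x" for x
    using tree_time_cong[of _ "restrict x {1..k}" x p] by (auto simp: fun_eq_iff)
  have incr: "increasing_epochs k (?T x) \<longleftrightarrow> (\<forall>i<k. tree_time p x i < tree_time p x (Suc i))" for x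
    using rooted_T by (auto simp: increasing_epochs_def simp del: rooted_simps)
  have X_A': "?X \<omega> \<in> A' \<longleftrightarrow> (\<forall>i<k. tree_time p (offspring_gap p (\<lambda>u. \<Phi> u \<omega>)) i < tree_time p (offspring_gap p (\<lambda>u. \<Phi> u \<omega>)) (Suc i)) \<and>
      ?T (offspring_gap p (\<lambda>u. \<Phi> u \<omega>)) \<in> A" for \<omega>
    unfolding A'_def vimage_def Int_iff mem_Collect_eq T_X unfolding incr by (simp add: space_PiM)
  have E: "E = {\<omega> \<in> space M. right_degrees k p (\<lambda>u. \<Phi> u \<omega>) \<and> ?X \<omega> \<in> A'}"
    unfolding E_def X_A' realises_def right_degrees_def by blast
  show "E \<in> events"
  proof -
    have "E = {\<omega> \<in> space M. right_degrees k p (\<lambda>u. \<Phi> u \<omega>)} \<inter> (?X -` A' \<inter> space M)" unfolding E by auto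
    then show ?thesis using right_degrees_event measurable_sets[OF measurable_gaps A'] by simp
  qed
  define H where "H t = ennreal (exp (- real (Suc k) * rho)) *
      (\<Prod>i\<in>{1..k}. ennreal (f (rooted t i - rooted t (p i)))) * (indicator {t. increasing_epochs k t} t * indicator A t)" for t
  have H: "H \<in> borel_measurable (lebesgue_prod k)"
    unfolding H_def using parent_function_less[OF p]
    by (intro borel_measurable_times_ennreal borel_measurable_prod_ennreal measurable_compose[OF _ measurable_ennreal]
        measurable_compose[OF _ f_measurable] borel_measurable_diff measurable_rooted measurable_increasing
        borel_measurable_indicator A borel_measurable_const) (auto intro: less_imp_le less_le_trans)
  have "emeasure M E = (\<integral>\<^sup>+x. ennreal (exp (- real (Suc k) * rho) * (\<Prod>i\<in>{1..k}. f (x i))) *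
        indicator (order_cone {1..k} (siblings k p)) x * indicator A' x \<partial>lebesgue_prod k)"
    unfolding E by (rule gap_law[OF p A'])
  also have "\<dots> = (\<integral>\<^sup>+x. H (?T x) \<partial>lebesgue_prod k)"
  proof (rule nn_integral_cong)
    fix x assume x: "x \<in> space (lebesgue_prod k)"
    have step: "tree_time p x i - tree_time p x (p i) = x i" if "i \<in> {1..k}" for i
      using tree_time_rec[of i p x] parent_function_less[OF p that] that by simp
    have prod: "(\<Prod>i\<in>{1..k}. ennreal (f (rooted (?T x) i - rooted (?T x) (p i)))) = ennreal (\<Prod>i\<in>{1..k}. f (x i))"
    proof -
      have "(\<Prod>i\<in>{1..k}. ennreal (f (rooted (?T x) i - rooted (?T x) (p i)))) = (\<Prod>i\<in>{1..k}. ennreal (f (x i)))"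
      proof (rule prod.cong[OF refl])
        fix i assume i: "i \<in> {1..k}"
        then have "p i \<le> k" using parent_function_less[OF p i] by simp
        then show "ennreal (f (rooted (?T x) i - rooted (?T x) (p i))) = ennreal (f (x i))"
          using i step[OF i] rooted_T[of i] rooted_T[of "p i"] by simp
      qed
      then show ?thesis using f_nonneg by (simp add: prod_ennreal)
    qed
    have T_space: "?T x \<in> space (lebesgue_prod k)" by (simp add: space_PiM)
    have "x \<in> order_cone {1..k} (siblings k p)" if "x \<in> A'"
    proof -
      have less: "tree_time p x i < tree_time p x j" if "i < j" "j \<le> k" for i j
        using that
      proof (induction j)
        case (Suc j)
        have "tree_time p x j < tree_time p x (Suc j)"
          using \<open>x \<in> A'\<close> Suc.prems incr[of x] by (auto simp: A'_def)
        then show ?case using Suc by (cases "i = j") auto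
      qed simp
      have "x i < x j" if "(i, j) \<in> siblings k p" for i j
        using less[of i j] step[of i] step[of j] that by (auto simp: siblings_def)
      then show ?thesis using x by (auto simp: order_cone_def space_PiM)
    qed
    moreover have "x \<in> A' \<longleftrightarrow> increasing_epochs k (?T x) \<and> ?T x \<in> A"
      using x T_space by (auto simp: A'_def)
    ultimately show "ennreal (exp (- real (Suc k) * rho) * (\<Prod>i\<in>{1..k}. f (x i))) *
        indicator (order_cone {1..k} (siblings k p)) x * indicator A' x = H (?T x)"
      unfolding H_def prod using f_nonneg
      by (auto simp: indicator_def ennreal_mult' prod_nonneg simp del: One_nat_def)
  qed
  also have "\<dots> = (\<integral>\<^sup>+t. H t \<partial>lebesgue_prod k)"
    by (rule nn_integral_tree_times[OF parent_function_less[OF p] H])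
  finally show "emeasure M E = (\<integral>\<^sup>+t. ennreal (exp (- real (Suc k) * rho)) *
      (\<Prod>i\<in>{1..k}. ennreal (f (rooted t i - rooted t (p i)))) * (indicator {t. increasing_epochs k t} t * indicator A t) \<partial>lebesgue_prod k)"
    unfolding H_def .
qed

definition epochs :: "nat \<Rightarrow> 'a \<Rightarrow> nat \<Rightarrow> real" where
  "epochs k \<omega> = (\<lambda>i\<in>{1..k}. epoch (\<lambda>u. \<Phi> u \<omega>) i)"

lemma measurable_epochs: "epochs k \<in> M \<rightarrow>\<^sub>M lebesgue_prod k"
  unfolding epochs_def[abs_def] using measurable_epoch[OF measurable_\<Phi>] by (intro measurable_restrict) simp

lemma size_event: "{\<omega> \<in> space M. cluster_size (\<lambda>u. \<Phi> u \<omega>) = n} \<in> events"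
  using measurable_sets[OF measurable_cluster_size[OF measurable_\<Phi>], of "{n}"]
  by (simp add: vimage_def Int_def conj_commute)

text \<open>On a regular realisation with \<open>Suc k\<close> events exactly one parent function is
  realised, so up to a null set the event is a finite disjoint union. Choosing a parent for every
  event is the expansion of a product of sums, \<open>prod_sum_PiE\<close>.\<close>

lemma epoch_law:
  assumes A: "A \<in> sets (lebesgue_prod k)"
  shows "emeasure M {\<omega> \<in> space M. cluster_size (\<lambda>u. \<Phi> u \<omega>) = Suc k \<and> epochs k \<omega> \<in> A} =
    ennreal (exp (- real (Suc k) * rho)) * (\<integral>\<^sup>+t. (\<Prod>i\<in>{1..k}. ennreal (intensity i t)) *
       indicator {t. increasing_epochs k t} t * indicator A t \<partial>lebesgue_prod k)"
proof -
  define E where "E p = {\<omega> \<in> space M. realises k p (\<lambda>u. \<Phi> u \<omega>) \<and>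
      (\<lambda>i\<in>{1..k}. tree_time p (offspring_gap p (\<lambda>u. \<Phi> u \<omega>)) i) \<in> A}" for p
  let ?P = "parent_functions k" and ?c = "ennreal (exp (- real (Suc k) * rho))"
  let ?V = "{\<omega> \<in> space M. cluster_size (\<lambda>u. \<Phi> u \<omega>) = Suc k \<and> epochs k \<omega> \<in> A}"
  have fin: "finite ?P" by (intro finite_PiE) auto
  note E = realises_emeasure[OF _ A, folded E_def]
  have epochs_eq: "epochs k \<omega> = (\<lambda>i\<in>{1..k}. tree_time p (offspring_gap p (\<lambda>u. \<Phi> u \<omega>)) i)"
    if "p \<in> ?P" "realises k p (\<lambda>u. \<Phi> u \<omega>)" for p \<omega>
    using epochs_realises(2)[OF that] by (auto simp: epochs_def fun_eq_iff)
  have "AE \<omega> in M. (\<omega> \<in> ?V) = (\<omega> \<in> (\<Union>p\<in>?P. E p))"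
  proof (rule AE_mp[OF AE_regular], intro AE_I2 impI)
    fix \<omega> assume \<omega>: "\<omega> \<in> space M" "regular (\<lambda>u. \<Phi> u \<omega>)"
    show "(\<omega> \<in> ?V) = (\<omega> \<in> (\<Union>p\<in>?P. E p))"
    proof
      assume V: "\<omega> \<in> ?V"
      then obtain p where "p \<in> ?P" "realises k p (\<lambda>u. \<Phi> u \<omega>)" using ex_realises[OF \<omega>(2)] by auto
      then show "\<omega> \<in> (\<Union>p\<in>?P. E p)" using V epochs_eq by (auto simp: E_def)
    next
      assume "\<omega> \<in> (\<Union>p\<in>?P. E p)"
      then obtain p where "p \<in> ?P" "\<omega> \<in> E p" by blast
      then show "\<omega> \<in> ?V" using epochs_eq[of p \<omega>] epochs_realises(1)[of p k] by (auto simp: E_def)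
    qed
  qed
  moreover have "?V \<in> events"
  proof -
    have "?V = {\<omega> \<in> space M. cluster_size (\<lambda>u. \<Phi> u \<omega>) = Suc k} \<inter> (epochs k -` A \<inter> space M)" by auto
    then show ?thesis using size_event measurable_sets[OF measurable_epochs A] by simp
  qed
  moreover have "(\<Union>p\<in>?P. E p) \<in> events" using E(1) fin by (intro sets.finite_UN) auto
  ultimately have "emeasure M ?V = emeasure M (\<Union>p\<in>?P. E p)" by (intro emeasure_eq_AE)
  also have "\<dots> = (\<Sum>p\<in>?P. emeasure M (E p))"
    using E(1) fin realises_unique by (intro sum_emeasure[symmetric]) (auto simp: disjoint_family_on_def E_def)
  also have "\<dots> = (\<Sum>p\<in>?P. \<integral>\<^sup>+t. ?c * (\<Prod>i\<in>{1..k}. ennreal (f (rooted t i - rooted t (p i)))) *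
      (indicator {t. increasing_epochs k t} t * indicator A t) \<partial>lebesgue_prod k)"
    by (rule sum.cong[OF refl]) (rule E(2))
  also have "\<dots> = (\<integral>\<^sup>+t. (\<Sum>p\<in>?P. ?c * (\<Prod>i\<in>{1..k}. ennreal (f (rooted t i - rooted t (p i)))) *
      (indicator {t. increasing_epochs k t} t * indicator A t)) \<partial>lebesgue_prod k)"
  proof (rule nn_integral_sum[symmetric])
    fix p assume p: "p \<in> ?P"
    show "(\<lambda>t. ?c * (\<Prod>i\<in>{1..k}. ennreal (f (rooted t i - rooted t (p i)))) *
      (indicator {t. increasing_epochs k t} t * indicator A t)) \<in> borel_measurable (lebesgue_prod k)"
      using parent_function_less[OF p]
      by (intro borel_measurable_times_ennreal borel_measurable_prod_ennreal measurable_compose[OF _ measurable_ennreal]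
        measurable_compose[OF _ f_measurable] borel_measurable_diff measurable_rooted measurable_increasing
        borel_measurable_indicator A borel_measurable_const) (auto intro: less_imp_le less_le_trans)
  qed
  also have "\<dots> = (\<integral>\<^sup>+t. ?c * ((\<Prod>i\<in>{1..k}. ennreal (intensity i t)) * indicator {t. increasing_epochs k t} t * indicator A t) \<partial>lebesgue_prod k)"
  proof (rule nn_integral_cong)
    fix t
    have "(\<Prod>i\<in>{1..k}. ennreal (intensity i t)) = (\<Prod>i\<in>{1..k}. \<Sum>j\<in>{..<i}. ennreal (f (rooted t i - rooted t j)))"
      using f_nonneg by (simp add: intensity_def sum_ennreal)
    also have "\<dots> = (\<Sum>p\<in>?P. \<Prod>i\<in>{1..k}. ennreal (f (rooted t i - rooted t (p i))))"
      by (rule prod_sum_PiE) auto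
    finally show "(\<Sum>p\<in>?P. ?c * (\<Prod>i\<in>{1..k}. ennreal (f (rooted t i - rooted t (p i)))) *
        (indicator {t. increasing_epochs k t} t * indicator A t)) =
      ?c * ((\<Prod>i\<in>{1..k}. ennreal (intensity i t)) * indicator {t. increasing_epochs k t} t * indicator A t)"
      by (simp only: sum_distrib_left[symmetric] sum_distrib_right[symmetric] mult.assoc)
  qed
  also have "\<dots> = ?c * (\<integral>\<^sup>+t. (\<Prod>i\<in>{1..k}. ennreal (intensity i t)) *
       indicator {t. increasing_epochs k t} t * indicator A t \<partial>lebesgue_prod k)"
    by (intro nn_integral_cmult borel_measurable_times_ennreal borel_measurable_prod_ennreal
        measurable_compose[OF _ measurable_ennreal] measurable_intensity measurable_increasing
        borel_measurable_indicator A) auto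
  finally show ?thesis .
qed

lemma compensator_law:
  assumes B: "B \<in> sets (lebesgue_prod k)"
  shows "emeasure M {\<omega> \<in> space M. cluster_size (\<lambda>u. \<Phi> u \<omega>) = Suc k \<and> (\<lambda>i\<in>{1..k}. compensator i (epochs k \<omega>)) \<in> B} =
    ennreal (exp (- real (Suc k) * rho)) * (\<integral>\<^sup>+y. indicator {y. in_polytope k y} y * indicator B y \<partial>lebesgue_prod k)"
proof -
  let ?C = "\<lambda>t. \<lambda>i\<in>{1..k}. compensator i t"
  have A: "?C -` B \<inter> space (lebesgue_prod k) \<in> sets (lebesgue_prod k)"
    by (rule measurable_sets[OF measurable_compensators B])
  have e: "{\<omega> \<in> space M. cluster_size (\<lambda>u. \<Phi> u \<omega>) = Suc k \<and> ?C (epochs k \<omega>) \<in> B} =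
      {\<omega> \<in> space M. cluster_size (\<lambda>u. \<Phi> u \<omega>) = Suc k \<and> epochs k \<omega> \<in> ?C -` B \<inter> space (lebesgue_prod k)}"
    by (auto simp: epochs_def space_PiM)
  have "emeasure M {\<omega> \<in> space M. cluster_size (\<lambda>u. \<Phi> u \<omega>) = Suc k \<and> ?C (epochs k \<omega>) \<in> B} =
      ennreal (exp (- real (Suc k) * rho)) * (\<integral>\<^sup>+t. (\<Prod>i\<in>{1..k}. ennreal (intensity i t)) *
       indicator {t. increasing_epochs k t} t * indicator (?C -` B \<inter> space (lebesgue_prod k)) t \<partial>lebesgue_prod k)"
    unfolding e by (rule epoch_law[OF A])
  also have "(\<integral>\<^sup>+t. (\<Prod>i\<in>{1..k}. ennreal (intensity i t)) *
       indicator {t. increasing_epochs k t} t * indicator (?C -` B \<inter> space (lebesgue_prod k)) t \<partial>lebesgue_prod k) =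
      (\<integral>\<^sup>+t. (\<Prod>i\<in>{1..k}. ennreal (intensity i t)) * indicator {t. increasing_epochs k t} t * indicator B (?C t) \<partial>lebesgue_prod k)"
    by (intro nn_integral_cong) (simp add: indicator_def)
  also have "\<dots> = (\<integral>\<^sup>+y. indicator {y. in_polytope k y} y * indicator B y \<partial>lebesgue_prod k)"
    by (rule nn_integral_compensators) (use B in simp)
  finally show ?thesis .
qed

text \<open>\<open>compensator_point\<close> reads the 0-th epoch off the event times, whereas
  \<open>rooted\<close> inserts 0; this reconciles the two.\<close>

lemma AE_epoch_0: "AE \<omega> in M. cluster_size (\<lambda>u. \<Phi> u \<omega>) = Suc k \<longrightarrow> epoch (\<lambda>u. \<Phi> u \<omega>) 0 = 0"
  using AE_regular
proof eventually_elim
  case (elim \<omega>)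
  show ?case
  proof
    assume "cluster_size (\<lambda>u. \<Phi> u \<omega>) = Suc k"
    then obtain p where "p \<in> parent_functions k" "realises k p (\<lambda>u. \<Phi> u \<omega>)" using ex_realises[OF elim] by blast
    from epochs_realises(2)[OF this, of 0] show "epoch (\<lambda>u. \<Phi> u \<omega>) 0 = 0" by simp
  qed
qed

lemma kernel_integral_eq_mass:
  assumes fg: "\<And>t. f t = (if 0 < t then g t else 0)" and g: "set_integrable lborel {0..} g"
  shows "kernel_integral g t = mass {..t}"
  unfolding kernel_integral_def mass_def set_lebesgue_integral_def
proof (rule integral_cong_AE)
  have m: "(\<lambda>u. indicator {0..} u *\<^sub>R g u) \<in> borel_measurable lborel"
    using g by (auto simp: set_integrable_def)
  have "(\<lambda>u. indicator {0..t} u *\<^sub>R g u) = (\<lambda>u. indicator {..t} u *\<^sub>R (indicator {0..} u *\<^sub>R g u))"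
    by (auto simp: indicator_def)
  then show "(\<lambda>u. indicator {0..t} u *\<^sub>R g u) \<in> borel_measurable lborel" using m by simp
  \<comment> \<open>The two integrands differ at most at \<open>u = 0\<close>.\<close>
  show "AE u in lborel. indicator {0..t} u *\<^sub>R g u = indicator {..t} u *\<^sub>R f u"
    using AE_lborel_singleton[of 0] by eventually_elim (auto simp: fg indicator_def)
qed simp

lemma measurable_compensator_points:
  assumes "\<And>t. kernel_integral g t = mass {..t}"
  shows "(\<lambda>\<omega>. \<lambda>i\<in>{1..k}. compensator_point g (\<lambda>u. \<Phi> u \<omega>) i) \<in> M \<rightarrow>\<^sub>M lebesgue_prod k"
proof (rule measurable_restrict)
  fix i
  show "(\<lambda>\<omega>. compensator_point g (\<lambda>u. \<Phi> u \<omega>) i) \<in> M \<rightarrow>\<^sub>M lborel"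
    unfolding compensator_point_def assms measurable_lborel1
    by (intro borel_measurable_sum measurable_compose[OF _ measurable_mass_atMost] borel_measurable_diff
        measurable_epoch measurable_\<Phi>)
qed

lemma compensator_points_law:
  assumes g: "\<And>t. kernel_integral g t = mass {..t}" and B: "B \<in> sets (lebesgue_prod k)"
  shows "emeasure M {\<omega> \<in> space M. cluster_size (\<lambda>u. \<Phi> u \<omega>) = Suc k \<and>
      (\<lambda>i\<in>{1..k}. compensator_point g (\<lambda>u. \<Phi> u \<omega>) i) \<in> B} =
    ennreal (exp (- real (Suc k) * rho)) * emeasure (lebesgue_prod k) ({y \<in> space (lebesgue_prod k). in_polytope k y} \<inter> B)"
proof -
  let ?S = "{\<omega> \<in> space M. cluster_size (\<lambda>u. \<Phi> u \<omega>) = Suc k}"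
  let ?X = "\<lambda>\<omega>. \<lambda>i\<in>{1..k}. compensator_point g (\<lambda>u. \<Phi> u \<omega>) i"
  let ?Y = "\<lambda>\<omega>. \<lambda>i\<in>{1..k}. compensator i (epochs k \<omega>)"
  have XY: "?X \<omega> = ?Y \<omega>" if "epoch (\<lambda>u. \<Phi> u \<omega>) 0 = 0" for \<omega>
  proof -
    have "rooted (epochs k \<omega>) i = epoch (\<lambda>u. \<Phi> u \<omega>) i" if "i \<le> k" for i
      using that \<open>epoch (\<lambda>u. \<Phi> u \<omega>) 0 = 0\<close> by (auto simp: rooted_def epochs_def)
    then show ?thesis by (auto simp: fun_eq_iff compensator_point_def compensator_def g)
  qed
  have eq: "{\<omega> \<in> space M. cluster_size (\<lambda>u. \<Phi> u \<omega>) = Suc k \<and> Z \<omega> \<in> B} = ?S \<inter> (Z -` B \<inter> space M)"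
    for Z :: "'a \<Rightarrow> nat \<Rightarrow> real" by auto
  have "emeasure M (?S \<inter> (?X -` B \<inter> space M)) = emeasure M (?S \<inter> (?Y -` B \<inter> space M))"
  proof (rule emeasure_eq_AE)
    show "AE \<omega> in M. (\<omega> \<in> ?S \<inter> (?X -` B \<inter> space M)) = (\<omega> \<in> ?S \<inter> (?Y -` B \<inter> space M))"
      using AE_epoch_0[of k] by eventually_elim (use XY in auto)
    show "?S \<inter> (?X -` B \<inter> space M) \<in> events"
      using measurable_sets[OF measurable_compensator_points[OF g] B] size_event by simp
    show "?S \<inter> (?Y -` B \<inter> space M) \<in> events"
      using measurable_sets[OF measurable_compose[OF measurable_epochs measurable_compensators] B] size_event by simp
  qed
  then have "emeasure M {\<omega> \<in> space M. cluster_size (\<lambda>u. \<Phi> u \<omega>) = Suc k \<and> ?X \<omega> \<in> B} =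
      ennreal (exp (- real (Suc k) * rho)) * (\<integral>\<^sup>+y. indicator {y. in_polytope k y} y * indicator B y \<partial>lebesgue_prod k)"
    unfolding eq[symmetric] compensator_law[OF B] .
  also have "(\<integral>\<^sup>+y. indicator {y. in_polytope k y} y * indicator B y \<partial>lebesgue_prod k) =
      (\<integral>\<^sup>+y. indicator ({y \<in> space (lebesgue_prod k). in_polytope k y} \<inter> B) y \<partial>lebesgue_prod k)"
    by (intro nn_integral_cong) (auto simp: indicator_def)
  also have "\<dots> = emeasure (lebesgue_prod k) ({y \<in> space (lebesgue_prod k). in_polytope k y} \<inter> B)"
    by (intro nn_integral_indicator sets.Int in_polytope_sets B)
  finally show ?thesis .
qed

lemma volume_in_polytope:
  "emeasure (lebesgue_prod k) {y \<in> space (lebesgue_prod k). in_polytope k y} = ennreal (goncarov rho k (real (Suc k) * rho))"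
proof -
  have "emeasure (lebesgue_prod k) {y \<in> space (lebesgue_prod k). in_polytope k y} =
      (\<integral>\<^sup>+y. indicator {y \<in> space (lebesgue_prod k). in_polytope k y} y \<partial>lebesgue_prod k)"
    by (rule nn_integral_indicator[OF in_polytope_sets, symmetric])
  also have "\<dots> = (\<integral>\<^sup>+y. indicator {y. in_polytope k y} y \<partial>lebesgue_prod k)"
    by (intro nn_integral_cong) (simp add: indicator_def)
  finally show ?thesis unfolding nn_integral_in_polytope .
qed

text \<open>The first factor collapses to \<open>r\<close>, which leaves
  \<open>r ^ k * (k + 1) ^ (k - 1) / fact k\<close>; the form with \<open>fact (Suc k)\<close> is
  the reciprocal of the claimed density.\<close>

lemma goncarov_volume: "goncarov r k (real (Suc k) * r) = r ^ k * real (Suc k) ^ k / fact (Suc k)"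
proof (cases k)
  case (Suc m)
  have "(real (Suc k) * r - real k * r) * (real (Suc k) * r) ^ m = r ^ k * real (Suc k) ^ m"
  proof -
    have "real (Suc k) * r - real k * r = r" by (simp add: algebra_simps)
    then show ?thesis unfolding power_mult_distrib by (simp add: Suc mult_ac del: of_nat_Suc)
  qed
  then have "goncarov r k (real (Suc k) * r) = r ^ k * real (Suc k) ^ m / fact k"
    by (simp add: goncarov_def Suc)
  also have "\<dots> = r ^ k * real (Suc k) ^ k / fact (Suc k)"
    by (simp add: Suc field_simps del: of_nat_Suc)
  finally show ?thesis .
qed (simp add: goncarov_def)

text \<open>Joint and marginal probability both carry \<open>exp (- real (Suc k) * rho)\<close>,
  which cancels; the normalisation left over is the volume of the polytope.\<close>

lemma conditional_law:
  assumes g: "\<And>t. kernel_integral g t = mass {..t}" and B: "B \<in> sets (lebesgue_prod k)" and rho: "0 < rho"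
  shows "emeasure (distr (uniform_measure M {\<omega> \<in> space M. cluster_size (\<lambda>u. \<Phi> u \<omega>) = Suc k}) (lebesgue_prod k)
       (\<lambda>\<omega>. \<lambda>i\<in>{1..k}. compensator_point g (\<lambda>u. \<Phi> u \<omega>) i)) B =
    emeasure (lebesgue_prod k) ({y \<in> space (lebesgue_prod k). in_polytope k y} \<inter> B) /
      ennreal (rho ^ k * real (Suc k) ^ k / fact (Suc k))"
proof -
  let ?S = "{\<omega> \<in> space M. cluster_size (\<lambda>u. \<Phi> u \<omega>) = Suc k}"
  let ?X = "\<lambda>\<omega>. \<lambda>i\<in>{1..k}. compensator_point g (\<lambda>u. \<Phi> u \<omega>) i"
  let ?P = "{y \<in> space (lebesgue_prod k). in_polytope k y}"
  let ?c = "exp (- real (Suc k) * rho)" and ?V = "rho ^ k * real (Suc k) ^ k / fact (Suc k)"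
  have X: "?X \<in> uniform_measure M ?S \<rightarrow>\<^sub>M lebesgue_prod k"
    using measurable_compensator_points[OF g] by (simp add: measurable_cong_sets[OF sets_uniform_measure refl])
  have "?S = {\<omega> \<in> space M. cluster_size (\<lambda>u. \<Phi> u \<omega>) = Suc k \<and> ?X \<omega> \<in> space (lebesgue_prod k)}"
    by (auto simp: space_PiM)
  then have "emeasure M ?S = ennreal ?c * emeasure (lebesgue_prod k) (?P \<inter> space (lebesgue_prod k))"
    using compensator_points_law[OF g sets.top] by simp
  also have "?P \<inter> space (lebesgue_prod k) = ?P" by auto
  \<comment> \<open>With \<open>n = Suc k\<close> this is the Borel probability
    \<open>exp (- n * rho) * (n * rho) ^ (n - 1) / fact n\<close>.\<close>
  finally have S: "emeasure M ?S = ennreal ?c * ennreal ?V"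
    unfolding volume_in_polytope goncarov_volume .
  have "emeasure (distr (uniform_measure M ?S) (lebesgue_prod k) ?X) B = emeasure (uniform_measure M ?S) (?X -` B \<inter> space M)"
    using X B by (simp add: emeasure_distr)
  also have "\<dots> = emeasure M (?S \<inter> (?X -` B \<inter> space M)) / emeasure M ?S"
    by (intro emeasure_uniform_measure size_event measurable_sets[OF measurable_compensator_points[OF g] B])
  also have "?S \<inter> (?X -` B \<inter> space M) = {\<omega> \<in> space M. cluster_size (\<lambda>u. \<Phi> u \<omega>) = Suc k \<and> ?X \<omega> \<in> B}" by auto
  also have "emeasure M {\<omega> \<in> space M. cluster_size (\<lambda>u. \<Phi> u \<omega>) = Suc k \<and> ?X \<omega> \<in> B} / emeasure M ?S =
      (ennreal ?c * emeasure (lebesgue_prod k) (?P \<inter> B)) / (ennreal ?c * ennreal ?V)"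
    unfolding S compensator_points_law[OF g B] ..
  also have "\<dots> = emeasure (lebesgue_prod k) (?P \<inter> B) / ennreal ?V"
    unfolding mult.commute[of "ennreal ?c"] by (rule divide_mult_eq) simp_all
  finally show ?thesis .
qed

end

theorem lemma2:
  fixes M :: "'a measure"
    and g :: "real \<Rightarrow> real"
    and \<rho> :: real
    and \<Phi> :: "nat list \<Rightarrow> 'a \<Rightarrow> real set"
    and N :: "'a \<Rightarrow> nat"
    and \<Lambda> :: "nat \<Rightarrow> 'a \<Rightarrow> real"
    and given_size :: "nat \<Rightarrow> 'a measure"
  assumes "prob_space M"
    and "\<And>t. 0 \<le> t \<Longrightarrow> 0 \<le> g t"
    and "set_integrable lborel {0..} g"
    and "\<rho> = (LINT t:{0..}|lborel. g t)"
    and "0 < \<rho>" and "\<rho> < 1"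
    and "hawkes_offspring M g \<Phi>"
  defines "N \<equiv> \<lambda>\<omega>. cluster_size (\<lambda>u. \<Phi> u \<omega>)"
    and "\<Lambda> \<equiv> \<lambda>i \<omega>. compensator_point g (\<lambda>u. \<Phi> u \<omega>) i"
    and "given_size \<equiv> \<lambda>n. uniform_measure M {\<omega> \<in> space M. N \<omega> = n}"
  shows "(\<forall>k\<ge>1. distributed (given_size (k + 1)) (lebesgue_prod k)
            (\<lambda>\<omega>. \<lambda>i\<in>{1..k}. \<Lambda> i \<omega>)
            (\<lambda>x. if 0 < x 1 \<and> (\<forall>i\<in>{1..<k}. x i < x (i + 1)) \<and> x k < real k * \<rho> \<and>
                    (\<forall>i\<in>{1..k}. x i < real i * \<rho>)
                 then ennreal ((1 / \<rho>) ^ k * (fact (k + 1) / real (k + 1) ^ k))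
                 else 0)) \<and>
         (\<forall>k. distr (given_size (k + 1)) (lebesgue_prod k) (\<lambda>\<omega>. \<lambda>i\<in>{1..k}. \<Lambda> i \<omega>) =
            uniform_measure (lebesgue_prod k) (hawkes_polytope \<rho> k))"
proof -
  define f where "f t = (if 0 < t then g t else 0)" for t
  have f_eq: "f = (\<lambda>t. indicator {0<..} t *\<^sub>R (indicator {0..} t *\<^sub>R g t))"
    by (auto simp: f_def indicator_def)
  have f_int: "integrable lborel f"
    unfolding f_eq by (rule integrable_mult_indicator[OF _ assms(3)[unfolded set_integrable_def]]) simp
  interpret hawkes_cluster M f \<Phi>
  proof (intro hawkes_cluster.intro hawkes_cluster_axioms.intro)
    show "poisson_process M f (\<Phi> u)" for u
      using assms(7) by (simp add: hawkes_offspring_def f_def[abs_def])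
    show "prob_space.indep_vars M (\<lambda>_. config_space) \<Phi> UNIV"
      using assms(7) by (simp add: hawkes_offspring_def)
  qed (use assms(1,2) f_int in \<open>auto simp: f_def\<close>)
  have g: "kernel_integral g t = mass {..t}" for t
    by (rule kernel_integral_eq_mass[OF f_def assms(3)])
  have rho: "rho = \<rho>"
    unfolding assms(4) rho_def set_lebesgue_integral_def
  proof (rule integral_cong_AE)
    show "AE t in lborel. f t = indicator {0..} t *\<^sub>R g t"
      using AE_lborel_singleton[of 0] by eventually_elim (auto simp: f_def indicator_def)
  qed (use assms(3) in \<open>auto simp: set_integrable_def\<close>)
  have rho_pos: "0 < rho" using assms(5) rho by simp
  let ?P = "\<lambda>k. {y \<in> space (lebesgue_prod k). in_polytope k y}"
  let ?V = "\<lambda>k. rho ^ k * real (Suc k) ^ k / fact (Suc k)"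
  let ?X = "\<lambda>k \<omega>. \<lambda>i\<in>{1..k}. \<Lambda> i \<omega>"
  have X: "?X k \<in> given_size n \<rightarrow>\<^sub>M lebesgue_prod k" for k n
    using measurable_compensator_points[OF g, of k]
    by (simp add: given_size_def \<Lambda>_def measurable_cong_sets[OF sets_uniform_measure refl])
  have law: "emeasure (distr (given_size (k + 1)) (lebesgue_prod k) (?X k)) B =
      emeasure (lebesgue_prod k) (?P k \<inter> B) / ennreal (?V k)" if "B \<in> sets (lebesgue_prod k)" for k B
    using conditional_law[OF g that rho_pos] by (simp add: given_size_def N_def \<Lambda>_def)
  have volume: "emeasure (lebesgue_prod k) (?P k) = ennreal (?V k)" for k
    by (simp only: volume_in_polytope goncarov_volume)
  have increasing_iff: "increasing_epochs k x \<longleftrightarrow> 0 < x 1 \<and> (\<forall>i\<in>{1..<k}. x i < x (i + 1))" if "k \<ge> 1" for k x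
  proof
    assume inc: "increasing_epochs k x"
    show "0 < x 1 \<and> (\<forall>i\<in>{1..<k}. x i < x (i + 1))"
    proof (intro conjI ballI)
      show "0 < x 1" using inc that by (auto simp: increasing_epochs_def rooted_def dest: spec[of _ 0])
      show "x i < x (i + 1)" if "i \<in> {1..<k}" for i
        using inc that by (auto simp: increasing_epochs_def rooted_def dest: spec[of _ i])
    qed
  qed (auto simp: increasing_epochs_def rooted_def)
  have distributed: "distributed (given_size (k + 1)) (lebesgue_prod k) (?X k)
            (\<lambda>x. if 0 < x 1 \<and> (\<forall>i\<in>{1..<k}. x i < x (i + 1)) \<and> x k < real k * \<rho> \<and>
                    (\<forall>i\<in>{1..k}. x i < real i * \<rho>)
                 then ennreal ((1 / \<rho>) ^ k * (fact (k + 1) / real (k + 1) ^ k))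
                 else 0)" (is "distributed _ _ _ ?d") if k: "k \<ge> 1" for k
  proof -
    \<comment> \<open>The claimed constant is the reciprocal volume of the polytope.\<close>
    have const: "(1 / \<rho>) ^ k * (fact (k + 1) / real (k + 1) ^ k) = 1 / ?V k"
      unfolding rho by (simp add: power_one_over field_simps)
    have d: "?d x = ennreal (1 / ?V k) * indicator (?P k) x" if "x \<in> space (lebesgue_prod k)" for x
      using that k unfolding const by (auto simp: in_polytope_def increasing_iff rho indicator_def)
    have dm: "?d \<in> borel_measurable (lebesgue_prod k)"
      by (rule measurable_cong[THEN iffD2, OF d]) (use in_polytope_sets[of k] in simp_all)
    have "distr (given_size (k + 1)) (lebesgue_prod k) (?X k) = density (lebesgue_prod k) ?d"
    proof (rule measure_eqI)
      fix B assume "B \<in> sets (distr (given_size (k + 1)) (lebesgue_prod k) (?X k))"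
      then have B: "B \<in> sets (lebesgue_prod k)" by simp
      have "emeasure (density (lebesgue_prod k) ?d) B = (\<integral>\<^sup>+x. ?d x * indicator B x \<partial>lebesgue_prod k)"
        by (rule emeasure_density[OF dm B])
      also have "\<dots> = (\<integral>\<^sup>+x. ennreal (1 / ?V k) * indicator (?P k \<inter> B) x \<partial>lebesgue_prod k)"
        by (intro nn_integral_cong) (simp only: d indicator_inter_arith mult.assoc)
      also have "\<dots> = ennreal (1 / ?V k) * emeasure (lebesgue_prod k) (?P k \<inter> B)"
        by (intro nn_integral_cmult_indicator sets.Int in_polytope_sets B)
      also have "\<dots> = emeasure (lebesgue_prod k) (?P k \<inter> B) / ennreal (?V k)"
        using rho_pos by (simp add: divide_ennreal_def inverse_ennreal mult.commute inverse_eq_divide)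
      finally show "emeasure (distr (given_size (k + 1)) (lebesgue_prod k) (?X k)) B = emeasure (density (lebesgue_prod k) ?d) B"
        unfolding law[OF B] by simp
    qed simp
    then show ?thesis unfolding distributed_def using dm X by blast
  qed
  have uniform: "distr (given_size (k + 1)) (lebesgue_prod k) (?X k) = uniform_measure (lebesgue_prod k) (hawkes_polytope \<rho> k)" for k
  proof -
    interpret L: product_sigma_finite "\<lambda>_. lborel :: real measure" by standard
    \<comment> \<open>\<open>hawkes_polytope\<close> admits \<open>x 1 = 0\<close>, which
      \<open>in_polytope\<close> excludes; the difference lies in this hyperplane. For
      \<open>k = 0\<close> there is no coordinate 1, and \<open>Z\<close> is empty.\<close>
    define Z where "Z = {x \<in> space (lebesgue_prod k). 1 \<le> k \<and> x 1 = 0}"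
    have Z: "Z \<in> null_sets (lebesgue_prod k)"
    proof (cases "1 \<le> k")
      case True
      let ?A = "\<lambda>i::nat. if i = 1 then {0::real} else UNIV"
      have "Z = PiE {1..k} ?A" using True by (auto simp: Z_def space_PiM PiE_iff extensional_def split: if_splits)
      moreover have "emeasure (lebesgue_prod k) (PiE {1..k} ?A) = (\<Prod>i\<in>{1..k}. emeasure lborel (?A i))"
        by (rule L.emeasure_PiM) auto
      moreover have "(\<Prod>i\<in>{1..k}. emeasure lborel (?A i)) = 0"
        using True by (intro prod_zero bexI[of _ 1]) auto
      moreover have "PiE {1..k} ?A \<in> sets (lebesgue_prod k)" by (intro sets_PiM_I_finite) auto
      ultimately show ?thesis by auto
    qed (simp add: Z_def)
    have H: "hawkes_polytope \<rho> k \<in> sets (lebesgue_prod k)"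
    proof -
      have c: "(\<lambda>x. x i) \<in> borel_measurable (lebesgue_prod k)" if "i \<in> {1..k}" for i
        using measurable_component_singleton[OF that, of "\<lambda>_. lborel :: real measure"] by simp
      have "{x \<in> space (lebesgue_prod k). \<forall>i\<in>{1..k}. 0 \<le> x i} \<inter>
          ({x \<in> space (lebesgue_prod k). \<forall>i\<in>{1..k}. x i < real i * \<rho>} \<inter>
           {x \<in> space (lebesgue_prod k). \<forall>i\<in>{1..<k}. x i < x (i + 1)}) \<in> sets (lebesgue_prod k)"
        by (intro sets.Int sets.sets_Collect_finite_All borel_measurable_less borel_measurable_le c) auto
      also have "{x \<in> space (lebesgue_prod k). \<forall>i\<in>{1..k}. 0 \<le> x i} \<inter>
          ({x \<in> space (lebesgue_prod k). \<forall>i\<in>{1..k}. x i < real i * \<rho>} \<inter>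
           {x \<in> space (lebesgue_prod k). \<forall>i\<in>{1..<k}. x i < x (i + 1)}) = hawkes_polytope \<rho> k"
        by (auto simp: hawkes_polytope_def space_PiM PiE_iff)
      finally show ?thesis .
    qed
    have AE: "AE x in lebesgue_prod k. x \<in> hawkes_polytope \<rho> k \<longleftrightarrow> x \<in> ?P k"
      using AE_not_in[OF Z] AE_space
    proof eventually_elim
      case (elim x)
      show ?case
      proof (cases "k = 0")
        case True
        then show ?thesis using elim by (simp add: hawkes_polytope_def in_polytope_def increasing_epochs_def space_PiM)
      next
        case False
        then have k: "k \<ge> 1" by simp
        have "0 \<le> x i" if "increasing_epochs k x" "i \<in> {1..k}" for i
        proof -
          have "j \<le> k \<Longrightarrow> 0 \<le> rooted x j" for j
          proof (induction j)
            case (Suc j)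
            then have "rooted x j < rooted x (Suc j)" using \<open>increasing_epochs k x\<close> by (simp only: increasing_epochs_def Suc_le_eq)
            then show ?case using Suc by simp
          qed simp
          from this[of i] show ?thesis using that by (auto simp: rooted_def)
        qed
        moreover have "x \<in> {1..k} \<rightarrow>\<^sub>E {0..} \<longleftrightarrow> (\<forall>i\<in>{1..k}. 0 \<le> x i)"
          using elim by (auto simp: space_PiM PiE_iff)
        moreover have "0 \<le> x 1 \<Longrightarrow> 0 < x 1" using elim k by (auto simp: Z_def)
        moreover have "1 \<in> {1..k}" using k by simp
        ultimately show ?thesis
          using elim(2) unfolding hawkes_polytope_def in_polytope_def mem_Collect_eq increasing_iff[OF k] rho
          by blast
      qed
    qed
    show ?thesis
    proof (rule measure_eqI)
      fix B assume "B \<in> sets (distr (given_size (k + 1)) (lebesgue_prod k) (?X k))"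
      then have B: "B \<in> sets (lebesgue_prod k)" by simp
      have "emeasure (lebesgue_prod k) (hawkes_polytope \<rho> k \<inter> B) = emeasure (lebesgue_prod k) (?P k \<inter> B)"
        using AE B H in_polytope_sets by (intro emeasure_eq_AE) (auto elim!: eventually_mono)
      moreover have "emeasure (lebesgue_prod k) (hawkes_polytope \<rho> k) = emeasure (lebesgue_prod k) (?P k)"
        using AE H in_polytope_sets by (intro emeasure_eq_AE) (auto elim!: eventually_mono)
      ultimately show "emeasure (distr (given_size (k + 1)) (lebesgue_prod k) (?X k)) B =
          emeasure (uniform_measure (lebesgue_prod k) (hawkes_polytope \<rho> k)) B"
        unfolding law[OF B] emeasure_uniform_measure[OF H B] volume by simp
    qed simp
  qed
  show ?thesis using distributed uniform by blast
qed

end
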